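(* Let $1<\beta\le2$, $t\in\mathbb R$ and let $\mathcal L_t:\mathcal F\to\mathcal F$ be the transfer operator of the potential $t\chi_{C_1}$. Then the following hold. (1) Let $\lambda\in\mathbb C$ be an isolated eigenvalue of $\mathcal L_t$ with $|\lambda|>r_t$. Then the geometric multiplicity of $\lambda$ is $1$, and for the corresponding eigenfunctional $\nu$ with $\nu(1)=1$ we have $$\nu(\chi_{[\underline 0,\underline a]})=\sum_{n=1}^\infty\frac{a_nH_{n-1}(t,\underline a)}{\lambda^n}\qquad(\ast)$$ for every $\underline a=(a_i)_{i=1}^\infty\in X_\beta$. Furthermore, any corresponding eigenfunction $h$ is of the form $$h=C\cdot\sum_{n=0}^\infty\frac{H_n(t,\underline1)}{\lambda^n}\chi_{[\underline0,\sigma^n(\underline1)]},\qquad C\in\mathbb C.$$ (2) The positive eigenvalue $\lambda_t>r_t$ of $\mathcal L_t$ is simple. The corresponding eigenfunctional $\nu_t$ with $\nu_t(1)=1$ is expressed as a non-atomic probability measure on $X_\beta$ satisfying $(\ast)$ for $\lambda=\lambda_t$. In addition, $\mu_t:=h_t\nu_t$ is a $\sigma$-invariant probability measure on $X_\beta$, where $$h_t=\frac1{F(t)}\sum_{n=0}^\infty\frac{H_n(t,\underline1)}{\lambda_t^n}\chi_{[\underline0,\sigma^n(\underline1)]},\qquad F(t)=\sum_{n=1}^\infty\frac{n\,q_n(1)H_{n-1}(t,\underline1)}{\lambda_t^n}.$$ (3) The positive eigenvalue $\lambda_t$ is the unique leading eigenvalue of $\mathcal L_t$, that is, $|\lambda|<\lambda_t$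 for any other isolated eigenvalue $\lambda\in\mathbb C$ with $|\lambda|>r_t$. In addition, there is a positive constant $K$ such that $$\left|\int_{X_\beta}f\cdot g\circ\sigma^n\,d\mu_t-\int_{X_\beta}f\,d\mu_t\cdot\int_{X_\beta}g\,d\mu_t\right|\le K\|f\|_{\mathcal B}\|g\|_{L^1(\mu_t)}\alpha^n$$ for all $n\ge1$, $f\in\mathcal F$ and $g\in L^1(\mu_t)$, where $\mu_t=h_t\nu_t$ and $$\alpha=\max\Bigl\{r_t,\ \max\{|\lambda|:\ 1-\phi_t(\lambda^{-1})=0,\ \lambda\ne\lambda_t\}\Bigr\}\in[r_t,\lambda_t).$$ In particular, $(\sigma,\mu_t)$ is exponentially mixing.
   Context: For $1<\beta\le2$, $\tau_\beta(x)=\beta x-[\beta x]$ on $[0,1]$ and $g_n(x)=[\beta\tau_\beta^{n-1}(x)]$ are the greedy digits of $x$. $\{0,1\}^{\mathbb N}$ carries the product topology, the lexicographic order $\preceq$ and the left shift $\sigma$. $\underline0=000\cdots$ and $\underline1=(q_n(1))_{n\ge1}:=\lim_{y\nearrow1}(g_n(y))_{n\ge1}$ (quasi-greedy expansion of $1$). The beta-shift is $X_\beta=\{\underline x\in\{0,1\}^{\mathbb N}:\sigma^n(\underline x)\preceq\underline1\ \forall n\ge0\}$ with the map $\sigma$. For $\underline a,\underline b\in X_\beta$, $[\underline a,\underline b]=\{\underline x\in X_\beta:\underline a\preceq\underline x\preceq\underline b\}$; $\chi_A$ is the indicator function of $A$. Function spaces: for $f:X_\beta\to\mathbb C$, $\mathrm{var}(f)$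 is the supremum of $\sum_{i=1}^n|f(x_i)-f(x_{i-1})|$ over finite chains $\underline0=x_0\prec x_1\prec\dots\prec x_n=\underline1$ in $X_\beta$; $BV=\{f:\mathrm{var}(f)<\infty\}$ with norm $\|f\|_{BV}=|f|_\infty+\mathrm{var}(f)$, $|f|_\infty=\sup|f|$. $\mathcal N$ is the set of $f\in BV$ vanishing off a countable set, $\mathcal B=BV/\mathcal N$ with the quotient norm $\|f\|_{\mathcal B}=\inf_{g\in\mathcal N}\|f+g\|_{BV}$, and $\mathcal F\subset\mathcal B$ is the closure in $\mathcal B$ of the linear span of indicator functions of intervals in $X_\beta$. $\mathcal F^*$ is the dual Banach space. Operator: $C_1=\{(x_i)\in X_\beta:x_1=1\}$; $\mathcal L_tf(x)=\sum_{y:\sigma(y)=x}e^{t\chi_{C_1}(y)}f(y)$, a bounded operator on $\mathcal F$; $\mathcal L_t^*\nu=\nu\circ\mathcal L_t$ on $\mathcal F^*$. An eigenfunctional of $\lambda$ is a nonzero $\nu\in\mathcal F^*$ with $\mathcal L_t^*\nu=\lambda\nu$. Geometric multiplicity is $\dim\ker(\lambda I-\mathcal L_t)$ in $\mathcal F$; algebraic multiplicity is the dimension of the generalized eigenspace; simple means algebraic multiplicity $1$. $\lambda_t>0$ and $\nu_t\in\mathcal F^*$ denote an eigenvalue and eigenfunctional with $\mathcal L_t^*\nu_t=\lambda_t\nu_t$, $\nu_t(f)\ge0$ for $f\ge0$, $\nu_t(1)=1$ (such a pair exists). $r_t=\limsup_{n\to\infty}|e^{tS_n\chi_{C_1}}|_\infty^{1/n}$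 with $S_nf=\sum_{i=0}^{n-1}f\circ\sigma^i$. For $\underline x=(x_i)\in X_\beta$: $H_0(t,\underline x)=1$, $H_n(t,\underline x)=\exp(t\sum_{i=1}^nx_i)$ for $n\ge1$. $\phi_t(z)=\sum_{n=1}^\infty q_n(1)H_{n-1}(t,\underline1)z^n$ (a power series with radius of convergence at least $r_t^{-1}$; zeros of $1-\phi_t$ are taken in its disc of convergence). If there is no zero other than $\lambda_t^{-1}$, the inner maximum in (3) is omitted. *)

theory Defs
  imports "HOL-Analysis.Analysis" "HOL-Library.Fun_Lexorder" "HOL-Probability.Probability"
begin

text \<open>
  Sequences are indexed from 0: \<open>x i\<close> is the digit $x_{i+1}$. The type \<open>nat \<Rightarrow> nat\<close> carries the
  product of the discrete topologies, of which $\{0,1\}^{\mathbb N}$ is a subspace. Eigenvalues are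
  called \<open>\<kappa>\<close>, as the Greek letter lambda is not available as a variable.
\<close>

type_synonym digits = "nat \<Rightarrow> nat"

definition lex_le :: "digits \<Rightarrow> digits \<Rightarrow> bool"  (infix "\<preceq>" 50)
  where "x \<preceq> y \<longleftrightarrow> less_fun x y \<or> x = y"

definition shift :: "digits \<Rightarrow> digits"
  where "shift x = (\<lambda>n. x (Suc n))"

definition tau :: "real \<Rightarrow> real \<Rightarrow> real"
  where "tau \<beta> x = \<beta> * x - of_int \<lfloor>\<beta> * x\<rfloor>"

definition greedy :: "real \<Rightarrow> real \<Rightarrow> digits"
  where "greedy \<beta> x = (\<lambda>n. nat \<lfloor>\<beta> * (tau \<beta> ^^ n) x\<rfloor>)"

definition zero_seq :: digits
  where "zero_seq = (\<lambda>n. 0)"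

definition one_seq :: "real \<Rightarrow> digits"
  where "one_seq \<beta> = (THE s. (greedy \<beta> \<longlongrightarrow> s) (at_left 1))"

definition beta_shift :: "real \<Rightarrow> digits set"
  where "beta_shift \<beta> = {x. (\<forall>i. x i \<in> {0, 1}) \<and> (\<forall>n. (shift ^^ n) x \<preceq> one_seq \<beta>)}"

definition ival :: "real \<Rightarrow> digits \<Rightarrow> digits \<Rightarrow> digits set"
  where "ival \<beta> a b = {x \<in> beta_shift \<beta>. a \<preceq> x \<and> x \<preceq> b}"

definition cyl1 :: "real \<Rightarrow> digits set"
  where "cyl1 \<beta> = {x \<in> beta_shift \<beta>. x 0 = 1}"


section \<open>The spaces BV, B and F\<close>

text \<open>
  A function on \<^term>\<open>beta_shift \<beta>\<close> is represented by a total function whose values elsewhere are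
  irrelevant. Passing to classes modulo \<open>null_fun \<beta>\<close> also identifies functions that agree on
  \<^term>\<open>beta_shift \<beta>\<close>.
\<close>

definition var_chains :: "real \<Rightarrow> (nat \<times> (nat \<Rightarrow> digits)) set"
  where "var_chains \<beta> = {(n, c). c 0 = zero_seq \<and> c n = one_seq \<beta> \<and>
           (\<forall>i\<le>n. c i \<in> beta_shift \<beta>) \<and> (\<forall>i<n. less_fun (c i) (c (Suc i)))}"

definition var :: "real \<Rightarrow> (digits \<Rightarrow> complex) \<Rightarrow> ennreal"
  where "var \<beta> f = (SUP (n, c) \<in> var_chains \<beta>. ennreal (\<Sum>i<n. cmod (f (c (Suc i)) - f (c i))))"

definition BV :: "real \<Rightarrow> (digits \<Rightarrow> complex) set"
  where "BV \<beta> = {f. var \<beta> f < \<infinity>}"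

definition BV_norm :: "real \<Rightarrow> (digits \<Rightarrow> complex) \<Rightarrow> real"
  where "BV_norm \<beta> f = (SUP x\<in>beta_shift \<beta>. cmod (f x)) + enn2real (var \<beta> f)"

definition null_fun :: "real \<Rightarrow> (digits \<Rightarrow> complex) set"
  where "null_fun \<beta> = {f \<in> BV \<beta>. countable {x \<in> beta_shift \<beta>. f x \<noteq> 0}}"

definition cls :: "real \<Rightarrow> (digits \<Rightarrow> complex) \<Rightarrow> (digits \<Rightarrow> complex) set"
  where "cls \<beta> f = {(\<lambda>x. f x + g x) | g. g \<in> null_fun \<beta>}"

type_synonym fclass = "(digits \<Rightarrow> complex) set"

definition B_space :: "real \<Rightarrow> fclass set"
  where "B_space \<beta> = cls \<beta> ` BV \<beta>"

definition B_zero :: "real \<Rightarrow> fclass"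
  where "B_zero \<beta> = cls \<beta> (\<lambda>_. 0)"

definition B_one :: "real \<Rightarrow> fclass"
  where "B_one \<beta> = cls \<beta> (\<lambda>_. 1)"

definition B_add :: "real \<Rightarrow> fclass \<Rightarrow> fclass \<Rightarrow> fclass"
  where "B_add \<beta> u v = (\<Union>f\<in>u. \<Union>g\<in>v. cls \<beta> (\<lambda>x. f x + g x))"

definition B_scale :: "real \<Rightarrow> complex \<Rightarrow> fclass \<Rightarrow> fclass"
  where "B_scale \<beta> c u = (\<Union>f\<in>u. cls \<beta> (\<lambda>x. c * f x))"

definition B_diff :: "real \<Rightarrow> fclass \<Rightarrow> fclass \<Rightarrow> fclass"
  where "B_diff \<beta> u v = B_add \<beta> u (B_scale \<beta> (-1) v)"

text \<open>The elements of \<open>cls \<beta> f\<close> are exactly the $f+g$ with $g$ in \<open>null_fun \<beta>\<close>.\<close>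
definition B_norm :: "real \<Rightarrow> fclass \<Rightarrow> real"
  where "B_norm \<beta> u = (INF f\<in>u. BV_norm \<beta> f)"

definition step_fun :: "real \<Rightarrow> (digits \<Rightarrow> complex) set"
  where "step_fun \<beta> = {(\<lambda>x. \<Sum>i<n. c i * indicator (ival \<beta> (a i) (b i)) x) | (n::nat) c a b.
           \<forall>i<n. a i \<in> beta_shift \<beta> \<and> b i \<in> beta_shift \<beta>}"

definition F_space :: "real \<Rightarrow> fclass set"
  where "F_space \<beta> = {u \<in> B_space \<beta>. \<forall>\<epsilon>>0. \<exists>s\<in>step_fun \<beta>. B_norm \<beta> (B_diff \<beta> u (cls \<beta> s)) < \<epsilon>}"

definition F_dual :: "real \<Rightarrow> (fclass \<Rightarrow> complex) set"
  where "F_dual \<beta> = {\<nu> \<in> extensional (F_space \<beta>).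
           (\<forall>u\<in>F_space \<beta>. \<forall>v\<in>F_space \<beta>. \<nu> (B_add \<beta> u v) = \<nu> u + \<nu> v) \<and>
           (\<forall>c. \<forall>u\<in>F_space \<beta>. \<nu> (B_scale \<beta> c u) = c * \<nu> u) \<and>
           (\<exists>C. \<forall>u\<in>F_space \<beta>. cmod (\<nu> u) \<le> C * B_norm \<beta> u)}"

primrec lincomb :: "real \<Rightarrow> (nat \<Rightarrow> complex) \<Rightarrow> (nat \<Rightarrow> fclass) \<Rightarrow> nat \<Rightarrow> fclass"
  where "lincomb \<beta> c e 0 = B_zero \<beta>"
      | "lincomb \<beta> c e (Suc n) = B_add \<beta> (lincomb \<beta> c e n) (B_scale \<beta> (c n) (e n))"

text \<open>\<open>V\<close> has a basis \<open>e 0, \<dots>, e (n-1)\<close>: coordinates are a bijection of $\mathbb C^n$ onto \<open>V\<close>.\<close>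
definition has_dim :: "real \<Rightarrow> fclass set \<Rightarrow> nat \<Rightarrow> bool"
  where "has_dim \<beta> V n \<longleftrightarrow> (\<exists>e. bij_betw (\<lambda>c. lincomb \<beta> c e n) ({..<n} \<rightarrow>\<^sub>E UNIV) V)"


section \<open>The transfer operator and its spectrum\<close>

definition transfer_fun :: "real \<Rightarrow> real \<Rightarrow> (digits \<Rightarrow> complex) \<Rightarrow> digits \<Rightarrow> complex"
  where "transfer_fun \<beta> t f x =
           (\<Sum>y | y \<in> beta_shift \<beta> \<and> shift y = x. of_real (exp (t * indicator (cyl1 \<beta>) y)) * f y)"

definition transfer :: "real \<Rightarrow> real \<Rightarrow> fclass \<Rightarrow> fclass"
  where "transfer \<beta> t u = (\<Union>f\<in>u. cls \<beta> (transfer_fun \<beta> t f))"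

definition shifted_op :: "real \<Rightarrow> real \<Rightarrow> complex \<Rightarrow> fclass \<Rightarrow> fclass"
  where "shifted_op \<beta> t \<kappa> u = B_diff \<beta> (B_scale \<beta> \<kappa> u) (transfer \<beta> t u)"

definition eigenspace :: "real \<Rightarrow> real \<Rightarrow> complex \<Rightarrow> fclass set"
  where "eigenspace \<beta> t \<kappa> = {h \<in> F_space \<beta>. shifted_op \<beta> t \<kappa> h = B_zero \<beta>}"

definition gen_eigenspace :: "real \<Rightarrow> real \<Rightarrow> complex \<Rightarrow> fclass set"
  where "gen_eigenspace \<beta> t \<kappa> = {h \<in> F_space \<beta>. \<exists>k. (shifted_op \<beta> t \<kappa> ^^ k) h = B_zero \<beta>}"

definition eigenfunctions :: "real \<Rightarrow> real \<Rightarrow> complex \<Rightarrow> fclass set"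
  where "eigenfunctions \<beta> t \<kappa> =
           {h \<in> F_space \<beta>. h \<noteq> B_zero \<beta> \<and> transfer \<beta> t h = B_scale \<beta> \<kappa> h}"

definition spectrum :: "real \<Rightarrow> real \<Rightarrow> complex set"
  where "spectrum \<beta> t = {\<kappa>. \<not> (bij_betw (shifted_op \<beta> t \<kappa>) (F_space \<beta>) (F_space \<beta>) \<and>
           (\<exists>C. \<forall>u\<in>F_space \<beta>. B_norm \<beta> u \<le> C * B_norm \<beta> (shifted_op \<beta> t \<kappa> u)))}"

definition isolated_eigenvalue :: "real \<Rightarrow> real \<Rightarrow> complex \<Rightarrow> bool"
  where "isolated_eigenvalue \<beta> t \<kappa> \<longleftrightarrow>
           eigenfunctions \<beta> t \<kappa> \<noteq> {} \<and> \<kappa> isolated_in spectrum \<beta> t"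

definition eigenfunctional :: "real \<Rightarrow> real \<Rightarrow> complex \<Rightarrow> (fclass \<Rightarrow> complex) \<Rightarrow> bool"
  where "eigenfunctional \<beta> t \<kappa> \<nu> \<longleftrightarrow> \<nu> \<in> F_dual \<beta> \<and> (\<exists>u\<in>F_space \<beta>. \<nu> u \<noteq> 0) \<and>
           (\<forall>u\<in>F_space \<beta>. \<nu> (transfer \<beta> t u) = \<kappa> * \<nu> u)"

definition nonneg_class :: "real \<Rightarrow> fclass \<Rightarrow> bool"
  where "nonneg_class \<beta> u \<longleftrightarrow> (\<exists>f\<in>u. \<forall>x\<in>beta_shift \<beta>. f x \<in> \<real>\<^sub>\<ge>\<^sub>0)"

text \<open>The pair $(\lambda_t,\nu_t)$.\<close>
definition positive_eigenpair :: "real \<Rightarrow> real \<Rightarrow> real \<Rightarrow> (fclass \<Rightarrow> complex) \<Rightarrow> bool"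
  where "positive_eigenpair \<beta> t \<kappa> \<nu> \<longleftrightarrow> 0 < \<kappa> \<and> eigenfunctional \<beta> t (of_real \<kappa>) \<nu> \<and>
           (\<forall>u\<in>F_space \<beta>. nonneg_class \<beta> u \<longrightarrow> \<nu> u \<in> \<real>\<^sub>\<ge>\<^sub>0) \<and> \<nu> (B_one \<beta>) = 1"

definition r_rad :: "real \<Rightarrow> real \<Rightarrow> real"
  where "r_rad \<beta> t = real_of_ereal (limsup (\<lambda>n. ereal (root n
           (SUP x\<in>beta_shift \<beta>. exp (t * (\<Sum>i<n. indicator (cyl1 \<beta>) ((shift ^^ i) x)))))))"

definition H :: "nat \<Rightarrow> real \<Rightarrow> digits \<Rightarrow> real"
  where "H n t x = exp (t * (\<Sum>i<n. real (x i)))"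

definition eigfun :: "real \<Rightarrow> real \<Rightarrow> 'a::real_normed_field \<Rightarrow> digits \<Rightarrow> 'a"
  where "eigfun \<beta> t \<kappa> x = (\<Sum>n. of_real (H n t (one_seq \<beta>)) / \<kappa> ^ n *
           indicator (ival \<beta> zero_seq ((shift ^^ n) (one_seq \<beta>))) x)"

definition norm_const :: "real \<Rightarrow> real \<Rightarrow> real \<Rightarrow> real"
  where "norm_const \<beta> t \<kappa> =
           (\<Sum>n. real (Suc n) * real (one_seq \<beta> n) * H n t (one_seq \<beta>) / \<kappa> ^ Suc n)"

definition h_density :: "real \<Rightarrow> real \<Rightarrow> real \<Rightarrow> digits \<Rightarrow> real"
  where "h_density \<beta> t \<kappa> x = 1 / norm_const \<beta> t \<kappa> * eigfun \<beta> t \<kappa> x"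

definition phi_coeff :: "real \<Rightarrow> real \<Rightarrow> nat \<Rightarrow> complex"
  where "phi_coeff \<beta> t n = (case n of 0 \<Rightarrow> 0
           | Suc k \<Rightarrow> of_nat (one_seq \<beta> k) * of_real (H k t (one_seq \<beta>)))"

definition phi :: "real \<Rightarrow> real \<Rightarrow> complex \<Rightarrow> complex"
  where "phi \<beta> t z = (\<Sum>n. phi_coeff \<beta> t n * z ^ n)"

text \<open>Since \<open>phi \<beta> t 0 = 0\<close>, the convention \<open>inverse 0 = 0\<close> does not add \<open>\<kappa> = 0\<close> to this set.\<close>
definition other_moduli :: "real \<Rightarrow> real \<Rightarrow> real \<Rightarrow> real set"
  where "other_moduli \<beta> t \<kappa>t = {cmod \<kappa> | \<kappa>. ereal (cmod (inverse \<kappa>)) < conv_radius (phi_coeff \<beta> t) \<and>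
           1 - phi \<beta> t (inverse \<kappa>) = 0 \<and> \<kappa> \<noteq> of_real \<kappa>t}"

definition alpha :: "real \<Rightarrow> real \<Rightarrow> real \<Rightarrow> real"
  where "alpha \<beta> t \<kappa>t = (if other_moduli \<beta> t \<kappa>t = {} then r_rad \<beta> t
           else max (r_rad \<beta> t) (GREATEST r. r \<in> other_moduli \<beta> t \<kappa>t))"


section \<open>Measures\<close>

definition prob_on_beta_shift :: "real \<Rightarrow> digits measure \<Rightarrow> bool"
  where "prob_on_beta_shift \<beta> m \<longleftrightarrow>
           prob_space m \<and> sets m = sets (restrict_space borel (beta_shift \<beta>))"

definition non_atomic :: "'a measure \<Rightarrow> bool"
  where "non_atomic m \<longleftrightarrow> \<not> (\<exists>A\<in>sets m. emeasure m A > 0 \<and>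
           (\<forall>B\<in>sets m. B \<subseteq> A \<longrightarrow> emeasure m B = 0 \<or> emeasure m B = emeasure m A))"

definition shift_invariant :: "digits measure \<Rightarrow> bool"
  where "shift_invariant m \<longleftrightarrow> shift \<in> measurable m m \<and> distr m m shift = m"

definition correlation :: "digits measure \<Rightarrow> nat \<Rightarrow> (digits \<Rightarrow> complex) \<Rightarrow> (digits \<Rightarrow> complex) \<Rightarrow> complex"
  where "correlation m n f g =
           (\<integral>x. f x * g ((shift ^^ n) x) \<partial>m) - (\<integral>x. f x \<partial>m) * (\<integral>x. g x \<partial>m)"

definition correlation_bound :: "real \<Rightarrow> digits measure \<Rightarrow> real \<Rightarrow> real \<Rightarrow> bool"
  where "correlation_bound \<beta> m K \<theta> \<longleftrightarrow> (\<forall>n\<ge>1. \<forall>f g. cls \<beta> f \<in> F_space \<beta> \<longrightarrow> integrable m g \<longrightarrow>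
           cmod (correlation m n f g) \<le> K * B_norm \<beta> (cls \<beta> f) * (\<integral>x. cmod (g x) \<partial>m) * \<theta> ^ n)"

definition exponentially_mixing :: "real \<Rightarrow> digits measure \<Rightarrow> bool"
  where "exponentially_mixing \<beta> m \<longleftrightarrow> (\<exists>K>0. \<exists>\<theta>. 0 < \<theta> \<and> \<theta> < 1 \<and> correlation_bound \<beta> m K \<theta>)"

end

theory Submission
  imports Defs "HOL-Complex_Analysis.Laurent_Convergence"
begin

text \<open>
  Write \<open>q\<close> for the quasi-greedy expansion of 1 and \<open>ind a\<close> for the indicator of \<open>[0,a]\<close>. Modulo
  functions with countable support, the \<open>ind a\<close> with \<open>a\<close> having infinitely many ones behave like the
  unit vectors of an \<open>l1\<close> space: the variation of a finite combination bounds the sum of the moduli of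
  its coefficients. Hence \<open>F\<close> is this \<open>l1\<close> space and its dual consists of the bounded functions of
  \<open>a\<close>. On unit vectors the transfer operator is the weighted shift
  \<open>ind a \<mapsto> exp (t a\<^sub>1) ind (shift a)\<close>, of spectral radius \<open>r_rad\<close>, plus the rank-one term
  \<open>a\<^sub>1 ind q\<close>. So an eigenvalue \<open>\<kappa>\<close> of modulus above \<open>r_rad\<close> is a root of
  \<open>phi (1/\<kappa>) = 1\<close>, and eigenfunctions and eigenfunctionals are found by applying the resolvent of the
  shift. Evaluating at \<open>ind q\<close>, where the functional is 1, makes the coefficients of \<open>phi\<close>,
  scaled by powers of \<open>1/\<kappa>\<^sub>t\<close>, a probability vector charging 1. This excludes other roots of modulus
  at least \<open>\<kappa>\<^sub>t\<close>, and the renewal theorem with exponential rate yields the convergence of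
  \<open>\<kappa>\<^sub>t\<^sup>-\<^sup>n L\<^sup>n\<close>, hence the mixing rate. The distribution function \<open>a \<mapsto> \<nu>\<^sub>t (ind a)\<close>
  conjugates the shift to a piecewise linear map of \<open>(0,1]\<close> with slopes \<open>\<kappa>\<^sub>t\<close> and
  \<open>\<kappa>\<^sub>t exp (-t)\<close>; the measure is the image of Lebesgue measure under the inverse coding. As
  \<open>\<kappa>\<^sub>t > 1\<close>, correlations decay at some rate below \<open>1 \<le> r_rad \<le> alpha\<close>, so no sharp bound on
  the convergence to \<open>h\<^sub>t\<close> is needed.
\<close>

text \<open>Elements of \<open>F\<close> are only limits, so they are never given coordinates. A
  functional is described by its values \<open>G a\<close> on unit vectors, and
  \<open>rep G f z\<close> says that \<open>z\<close> is the limit of its values on step functions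
  approximating \<open>f\<close>; the coefficient bound makes this independent of the approximation.
  Spectral questions are therefore answered on the dual side. If \<open>f\<close> is an
  eigenfunction and \<open>R\<close> is the resolvent of the transposed weighted shift applied to
  \<open>G\<close>, evaluating \<open>R\<close> on both sides of the eigenvalue equation leaves
  \<open>p * R q\<close> as the value of \<open>G\<close> at \<open>f\<close>, where
  \<open>p\<close> is the value at \<open>f\<close> of the first-digit functional. Evaluations in
  place of \<open>G\<close> yield the eigenfunction, the first digit yields the equation for
  \<open>\<kappa>\<close>. Mixing needs the iterates on \<open>ind b * h\<close>, not on
  \<open>ind b\<close>. This costs nothing: two intervals starting at 0 intersect in the smaller
  one, so \<open>ind b * h\<close> is again an absolutely convergent series of unit vectors. Passing
  to all \<open>f\<close> uses the coefficient bound once more: the estimate is linear in the sum of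
  the moduli of the coefficients, hence in the norm.\<close>

lemma less_fun_total: "less_fun (x::digits) y \<or> x = y \<or> less_fun y x"
proof (cases "x = y")
  case False
  define k where "k = (LEAST k. x k \<noteq> y k)"
  have ex: "\<exists>k. x k \<noteq> y k" using False by auto
  have "x k \<noteq> y k" unfolding k_def using ex by (rule LeastI_ex)
  moreover have "\<forall>j<k. x j = y j" unfolding k_def using not_less_Least by blast
  ultimately show ?thesis unfolding less_fun_def by (metis nat_neq_iff)
qed simp

interpretation lex: linorder lex_le less_fun
proof
  fix x y z :: digits
  show "less_fun x y = (x \<preceq> y \<and> \<not> y \<preceq> x)"
    unfolding lex_le_def using less_fun_asym less_fun_irrefl by blast
  show "x \<preceq> x" by (simp add: lex_le_def)
  show "x \<preceq> z" if "x \<preceq> y" "y \<preceq> z" using that less_fun_trans unfolding lex_le_def by blast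
  show "x = y" if "x \<preceq> y" "y \<preceq> x" using that less_fun_asym unfolding lex_le_def by blast
  show "x \<preceq> y \<or> y \<preceq> x" using less_fun_total unfolding lex_le_def by blast
qed

definition prepend :: "nat \<Rightarrow> digits \<Rightarrow> digits"
  where "prepend d x = (\<lambda>n. case n of 0 \<Rightarrow> d | Suc k \<Rightarrow> x k)"

lemma prepend_simps [simp]: "prepend d x 0 = d" "prepend d x (Suc n) = x n"
  "shift (prepend d x) = x"
  by (auto simp: prepend_def shift_def)

lemma prepend_shift: "prepend (x 0) (shift x) = x"
  by (auto simp: prepend_def shift_def fun_eq_iff split: nat.splits)

lemma shift_pow: "(shift ^^ n) x i = x (n + i)"
  by (induction n arbitrary: x i) (auto simp: shift_def funpow_Suc_right simp del: funpow.simps(2))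

lemma shift_funpow_Suc: "(shift ^^ Suc n) x = (shift ^^ n) (shift x)"
  by (simp add: funpow_swap1)

lemma less_fun_first:
  assumes "x 0 = y 0" shows "less_fun x y \<longleftrightarrow> less_fun (shift x) (shift y)"
proof
  assume "less_fun x y"
  then obtain k where k: "x k < y k" "\<forall>j<k. x j = y j" unfolding less_fun_def by blast
  then obtain k' where "k = Suc k'" using assms by (cases k) auto
  then show "less_fun (shift x) (shift y)" unfolding less_fun_def shift_def using k by auto
next
  assume "less_fun (shift x) (shift y)"
  then obtain k where k: "x (Suc k) < y (Suc k)" "\<forall>j<k. x (Suc j) = y (Suc j)"
    unfolding less_fun_def shift_def by blast
  have "x j = y j" if "j < Suc k" for j using that k(2) assms by (cases j) auto
  then show "less_fun x y" unfolding less_fun_def using k by blast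
qed

lemma lex_le_first:
  assumes "x 0 = y 0" shows "x \<preceq> y \<longleftrightarrow> shift x \<preceq> shift y"
proof -
  have "less_fun y x \<longleftrightarrow> less_fun (shift y) (shift x)" using assms by (intro less_fun_first) simp
  then show ?thesis by (simp add: lex.not_less[symmetric])
qed

lemma lex_le_head: "x \<preceq> y \<Longrightarrow> x 0 \<le> y 0"
  unfolding lex_le_def less_fun_def
  by (metis bot_nat_0.not_eq_extremum less_or_eq_imp_le order_refl)

lemma less_fun_head: "x 0 < y 0 \<Longrightarrow> less_fun (x::digits) y"
  by (rule less_funI, rule exI[of _ "0::nat"]) simp

lemma less_fun_shift_pow:
  assumes "x k < y k" "\<forall>j<k. x j = y j" "n \<le> k"
  shows "less_fun ((shift ^^ n) x) ((shift ^^ n) y)"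
  unfolding less_fun_def shift_pow using assms by (intro exI[of _ "k - n"]) auto

lemma zero_seq_le: "zero_seq \<preceq> x"
proof -
  have "\<not> less_fun x zero_seq" by (auto simp: less_fun_def zero_seq_def)
  then show ?thesis by (simp add: lex.not_less)
qed

section \<open>Coding by a piecewise linear map\<close>

text \<open>The breakpoint \<open>1 / \<kappa>\<close> belongs to the left branch. For
  \<open>E = 1\<close> this is the left-continuous version of \<open>tau\<close>, which makes the
  codes quasi-greedy; for \<open>E = exp t\<close> the right branch inverts
  \<open>v \<mapsto> (1 + exp t * v) / \<kappa>\<close>, the recursion of the distribution function
  at a digit 1.\<close>

definition branch :: "real \<Rightarrow> real \<Rightarrow> real \<Rightarrow> real"
  where "branch \<kappa> E u = (if u \<le> 1 / \<kappa> then \<kappa> * u else (\<kappa> * u - 1) / E)"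

lemma branch_left: "u \<le> 1 / \<kappa> \<Longrightarrow> branch \<kappa> E u = \<kappa> * u"
  and branch_right: "\<not> u \<le> 1 / \<kappa> \<Longrightarrow> branch \<kappa> E u = (\<kappa> * u - 1) / E"
  by (simp_all add: branch_def)

definition coding :: "real \<Rightarrow> real \<Rightarrow> real \<Rightarrow> digits"
  where "coding \<kappa> E u = (\<lambda>i. if (branch \<kappa> E ^^ i) u \<le> 1 / \<kappa> then 0 else 1)"

lemma shift_coding: "(shift ^^ n) (coding \<kappa> E u) = coding \<kappa> E ((branch \<kappa> E ^^ n) u)"
  by (auto simp: fun_eq_iff shift_pow coding_def funpow_add add.commute[of n])

lemma coding_digit: "coding \<kappa> E u i \<in> {0, 1}"
  by (simp add: coding_def)

text \<open>The right branch sends \<open>(1 / \<kappa>, 1]\<close> onto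
  \<open>(0, (\<kappa> - 1) / E]\<close>, so the condition on \<open>E\<close> says that
  \<open>(0, 1]\<close> is mapped into itself. The locale serves twice: with \<open>\<beta>\<close>
  and 1 for the beta-shift, with the eigenvalue and \<open>exp t\<close> for the
  eigenmeasure.\<close>

locale piecewise_linear =
  fixes \<kappa> E :: real
  assumes \<kappa>: "1 < \<kappa>" and E: "0 < E" "\<kappa> - 1 \<le> E"
begin

lemma branch_in: "u \<in> {0<..1} \<Longrightarrow> branch \<kappa> E u \<in> {0<..1}"
proof -
  assume u: "u \<in> {0<..1}"
  have "\<kappa> * u \<le> \<kappa> * 1" using u \<kappa> by (intro mult_left_mono) auto
  then have "\<kappa> * u - 1 \<le> E" using E by linarith
  then show ?thesis using u \<kappa> E by (auto simp: branch_def field_simps)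
qed

lemma branch_pow_in: "u \<in> {0<..1} \<Longrightarrow> (branch \<kappa> E ^^ n) u \<in> {0<..1}"
  by (induction n) (auto simp del: greaterThanAtMost_iff intro: branch_in)

text \<open>Up to the first place where the codes differ, both orbits pass through the same
  branches. These are increasing, so the order of the points persists and decides that
  digit.\<close>

lemma coding_mono:
  assumes "u \<le> v" shows "coding \<kappa> E u \<preceq> coding \<kappa> E v"
proof (rule ccontr)
  assume "\<not> ?thesis"
  then obtain k where k: "coding \<kappa> E v k < coding \<kappa> E u k" "\<forall>j<k. coding \<kappa> E v j = coding \<kappa> E u j"
    unfolding lex.not_le less_fun_def by blast
  have "(branch \<kappa> E ^^ j) u \<le> (branch \<kappa> E ^^ j) v" if "j \<le> k" for j
    using that
  proof (induction j)
    case (Suc j)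
    then have "coding \<kappa> E v j = coding \<kappa> E u j" and le: "(branch \<kappa> E ^^ j) u \<le> (branch \<kappa> E ^^ j) v"
      using k by auto
    then show ?case using \<kappa> E
      by (cases "(branch \<kappa> E ^^ j) u \<le> 1 / \<kappa>"; cases "(branch \<kappa> E ^^ j) v \<le> 1 / \<kappa>")
        (auto simp: coding_def branch_left branch_right divide_right_mono)
  qed (use assms in auto)
  from this[of k] k(1) show False by (auto simp: coding_def split: if_splits)
qed

text \<open>If the code is eventually 0, the orbit is eventually multiplied by
  \<open>\<kappa> > 1\<close> at each step and leaves \<open>(0, 1]\<close>.\<close>

lemma coding_infinite_ones:
  assumes "u \<in> {0<..1}" shows "\<exists>i\<ge>n. coding \<kappa> E u i = 1"
proof (rule ccontr)
  assume "\<not> ?thesis"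
  then have z: "coding \<kappa> E u i = 0" if "i \<ge> n" for i
    using that coding_digit[of \<kappa> E u i] by auto
  define v where "v = (branch \<kappa> E ^^ n) u"
  have v: "v \<in> {0<..1}" using branch_pow_in[OF assms] by (simp add: v_def)
  have small: "(branch \<kappa> E ^^ j) v \<le> 1 / \<kappa>" for j
    using z[of "n + j"] by (auto simp: coding_def v_def funpow_add add.commute split: if_splits)
  have "(branch \<kappa> E ^^ j) v = \<kappa> ^ j * v" for j
  proof (induction j)
    case (Suc j) then show ?case using small[of j] by (simp add: branch_left)
  qed simp
  then have b: "\<kappa> ^ j \<le> 1 / v" for j using branch_pow_in[OF v, of j] v by (simp add: field_simps)
  obtain j where "1 / v < \<kappa> ^ j" using real_arch_pow[OF \<kappa>] by blast
  then show False using b[of j] by linarith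
qed

end

text \<open>For \<open>E = 1\<close> both slopes are \<open>\<kappa>\<close>, so the distance of two
  points with equal codes grows by the factor \<open>\<kappa>\<close> at each step, inside an
  interval of length 1.\<close>

lemma coding_inj:
  assumes \<kappa>: "1 < \<kappa>" "\<kappa> \<le> 2"
  shows "inj_on (coding \<kappa> 1) {0<..1}"
proof (rule inj_onI, rule ccontr)
  fix u v assume u: "u \<in> {0<..1::real}" and v: "v \<in> {0<..1}" and eq: "coding \<kappa> 1 u = coding \<kappa> 1 v"
    and ne: "u \<noteq> v"
  interpret piecewise_linear \<kappa> 1 using \<kappa> by unfold_locales auto
  have *: "(branch \<kappa> 1 ^^ j) u - (branch \<kappa> 1 ^^ j) v = \<kappa> ^ j * (u - v)" for j
  proof (induction j)
    case (Suc j)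
    have "((branch \<kappa> 1 ^^ j) u \<le> 1 / \<kappa>) = ((branch \<kappa> 1 ^^ j) v \<le> 1 / \<kappa>)"
      using fun_cong[OF eq, of j] by (auto simp: coding_def split: if_splits)
    then have "(branch \<kappa> 1 ^^ Suc j) u - (branch \<kappa> 1 ^^ Suc j) v
        = \<kappa> * ((branch \<kappa> 1 ^^ j) u - (branch \<kappa> 1 ^^ j) v)"
      by (cases "(branch \<kappa> 1 ^^ j) u \<le> 1 / \<kappa>") (auto simp: branch_left branch_right algebra_simps)
    then show ?case using Suc by simp
  qed simp
  have b: "\<kappa> ^ j * \<bar>u - v\<bar> \<le> 1" for j
  proof -
    have "\<bar>(branch \<kappa> 1 ^^ j) u - (branch \<kappa> 1 ^^ j) v\<bar> \<le> 1"
      using branch_pow_in[OF u, of j] branch_pow_in[OF v, of j] by (auto simp: abs_le_iff)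
    then show ?thesis unfolding * using \<kappa> by (simp add: abs_mult)
  qed
  obtain j where "1 / \<bar>u - v\<bar> < \<kappa> ^ j" using real_arch_pow[OF \<kappa>(1)] by blast
  then show False using b[of j] ne by (simp add: field_simps)
qed

section \<open>The quasi-greedy expansion and the beta-shift\<close>

text \<open>A one of \<open>b\<close> at \<open>p\<close> is lowered to zero, after which any
  admissible tail is allowed. This embeds all of \<open>X\<close> below \<open>b\<close>, and the
  larger \<open>p\<close>, the closer to \<open>b\<close>.\<close>

definition splice :: "digits \<Rightarrow> nat \<Rightarrow> digits \<Rightarrow> digits"
  where "splice b p x = (\<lambda>i. if i < p then b i else if i = p then 0 else x (i - p - 1))"

lemma shift_splice: "(shift ^^ Suc p) (splice b p x) = x"
  unfolding fun_eq_iff shift_pow by (auto simp: splice_def)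

locale beta =
  fixes \<beta> t :: real
  assumes beta: "1 < \<beta>" "\<beta> \<le> 2"
begin

abbreviation X :: "digits set" where "X \<equiv> beta_shift \<beta>"
abbreviation q :: digits where "q \<equiv> one_seq \<beta>"

text \<open>Points approach \<open>L\<close> strictly from the left, so at a discontinuity of
  \<open>tau\<close> they still see the lower branch; this is the origin of the closed left branch
  in \<open>branch\<close>. The images again approach their limit strictly from below, so the
  statement can be iterated.\<close>

lemma tau_at_left:
  assumes "L \<in> {0<..1}"
  shows "filterlim (tau \<beta>) (at_left (branch \<beta> 1 L)) (at_left L)"
    and "eventually (\<lambda>v. nat \<lfloor>\<beta> * v\<rfloor> = (if L \<le> 1 / \<beta> then 0 else 1)) (at_left L)"
proof -
  define d :: int where "d = (if L \<le> 1 / \<beta> then 0 else 1)"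
  have ev: "eventually (\<lambda>v. \<lfloor>\<beta> * v\<rfloor> = d \<and> v < L) (at_left L)"
  proof (cases "L \<le> 1 / \<beta>")
    case True
    have "eventually (\<lambda>v. v \<in> {0<..<L}) (at_left L)"
      using assms by (intro eventually_at_leftI[of 0]) auto
    then show ?thesis
    proof eventually_elim
      case (elim v)
      have "\<beta> * v < \<beta> * L" using elim beta by simp
      also have "\<dots> \<le> 1" using True beta by (simp add: field_simps)
      finally show ?case using elim beta True by (auto simp: d_def floor_eq_iff)
    qed
  next
    case False
    then have "eventually (\<lambda>v. v \<in> {1 / \<beta><..<L}) (at_left L)"
      by (intro eventually_at_leftI[of "1 / \<beta>"]) auto
    then show ?thesis
    proof eventually_elim
      case (elim v)
      have "\<beta> * v < \<beta> * L" using elim beta by simp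
      also have "\<beta> * L \<le> \<beta> * 1" using assms beta by (intro mult_left_mono) auto
      finally have "\<beta> * v < 2" using beta by linarith
      moreover have "1 < \<beta> * v" using elim beta by (simp add: field_simps)
      ultimately show ?case using elim False by (auto simp: d_def floor_eq_iff)
    qed
  qed
  then show "eventually (\<lambda>v. nat \<lfloor>\<beta> * v\<rfloor> = (if L \<le> 1 / \<beta> then 0 else 1)) (at_left L)"
    by eventually_elim (auto simp: d_def)
  have br: "branch \<beta> 1 L = \<beta> * L - d" by (auto simp: branch_def d_def)
  have tl: "((\<lambda>v. \<beta> * v - d) \<longlongrightarrow> \<beta> * L - d) (at_left L)" by (intro tendsto_intros)
  have "(tau \<beta> \<longlongrightarrow> \<beta> * L - d) (at_left L)"
    by (rule Lim_transform_eventually[OF tl]) (use ev in \<open>eventually_elim, simp add: tau_def\<close>)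
  moreover have "eventually (\<lambda>v. tau \<beta> v < \<beta> * L - d) (at_left L)"
    using ev by eventually_elim (use beta in \<open>simp add: tau_def\<close>)
  ultimately show "filterlim (tau \<beta>) (at_left (branch \<beta> 1 L)) (at_left L)"
    unfolding br filterlim_at by (auto elim: eventually_mono)
qed

sublocale pl1: piecewise_linear \<beta> 1
  using beta by unfold_locales auto

text \<open>The quasi-greedy expansion is the itinerary of 1: left limits pass through all iterates
  of \<open>tau\<close>, and each greedy digit is eventually constant. Convergence in the product
  topology is coordinatewise with unique limits, which resolves the \<open>THE\<close>.\<close>

lemma one_seq_coding: "q = coding \<beta> 1 1"
proof -
  have lim: "filterlim (tau \<beta> ^^ n) (at_left ((branch \<beta> 1 ^^ n) 1)) (at_left 1)" for n
  proof (induction n)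
    case 0 then show ?case by (simp add: filterlim_ident)
  next
    case (Suc n)
    show ?case using filterlim_compose[OF tau_at_left(1)[OF pl1.branch_pow_in[of 1 n]] Suc]
      by (simp add: o_def)
  qed
  have "eventually (\<lambda>y. greedy \<beta> y i = coding \<beta> 1 1 i) (at_left 1)" for i
    using filterlim_iff[THEN iffD1, OF lim[of i], rule_format, OF tau_at_left(2)[OF pl1.branch_pow_in[of 1 i]]]
    by (simp add: greedy_def coding_def)
  then have comp: "((\<lambda>y. greedy \<beta> y i) \<longlongrightarrow> coding \<beta> 1 1 i) (at_left 1)" for i
    by (simp add: tendsto_eventually)
  then have "limitin (product_topology (\<lambda>_. euclidean) UNIV) (greedy \<beta>) (coding \<beta> 1 1) (at_left 1)"
    unfolding limitin_componentwise by simp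
  then have lim1: "(greedy \<beta> \<longlongrightarrow> coding \<beta> 1 1) (at_left 1)"
    by (simp add: euclidean_product_topology)
  show ?thesis unfolding one_seq_def
  proof (rule the_equality, rule lim1)
    fix s assume s: "(greedy \<beta> \<longlongrightarrow> s) (at_left 1)"
    have "s i = coding \<beta> 1 1 i" for i
    proof -
      have "limitin (product_topology (\<lambda>_. euclidean) UNIV) (greedy \<beta>) s (at_left 1)"
        using s by (simp add: euclidean_product_topology)
      then have "((\<lambda>y. greedy \<beta> y i) \<longlongrightarrow> s i) (at_left 1)"
        unfolding limitin_componentwise by simp
      then show ?thesis using comp[of i] tendsto_unique[OF trivial_limit_at_left_real] by blast
    qed
    then show "s = coding \<beta> 1 1" by blast
  qed
qed

lemma q0: "q 0 = 1" using beta by (simp add: one_seq_coding coding_def)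
lemma q_ones: "\<exists>i\<ge>n. q i = 1" unfolding one_seq_coding by (rule pl1.coding_infinite_ones) simp

text \<open>The orbit stays below 1, and \<open>coding\<close> is monotone.\<close>

lemma coding_in_X: "u \<in> {0<..1} \<Longrightarrow> coding \<beta> 1 u \<in> X"
  unfolding beta_shift_def one_seq_coding shift_coding
  using pl1.branch_pow_in[of u] coding_digit
  by (auto intro!: pl1.coding_mono simp: shift_coding simp del: insert_iff)

lemma q_in: "q \<in> X" using coding_in_X[of 1] by (simp add: one_seq_coding)

lemma X_digit: "x \<in> X \<Longrightarrow> x i \<in> {0, 1}" by (simp add: beta_shift_def)
lemma X_le: "x \<in> X \<Longrightarrow> x \<preceq> q" using funpow_0[of shift x] by (auto simp: beta_shift_def dest: spec[of _ 0])
lemma X_shift: "x \<in> X \<Longrightarrow> shift x \<in> X"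
  unfolding beta_shift_def mem_Collect_eq by (metis shift_funpow_Suc shift_def)
lemma X_shift_pow: "x \<in> X \<Longrightarrow> (shift ^^ n) x \<in> X"
  by (induction n) (auto intro: X_shift)
lemma zero_in: "zero_seq \<in> X"
proof -
  have "(shift ^^ n) zero_seq = zero_seq" for n by (simp add: fun_eq_iff shift_pow zero_seq_def)
  then show ?thesis using zero_seq_le by (simp add: beta_shift_def) (simp add: zero_seq_def)
qed

lemma X_prependI:
  assumes "x \<in> X" "d \<in> {0,1}" "prepend d x \<preceq> q" shows "prepend d x \<in> X"
proof -
  have "(shift ^^ n) (prepend d x) \<preceq> q" for n
    using assms by (cases n) (auto simp: shift_funpow_Suc beta_shift_def simp del: funpow.simps(2))
  moreover have "prepend d x i \<in> {0,1}" for i using assms by (cases i) (auto simp: beta_shift_def)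
  ultimately show ?thesis by (simp add: beta_shift_def)
qed

lemma prepend0_in: "x \<in> X \<Longrightarrow> prepend 0 x \<in> X"
  using less_fun_head[of "prepend 0 x" q] q0 by (intro X_prependI) (auto simp: lex_le_def)

lemma prepend1_in_iff: "x \<in> X \<Longrightarrow> prepend 1 x \<in> X \<longleftrightarrow> x \<preceq> shift q"
  using X_prependI[of x 1] X_le[of "prepend 1 x"] lex_le_first[of "prepend 1 x" q] q0 by auto

text \<open>Shifts by at most \<open>p\<close> still see the lowered digit and stay below the shifts
  of \<open>b\<close>; larger shifts are shifts of \<open>x\<close>.\<close>

lemma splice_in:
  assumes b: "b \<in> X" "b p = 1" and x: "x \<in> X"
  shows "splice b p x \<in> X" "less_fun (splice b p x) b"
proof -
  have d: "splice b p x p < b p" "\<forall>j<p. splice b p x j = b j" using b by (auto simp: splice_def)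
  then show "less_fun (splice b p x) b" unfolding less_fun_def by blast
  have "(shift ^^ n) (splice b p x) \<preceq> q" for n
  proof (cases "n \<le> p")
    case True
    show ?thesis using less_fun_shift_pow[OF d True] X_le[OF X_shift_pow[OF b(1), of n]]
      by (rule lex.order_trans[OF lex.less_imp_le])
  next
    case False
    then obtain m where "n = m + Suc p" using le_Suc_ex[of "Suc p" n] by (auto simp: add.commute)
    then have "(shift ^^ n) (splice b p x) = (shift ^^ m) x"
      by (simp only: funpow_add o_apply shift_splice)
    then show ?thesis using x by (simp add: X_le X_shift_pow)
  qed
  moreover have "splice b p x i \<in> {0, 1}" for i
    using X_digit[OF b(1), of i] X_digit[OF x, of "i - p - 1"] by (auto simp: splice_def)
  ultimately show "splice b p x \<in> X" by (simp add: beta_shift_def)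
qed

lemma X_uncountable: "uncountable X"
proof
  assume "countable X"
  moreover have "coding \<beta> 1 ` {0<..1} \<subseteq> X" using coding_in_X by auto
  ultimately have "countable (coding \<beta> 1 ` {0<..1})" using countable_subset by blast
  then have "countable {0<..1::real}"
    by (rule countable_image_inj_on) (rule coding_inj[OF beta])
  then show False using uncountable_half_open_interval_2[of 0 "1::real"] by simp
qed

text \<open>Replacing \<open>w10\<dots>\<close> by \<open>w0q\<close> makes the representation of elements of \<open>F\<close> unique: two intervals
  \<open>[0,a]\<close>, \<open>[0,b]\<close> with \<open>a \<noteq> b\<close> in \<open>X1\<close> differ by an uncountable set.\<close>

definition X1 :: "digits set" where "X1 = {x \<in> X. \<forall>n. \<exists>i\<ge>n. x i = 1}"

lemma X1_X: "a \<in> X1 \<Longrightarrow> a \<in> X" by (simp add: X1_def)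
lemma q_in1: "q \<in> X1" using q_in q_ones by (simp add: X1_def)
lemma X1_shift: "a \<in> X1 \<Longrightarrow> shift a \<in> X1"
proof -
  assume a: "a \<in> X1"
  have "\<exists>i\<ge>n. a (Suc i) = 1" for n
  proof -
    obtain i where "i \<ge> Suc n" "a i = 1" using a by (auto simp: X1_def)
    then show ?thesis by (cases i) auto
  qed
  then show ?thesis using a X_shift[of a] by (auto simp: X1_def shift_def)
qed
lemma X1_shift_pow: "a \<in> X1 \<Longrightarrow> (shift ^^ n) a \<in> X1"
  by (induction n) (auto intro: X1_shift)

lemma between_uncountable:
  assumes "a \<in> X" "b \<in> X1" "less_fun a b"
  shows "uncountable {x \<in> X. less_fun a x \<and> x \<preceq> b}"
proof
  assume c: "countable {x \<in> X. less_fun a x \<and> x \<preceq> b}"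
  obtain k where k: "a k < b k" "\<forall>j<k. a j = b j" using assms(3) unfolding less_fun_def by blast
  \<comment> \<open>This one lies beyond the first difference \<open>k\<close>, so splicing there
    keeps the word above \<open>a\<close>.\<close>
  obtain p where p: "p \<ge> Suc k" "b p = 1" using assms(2) unfolding X1_def by blast
  have "splice b p x \<in> {x \<in> X. less_fun a x \<and> x \<preceq> b}" if "x \<in> X" for x
  proof -
    have "less_fun a (splice b p x)" unfolding less_fun_def
      using k p by (intro exI[of _ k]) (auto simp: splice_def)
    then show ?thesis using splice_in[OF X1_X[OF assms(2)] p(2) that] by (simp add: lex.less_imp_le)
  qed
  then have "countable (splice b p ` X)" by (intro countable_subset[OF _ c]) auto
  moreover have "inj_on (splice b p) X" by (rule inj_onI) (metis shift_splice)
  ultimately show False using countable_image_inj_on[of "splice b p" X] X_uncountable by blast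
qed

text \<open>If \<open>a\<close> is a word \<open>w\<close> followed by 1 and zeros, take
  \<open>w\<close> followed by 0 and \<open>q\<close>. Nothing in \<open>X\<close> lies strictly
  between the two, since every tail of an element of \<open>X\<close> is at most
  \<open>q\<close>.\<close>

lemma lower_representative:
  assumes "a \<in> X" "a \<notin> X1" "a \<noteq> zero_seq"
  obtains a' where "a' \<in> X1" "less_fun a' a" "\<And>x. x \<in> X \<Longrightarrow> less_fun x a \<Longrightarrow> x \<preceq> a'"
proof -
  define P where "P = {i. a i = 1}"
  obtain n where n: "\<forall>i\<ge>n. a i \<noteq> 1" using assms by (auto simp: X1_def)
  have "P \<subseteq> {..<n}" unfolding P_def using n not_le by blast
  then have fin: "finite P" using finite_subset by blast
  have "P \<noteq> {}" using assms(3) X_digit[OF assms(1)] unfolding P_def zero_seq_def by auto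
  define p where "p = Max P"
  have p: "a p = 1" using Max_in[OF fin \<open>P \<noteq> {}\<close>] by (simp add: p_def P_def)
  have after: "a i = 0" if "i > p" for i
    using Max_ge[OF fin, of i] that X_digit[OF assms(1), of i] by (auto simp: p_def P_def)
  define a' where "a' = splice a p q"
  have a'X: "a' \<in> X" "less_fun a' a" using splice_in[OF assms(1) p q_in] by (auto simp: a'_def)
  have "\<exists>i\<ge>m. a' i = 1" for m
  proof -
    obtain i where "i \<ge> m" "q i = 1" using q_ones by blast
    then show ?thesis by (intro exI[of _ "Suc p + i"]) (auto simp: a'_def splice_def)
  qed
  then have "a' \<in> X1" using a'X by (simp add: X1_def)
  moreover have "x \<preceq> a'" if x: "x \<in> X" "less_fun x a" for x
  proof -
    obtain k where k: "x k < a k" "\<forall>j<k. x j = a j" using x(2) unfolding less_fun_def by blast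
    have "k \<le> p" using k(1) after[of k] by (cases "k \<le> p") auto
    show ?thesis
    proof (cases "k = p")
      case False
      then have "less_fun x a'" unfolding less_fun_def
        using k \<open>k \<le> p\<close> by (intro exI[of _ k]) (auto simp: a'_def splice_def)
      then show ?thesis by (simp add: lex_le_def)
    next
      case True
      have le: "(shift ^^ Suc p) x \<preceq> q" using x X_le X_shift_pow by blast
      show ?thesis
      proof (rule ccontr)
        assume "\<not> ?thesis"
        then obtain j where j: "a' j < x j" "\<forall>i<j. a' i = x i"
          unfolding lex.not_le less_fun_def by blast
        have "a' i = x i" if "i \<le> p" for i
          using that k True p by (auto simp: a'_def splice_def)
        then have "Suc p \<le> j" using j(1) by (metis less_irrefl not_less_eq_eq)
        from less_fun_shift_pow[OF j this] have "less_fun q ((shift ^^ Suc p) x)"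
          by (simp only: a'_def shift_splice)
        then show False using le by (simp add: lex.not_le[symmetric])
      qed
    qed
  qed
  ultimately show thesis using that a'X(2) by blast
qed

abbreviation "bv \<equiv> BV \<beta>"
abbreviation "BVn \<equiv> BV_norm \<beta>"
abbreviation "null \<equiv> null_fun \<beta>"
abbreviation "Nm f \<equiv> B_norm \<beta> (cls \<beta> f)"
definition tv :: "(digits \<Rightarrow> complex) \<Rightarrow> real" where "tv f = enn2real (var \<beta> f)"

section \<open>Variation\<close>

text \<open>The chains in the definition of \<open>var\<close> are strict and run from
  \<open>zero_seq\<close> to \<open>one_seq \<beta>\<close>. A weak chain with a free starting point
  is reduced to a strict one by dropping repetitions and prepending \<open>zero_seq\<close>;
  \<open>chain_le_tv\<close> supplies the end point.\<close>

lemma refine_chain: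
  fixes f :: "digits \<Rightarrow> complex"
  assumes "\<forall>i\<le>n. y i \<in> X" "\<forall>i<n. y i \<preceq> y (Suc i)"
  shows "\<exists>m c. c 0 = zero_seq \<and> c m = y n \<and> (\<forall>i\<le>m. c i \<in> X) \<and> (\<forall>i<m. less_fun (c i) (c (Suc i))) \<and>
    (\<Sum>i<n. cmod (f (y (Suc i)) - f (y i))) \<le> (\<Sum>i<m. cmod (f (c (Suc i)) - f (c i)))"
  using assms
proof (induction n)
  case 0
  show ?case
  proof (cases "y 0 = zero_seq")
    case True
    then show ?thesis using 0 by (intro exI[of _ 0] exI[of _ y]) auto
  next
    case False
    then have "less_fun zero_seq (y 0)" using zero_seq_le[of "y 0"] by (auto simp: lex_le_def)
    then show ?thesis using 0 zero_in
      by (intro exI[of _ 1] exI[of _ "\<lambda>i. if i = 0 then zero_seq else y 0"]) auto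
  qed
next
  case (Suc n)
  then obtain m c where c: "c 0 = zero_seq" "c m = y n" "\<forall>i\<le>m. c i \<in> X"
      "\<forall>i<m. less_fun (c i) (c (Suc i))"
      "(\<Sum>i<n. cmod (f (y (Suc i)) - f (y i))) \<le> (\<Sum>i<m. cmod (f (c (Suc i)) - f (c i)))"
    by fastforce
  show ?case
  proof (cases "y (Suc n) = y n")
    case True
    then show ?thesis using c by (intro exI[of _ m] exI[of _ c]) auto
  next
    case False
    then have lt: "less_fun (c m) (y (Suc n))" using Suc.prems(2) c(2) by (auto simp: lex_le_def)
    define c' where "c' = c(Suc m := y (Suc n))"
    have "(\<Sum>i<m. cmod (f (c' (Suc i)) - f (c' i))) = (\<Sum>i<m. cmod (f (c (Suc i)) - f (c i)))"
      by (intro sum.cong) (auto simp: c'_def)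
    then show ?thesis using c lt Suc.prems(1)
      by (intro exI[of _ "Suc m"] exI[of _ c']) (auto simp: c'_def less_Suc_eq le_Suc_eq)
  qed
qed

lemma chain_le_tv:
  assumes "f \<in> bv" "\<forall>i\<le>n. y i \<in> X" "\<forall>i<n. y i \<preceq> y (Suc i)"
  shows "(\<Sum>i<n. cmod (f (y (Suc i)) - f (y i))) \<le> tv f"
proof -
  \<comment> \<open>\<open>q\<close> is the maximum of \<open>X\<close>, so it may be appended to
    close the chain.\<close>
  define y' where "y' = y(Suc n := q)"
  have y': "\<forall>i\<le>Suc n. y' i \<in> X" "\<forall>i<Suc n. y' i \<preceq> y' (Suc i)"
    using assms q_in X_le by (auto simp: y'_def less_Suc_eq le_Suc_eq)
  from refine_chain[OF this, of f] obtain m c where c: "c 0 = zero_seq" "c m = q" "\<forall>i\<le>m. c i \<in> X"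
      "\<forall>i<m. less_fun (c i) (c (Suc i))"
      "(\<Sum>i<Suc n. cmod (f (y' (Suc i)) - f (y' i))) \<le> (\<Sum>i<m. cmod (f (c (Suc i)) - f (c i)))"
    by (auto simp: y'_def)
  have "(\<Sum>i<n. cmod (f (y' (Suc i)) - f (y' i))) = (\<Sum>i<n. cmod (f (y (Suc i)) - f (y i)))"
    by (intro sum.cong) (auto simp: y'_def)
  then have 1: "(\<Sum>i<n. cmod (f (y (Suc i)) - f (y i))) \<le> (\<Sum>i<m. cmod (f (c (Suc i)) - f (c i)))"
    using c(5) by simp (smt (verit) norm_ge_zero)
  have "(m, c) \<in> var_chains \<beta>" using c by (simp add: var_chains_def)
  then have "ennreal (\<Sum>i<m. cmod (f (c (Suc i)) - f (c i))) \<le> var \<beta> f"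
    unfolding var_def by (intro SUP_upper2[of "(m, c)"]) auto
  moreover have "var \<beta> f < \<infinity>" using assms(1) by (simp add: BV_def)
  ultimately have "(\<Sum>i<m. cmod (f (c (Suc i)) - f (c i))) \<le> tv f"
    unfolding tv_def using enn2real_mono[of "ennreal (\<Sum>i<m. cmod (f (c (Suc i)) - f (c i)))" "var \<beta> f"]
    by (simp add: sum_nonneg)
  then show ?thesis using 1 by linarith
qed

lemma tv_pair: "f \<in> bv \<Longrightarrow> x \<in> X \<Longrightarrow> y \<in> X \<Longrightarrow> cmod (f x - f y) \<le> tv f"
proof -
  have *: "cmod (f y - f x) \<le> tv f" if "x \<preceq> y" "f \<in> bv" "x \<in> X" "y \<in> X" for x y
    using chain_le_tv[of f 1 "\<lambda>i. if i = 0 then x else y"] that by auto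
  show "f \<in> bv \<Longrightarrow> x \<in> X \<Longrightarrow> y \<in> X \<Longrightarrow> cmod (f x - f y) \<le> tv f"
    using *[of x y] *[of y x] lex.linear[of x y] by (auto simp: norm_minus_commute)
qed

text \<open>The supremum in the norm is meaningful: comparison with the value at
  \<open>zero_seq\<close> shows that bounded variation implies boundedness.\<close>

lemma sup_le:
  assumes "f \<in> bv" "x \<in> X" shows "cmod (f x) \<le> (SUP x\<in>X. cmod (f x))"
proof (rule cSUP_upper[OF assms(2)])
  show "bdd_above ((\<lambda>x. cmod (f x)) ` X)"
  proof (rule bdd_aboveI2)
    fix x assume "x \<in> X"
    then have "cmod (f x - f zero_seq) \<le> tv f" using assms tv_pair zero_in by blast
    then show "cmod (f x) \<le> tv f + cmod (f zero_seq)"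
      using norm_triangle_ineq2[of "f x" "f zero_seq"] by linarith
  qed
qed

lemma tv_nonneg: "0 \<le> tv f" by (simp add: tv_def)

lemma sup_nonneg: "f \<in> bv \<Longrightarrow> 0 \<le> (SUP x\<in>X. cmod (f x))"
  using sup_le[OF _ q_in] norm_ge_zero order_trans by blast

lemma BVn_nonneg: "f \<in> bv \<Longrightarrow> 0 \<le> BVn f"
  unfolding BV_norm_def by (simp add: sup_nonneg)

lemma BVn_sup: "f \<in> bv \<Longrightarrow> x \<in> X \<Longrightarrow> cmod (f x) \<le> BVn f"
  using sup_le[of f x] tv_nonneg[of f] unfolding BV_norm_def tv_def by linarith

text \<open>Weak chains with free end points are the class that order-preserving maps respect and
  that \<open>chain_le_tv\<close> bounds, so in this form estimates compose.\<close>

lemma BVI: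
  assumes "\<And>x. x \<in> X \<Longrightarrow> cmod (f x) \<le> A"
    and "\<And>n c. \<forall>i\<le>n. c i \<in> X \<Longrightarrow> \<forall>i<n. c i \<preceq> c (Suc i) \<Longrightarrow> (\<Sum>i<n. cmod (f (c (Suc i)) - f (c i))) \<le> K"
  shows "f \<in> bv" "BVn f \<le> A + K"
proof -
  have K0: "0 \<le> K" using assms(2)[of 0 "\<lambda>_. q"] q_in by simp
  have le: "var \<beta> f \<le> ennreal K" unfolding var_def
    by (rule SUP_least) (auto simp: var_chains_def lex_le_def intro!: ennreal_leI assms(2))
  then show "f \<in> bv" unfolding BV_def using ennreal_less_top le_less_trans by fastforce
  have "(SUP x\<in>X. cmod (f x)) \<le> A" using assms(1) q_in by (intro cSUP_least) auto
  moreover have "enn2real (var \<beta> f) \<le> K" using le K0 by (simp add: enn2real_leI)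
  ultimately show "BVn f \<le> A + K" unfolding BV_norm_def by linarith
qed

lemma BVn_eq: "BVn f = (SUP x\<in>X. cmod (f x)) + tv f" by (simp add: BV_norm_def tv_def)

lemma BV_add:
  assumes "f \<in> bv" "g \<in> bv"
  shows "(\<lambda>x. f x + g x) \<in> bv" "BVn (\<lambda>x. f x + g x) \<le> BVn f + BVn g"
proof -
  have 1: "cmod (f x + g x) \<le> (SUP x\<in>X. cmod (f x)) + (SUP x\<in>X. cmod (g x))" if "x \<in> X" for x
    using norm_triangle_ineq[of "f x" "g x"] sup_le[OF assms(1) that] sup_le[OF assms(2) that] by linarith
  have 2: "(\<Sum>i<n. cmod (f (c (Suc i)) + g (c (Suc i)) - (f (c i) + g (c i)))) \<le> tv f + tv g"
    if "\<forall>i\<le>n. c i \<in> X" "\<forall>i<n. c i \<preceq> c (Suc i)" for n c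
  proof -
    have "(\<Sum>i<n. cmod (f (c (Suc i)) + g (c (Suc i)) - (f (c i) + g (c i)))) \<le>
      (\<Sum>i<n. cmod (f (c (Suc i)) - f (c i)) + cmod (g (c (Suc i)) - g (c i)))"
      by (intro sum_mono order_trans[OF eq_refl norm_triangle_ineq]) (simp add: algebra_simps)
    then show ?thesis using chain_le_tv[OF assms(1) that] chain_le_tv[OF assms(2) that]
      by (simp add: sum.distrib)
  qed
  note * = BVI[where f = "\<lambda>x. f x + g x", OF 1 2]
  show "(\<lambda>x. f x + g x) \<in> bv" by (rule *)
  show "BVn (\<lambda>x. f x + g x) \<le> BVn f + BVn g" using *(2) by (simp add: BVn_eq)
qed

lemma BV_cmult:
  assumes "f \<in> bv"
  shows "(\<lambda>x. c * f x) \<in> bv" "BVn (\<lambda>x. c * f x) \<le> cmod c * BVn f"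
proof -
  have 1: "cmod (c * f x) \<le> cmod c * (SUP x\<in>X. cmod (f x))" if "x \<in> X" for x
    using sup_le[OF assms that] by (simp add: norm_mult mult_left_mono)
  have 2: "(\<Sum>i<n. cmod (c * f (d (Suc i)) - c * f (d i))) \<le> cmod c * tv f"
    if "\<forall>i\<le>n. d i \<in> X" "\<forall>i<n. d i \<preceq> d (Suc i)" for n d
    using chain_le_tv[OF assms that]
    by (simp add: norm_mult mult_left_mono flip: right_diff_distrib sum_distrib_left)
  note * = BVI[where f = "\<lambda>x. c * f x", OF 1 2]
  show "(\<lambda>x. c * f x) \<in> bv" by (rule *)
  show "BVn (\<lambda>x. c * f x) \<le> cmod c * BVn f" using *(2) by (simp add: BVn_eq distrib_left)
qed

lemma BV_diff:
  assumes "f \<in> bv" "g \<in> bv"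
  shows "(\<lambda>x. f x - g x) \<in> bv" "BVn (\<lambda>x. f x - g x) \<le> BVn f + BVn g"
  using BV_add[OF assms(1) BV_cmult(1)[OF assms(2), of "-1"]] BV_cmult(2)[OF assms(2), of "-1"] by auto

lemma BV_cong:
  assumes "f \<in> bv" "\<And>x. x \<in> X \<Longrightarrow> g x = f x"
  shows "g \<in> bv" "BVn g \<le> BVn f"
proof -
  have 1: "cmod (g x) \<le> (SUP x\<in>X. cmod (f x))" if "x \<in> X" for x
    using sup_le[OF assms(1) that] assms(2)[OF that] by simp
  have 2: "(\<Sum>i<n. cmod (g (d (Suc i)) - g (d i))) \<le> tv f"
    if "\<forall>i\<le>n. d i \<in> X" "\<forall>i<n. d i \<preceq> d (Suc i)" for n d
    using chain_le_tv[OF assms(1) that] that assms(2) by simp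
  note * = BVI[where f = g, OF 1 2]
  show "g \<in> bv" by (rule *)
  show "BVn g \<le> BVn f" using *(2) by (simp add: BVn_eq)
qed

lemma BV_const: "(\<lambda>_. c) \<in> bv" "BVn (\<lambda>_. c) \<le> cmod c"
  using BVI[of "\<lambda>_. c" "cmod c" 0] by auto

section \<open>Classes\<close>

lemma null_BV: "g \<in> null \<Longrightarrow> g \<in> bv" by (simp add: null_fun_def)
lemma null_countable: "g \<in> null \<Longrightarrow> countable {x \<in> X. g x \<noteq> 0}" by (simp add: null_fun_def)
lemma null_zero: "(\<lambda>_. 0) \<in> null" by (simp add: null_fun_def BV_const)

lemma nullI: "g \<in> bv \<Longrightarrow> countable N \<Longrightarrow> (\<And>x. x \<in> X \<Longrightarrow> x \<notin> N \<Longrightarrow> g x = 0) \<Longrightarrow> g \<in> null"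
  unfolding null_fun_def using countable_subset[of "{x \<in> X. g x \<noteq> 0}" N] by blast

lemma null_add: "f \<in> null \<Longrightarrow> g \<in> null \<Longrightarrow> (\<lambda>x. f x + g x) \<in> null"
  by (rule nullI[of _ "{x \<in> X. f x \<noteq> 0} \<union> {x \<in> X. g x \<noteq> 0}"])
    (auto simp: null_countable null_BV BV_add)

lemma null_cmult: "f \<in> null \<Longrightarrow> (\<lambda>x. c * f x) \<in> null"
  by (rule nullI[of _ "{x \<in> X. f x \<noteq> 0}"]) (auto simp: null_countable null_BV BV_cmult)

lemma null_uminus: "f \<in> null \<Longrightarrow> (\<lambda>x. - f x) \<in> null"
  using null_cmult[of f "-1"] by simp

lemma null_diff: "f \<in> null \<Longrightarrow> g \<in> null \<Longrightarrow> (\<lambda>x. f x - g x) \<in> null"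
  using null_add[OF _ null_uminus, of f g] by simp

lemma cls_iff: "h \<in> cls \<beta> f \<longleftrightarrow> (\<lambda>x. h x - f x) \<in> null"
proof
  assume "h \<in> cls \<beta> f"
  then obtain g where "g \<in> null" "h = (\<lambda>x. f x + g x)" by (auto simp: cls_def)
  then show "(\<lambda>x. h x - f x) \<in> null" by simp
next
  assume "(\<lambda>x. h x - f x) \<in> null"
  then show "h \<in> cls \<beta> f" unfolding cls_def by (intro CollectI exI[of _ "\<lambda>x. h x - f x"]) auto
qed

lemma cls_self: "f \<in> cls \<beta> f" by (simp add: cls_iff null_zero)

lemma cls_eqI:
  assumes "(\<lambda>x. f x - g x) \<in> null" shows "cls \<beta> f = cls \<beta> g"
proof -
  have "(\<lambda>x. h x - f x) \<in> null \<longleftrightarrow> (\<lambda>x. h x - g x) \<in> null" for h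
    using null_add[OF _ assms, of "\<lambda>x. h x - f x"] null_diff[OF _ assms, of "\<lambda>x. h x - g x"] by auto
  then show ?thesis by (auto simp: cls_iff)
qed

lemma cls_eq_iff: "cls \<beta> f = cls \<beta> g \<longleftrightarrow> (\<lambda>x. f x - g x) \<in> null"
  using cls_eqI cls_self[of f] cls_iff by metis

lemma cls_cong: "(\<And>x. x \<in> X \<Longrightarrow> f x = g x) \<Longrightarrow> cls \<beta> f = cls \<beta> g"
  by (intro cls_eqI nullI[of _ "{}"]) (auto intro: BV_cong[OF BV_const(1), of _ 0])

text \<open>Operations on classes are written as unions over representatives. They are well defined
  as soon as all sets in the union coincide.\<close>

lemma UN_const:
  assumes "a \<in> A" "\<And>x. x \<in> A \<Longrightarrow> F x = B" shows "(\<Union>x\<in>A. F x) = B"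
  using assms by auto

lemma B_add_cls: "B_add \<beta> (cls \<beta> f) (cls \<beta> g) = cls \<beta> (\<lambda>x. f x + g x)"
  unfolding B_add_def
proof (intro UN_const[OF cls_self] cls_eqI)
  fix f' g' assume "f' \<in> cls \<beta> f" "g' \<in> cls \<beta> g"
  from null_add[OF this[unfolded cls_iff]] show "(\<lambda>x. f' x + g' x - (f x + g x)) \<in> null"
    by (simp add: algebra_simps)
qed

lemma B_scale_cls: "B_scale \<beta> c (cls \<beta> f) = cls \<beta> (\<lambda>x. c * f x)"
  unfolding B_scale_def
proof (intro UN_const[OF cls_self] cls_eqI)
  fix f' assume "f' \<in> cls \<beta> f"
  from null_cmult[OF this[unfolded cls_iff], of c] show "(\<lambda>x. c * f' x - c * f x) \<in> null"
    by (simp add: algebra_simps)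
qed

lemma B_diff_cls: "B_diff \<beta> (cls \<beta> f) (cls \<beta> g) = cls \<beta> (\<lambda>x. f x - g x)"
  by (simp add: B_diff_def B_add_cls B_scale_cls)

lemma cls_BV: "f \<in> bv \<Longrightarrow> g \<in> cls \<beta> f \<Longrightarrow> g \<in> bv"
  using BV_add(1)[of f "\<lambda>x. g x - f x"] by (simp add: cls_iff null_BV)

lemma bdd_below_BVn: "f \<in> bv \<Longrightarrow> bdd_below (BVn ` cls \<beta> f)"
  by (rule bdd_belowI2[of _ 0]) (auto intro: BVn_nonneg cls_BV)

lemma Nm_le: "f \<in> bv \<Longrightarrow> g \<in> cls \<beta> f \<Longrightarrow> Nm f \<le> BVn g"
  unfolding B_norm_def by (rule cINF_lower[OF bdd_below_BVn])

lemma Nm_le_BVn: "f \<in> bv \<Longrightarrow> Nm f \<le> BVn f"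
  using Nm_le cls_self by blast

lemma Nm_nonneg: "f \<in> bv \<Longrightarrow> 0 \<le> Nm f"
  unfolding B_norm_def using cls_self by (intro cINF_greatest) (auto intro: BVn_nonneg cls_BV)

lemma Nm_approx:
  assumes "f \<in> bv" "Nm f < e"
  obtains g where "g \<in> cls \<beta> f" "g \<in> bv" "BVn g < e"
proof -
  obtain g where "g \<in> cls \<beta> f" "BVn g < e"
    using assms cINF_less_iff[OF _ bdd_below_BVn[OF assms(1)]] cls_self[of f] unfolding B_norm_def by blast
  then show thesis using that cls_BV assms(1) by blast
qed

lemma Nm_cong: "(\<lambda>x. f x - g x) \<in> null \<Longrightarrow> Nm f = Nm g"
  using cls_eqI by simp

lemma Nm_add:
  assumes "f \<in> bv" "g \<in> bv" shows "Nm (\<lambda>x. f x + g x) \<le> Nm f + Nm g"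
proof (rule field_le_epsilon)
  fix e :: real assume "e > 0"
  obtain f' where f': "f' \<in> cls \<beta> f" "f' \<in> bv" "BVn f' < Nm f + e / 2" using Nm_approx[OF assms(1)] \<open>e > 0\<close>
    by (metis half_gt_zero less_add_same_cancel1)
  obtain g' where g': "g' \<in> cls \<beta> g" "g' \<in> bv" "BVn g' < Nm g + e / 2" using Nm_approx[OF assms(2)] \<open>e > 0\<close>
    by (metis half_gt_zero less_add_same_cancel1)
  have "(\<lambda>x. f' x + g' x) \<in> cls \<beta> (\<lambda>x. f x + g x)"
    using null_add[OF f'(1)[unfolded cls_iff] g'(1)[unfolded cls_iff]] unfolding cls_iff
    by (simp add: algebra_simps)
  then have "Nm (\<lambda>x. f x + g x) \<le> BVn (\<lambda>x. f' x + g' x)" using Nm_le BV_add assms by blast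
  then show "Nm (\<lambda>x. f x + g x) \<le> Nm f + Nm g + e" using BV_add(2)[OF f'(2) g'(2)] f'(3) g'(3) by linarith
qed

lemma Nm_cmult:
  assumes "f \<in> bv" shows "Nm (\<lambda>x. c * f x) \<le> cmod c * Nm f"
proof (rule field_le_epsilon)
  fix e :: real assume "e > 0"
  \<comment> \<open>The added 1 covers \<open>c = 0\<close>.\<close>
  define d where "d = e / (cmod c + 1)"
  have d: "d > 0" "cmod c * d \<le> e" using \<open>e > 0\<close>
    by (auto simp: d_def add_pos_nonneg divide_simps)
      (smt (verit, best) mult_nonneg_nonneg norm_ge_zero \<open>e > 0\<close> distrib_left mult.commute)+
  obtain f' where f': "f' \<in> cls \<beta> f" "f' \<in> bv" "BVn f' < Nm f + d" using Nm_approx[OF assms] d(1)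
    by (metis less_add_same_cancel1)
  have "(\<lambda>x. c * f' x) \<in> cls \<beta> (\<lambda>x. c * f x)"
    using null_cmult[OF f'(1)[unfolded cls_iff], of c] unfolding cls_iff by (simp add: algebra_simps)
  then have "Nm (\<lambda>x. c * f x) \<le> BVn (\<lambda>x. c * f' x)" using Nm_le BV_cmult assms by blast
  also have "\<dots> \<le> cmod c * BVn f'" using BV_cmult f' by blast
  also have "\<dots> \<le> cmod c * (Nm f + d)" using f' by (intro mult_left_mono) auto
  finally show "Nm (\<lambda>x. c * f x) \<le> cmod c * Nm f + e" using d by (simp add: distrib_left)
qed

lemma Nm_diff:
  assumes "f \<in> bv" "g \<in> bv" shows "Nm (\<lambda>x. f x - g x) \<le> Nm f + Nm g"
  using Nm_add[OF assms(1) BV_cmult(1)[OF assms(2), of "-1"]] Nm_cmult[OF assms(2), of "-1"] by simp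

section \<open>Indicators of intervals\<close>

definition ind :: "digits \<Rightarrow> digits \<Rightarrow> complex" where "ind a = indicator (ival \<beta> zero_seq a)"

lemma ind_eq: "x \<in> X \<Longrightarrow> ind a x = (if x \<preceq> a then 1 else 0)"
  by (simp add: ind_def ival_def zero_seq_le indicator_def)

text \<open>\<open>ind a\<close> decreases along a chain, so the sum telescopes.\<close>

lemma ind_chain:
  assumes "\<forall>i\<le>n. c i \<in> X" "\<forall>i<n. c i \<preceq> c (Suc i)"
  shows "(\<Sum>i<n. cmod (ind a (c (Suc i)) - ind a (c i))) \<le> 1"
proof -
  have "cmod (ind a (c (Suc i)) - ind a (c i)) = Re (ind a (c i)) - Re (ind a (c (Suc i)))" if "i < n" for i
  proof -
    have "c i \<in> X" "c (Suc i) \<in> X" "c i \<preceq> c (Suc i)" using assms that by auto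
    then show ?thesis using lex.order_trans[of "c i" "c (Suc i)" a] by (auto simp: ind_eq)
  qed
  then have "(\<Sum>i<n. cmod (ind a (c (Suc i)) - ind a (c i))) = Re (ind a (c 0)) - Re (ind a (c n))"
    using sum_lessThan_telescope'[of "\<lambda>i. Re (ind a (c i))" n] by simp
  also have "\<dots> \<le> 1" using assms by (auto simp: ind_eq)
  finally show ?thesis .
qed

text \<open>Each \<open>ind a\<close> has supremum and variation at most 1, whence the factor 2. The
  series is exchanged with the finite sum over the chain.\<close>

lemma series_BV:
  assumes "summable (\<lambda>i. cmod (c i))" "\<And>x. x \<in> X \<Longrightarrow> f x = (\<Sum>i. c i * ind (a i) x)"
  shows "f \<in> bv" "BVn f \<le> 2 * (\<Sum>i. cmod (c i))"
proof -
  have s: "summable (\<lambda>i. c i * ind (a i) x)" if "x \<in> X" for x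
    by (rule summable_norm_cancel, rule summable_comparison_test'[OF assms(1), of 0])
      (use that in \<open>auto simp: norm_mult ind_eq\<close>)
  have 1: "cmod (f x) \<le> (\<Sum>i. cmod (c i))" if "x \<in> X" for x
    unfolding assms(2)[OF that]
    by (rule norm_suminf_le[OF _ assms(1)]) (use that in \<open>auto simp: norm_mult ind_eq\<close>)
  have 2: "(\<Sum>j<n. cmod (f (d (Suc j)) - f (d j))) \<le> (\<Sum>i. cmod (c i))"
    if d: "\<forall>j\<le>n. d j \<in> X" "\<forall>j<n. d j \<preceq> d (Suc j)" for n d
  proof -
    let ?g = "\<lambda>j i. cmod (c i) * cmod (ind (a i) (d (Suc j)) - ind (a i) (d j))"
    have sg: "summable (?g j)" if "j < n" for j
      by (rule summable_comparison_test'[OF assms(1), of 0])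
        (use d that in \<open>auto simp: ind_eq less_imp_le\<close>)
    have "cmod (f (d (Suc j)) - f (d j)) \<le> (\<Sum>i. ?g j i)" if "j < n" for j
    proof -
      have X: "d (Suc j) \<in> X" "d j \<in> X" using d that by auto
      have e: "f (d (Suc j)) - f (d j) = (\<Sum>i. c i * ind (a i) (d (Suc j)) - c i * ind (a i) (d j))"
        using X s by (simp add: assms(2) suminf_diff)
      show ?thesis unfolding e
        by (rule norm_suminf_le[OF _ sg[OF that]]) (simp add: norm_mult flip: right_diff_distrib)
    qed
    then have "(\<Sum>j<n. cmod (f (d (Suc j)) - f (d j))) \<le> (\<Sum>j<n. \<Sum>i. ?g j i)" by (intro sum_mono) auto
    also have "\<dots> = (\<Sum>i. \<Sum>j<n. ?g j i)" using sg by (intro suminf_sum[symmetric]) auto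
    also have "\<dots> \<le> (\<Sum>i. cmod (c i))"
    proof (rule suminf_le[OF _ _ assms(1)])
      show "summable (\<lambda>i. \<Sum>j<n. ?g j i)" using sg by (intro summable_sum) auto
      show "(\<Sum>j<n. ?g j i) \<le> cmod (c i)" for i
        using ind_chain[OF d, of "a i"] mult_left_mono[of _ 1 "cmod (c i)"]
        by (simp flip: sum_distrib_left)
    qed
    finally show ?thesis .
  qed
  note * = BVI[where f = f, OF 1 2]
  show "f \<in> bv" by (rule *)
  show "BVn f \<le> 2 * (\<Sum>i. cmod (c i))" using *(2) by simp
qed

lemma ind_BV: "ind a \<in> bv"
  using BVI(1)[of "ind a" 1 1] ind_chain by (auto simp: ind_eq)

text \<open>Within \<open>X\<close> the two intervals differ by the point \<open>a\<close>
  only.\<close>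

lemma ind_lower_representative:
  assumes "a \<in> X" "a \<notin> X1" "a \<noteq> zero_seq"
  obtains a' where "a' \<in> X1" "(\<lambda>x. ind a x - ind a' x) \<in> null" "less_fun a' a"
proof -
  obtain a' where a': "a' \<in> X1" "less_fun a' a" "\<And>x. x \<in> X \<Longrightarrow> less_fun x a \<Longrightarrow> x \<preceq> a'"
    using lower_representative[OF assms] by blast
  have "ind a x - ind a' x = 0" if "x \<in> X" "x \<notin> {a}" for x
    using a'(2) a'(3)[OF that(1)] that lex.order_trans[of x a' a] by (auto simp: ind_eq lex_le_def)
  then have "(\<lambda>x. ind a x - ind a' x) \<in> null"
    by (intro nullI[of _ "{a}"]) (auto intro: BV_diff ind_BV)
  then show thesis using that a' by blast
qed

lemma ind_zero_null: "ind zero_seq \<in> null"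
  using zero_seq_le lex.order_antisym[of _ zero_seq]
  by (intro nullI[of _ "{zero_seq}"]) (auto intro: ind_BV simp: ind_eq)

text \<open>The step functions with breakpoints in \<open>X1\<close>, together with the value of the linear functional
  sending \<open>ind a\<close> to \<open>G a\<close>.\<close>

inductive comb :: "(digits \<Rightarrow> complex) \<Rightarrow> (digits \<Rightarrow> complex) \<Rightarrow> complex \<Rightarrow> bool" for G where
  comb_0: "comb G (\<lambda>_. 0) 0"
| comb_Suc: "comb G f z \<Longrightarrow> a \<in> X1 \<Longrightarrow> comb G (\<lambda>x. f x + c * ind a x) (z + c * G a)"

lemma comb_BV: "comb G f z \<Longrightarrow> f \<in> bv"
  by (induction rule: comb.induct) (auto intro!: BV_const BV_add BV_cmult ind_BV)

lemma comb_add: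
  assumes "comb G f z" "comb G g w" shows "comb G (\<lambda>x. f x + g x) (z + w)"
  using assms(2)
proof (induction rule: comb.induct)
  case comb_0 then show ?case using assms(1) by simp
next
  case (comb_Suc g w a c)
  then show ?case using comb.comb_Suc[of G "\<lambda>x. f x + g x" "z + w" a c] by (simp add: add.assoc)
qed

lemma comb_cmult: "comb G f z \<Longrightarrow> comb G (\<lambda>x. c * f x) (c * z)"
proof (induction rule: comb.induct)
  case comb_0 then show ?case using comb.comb_0 by simp
next
  case (comb_Suc g w a d)
  then show ?case using comb.comb_Suc[of G "\<lambda>x. c * g x" "c * w" a "c * d"]
    by (simp add: distrib_left mult.assoc)
qed

lemma comb_diff: "comb G f z \<Longrightarrow> comb G g w \<Longrightarrow> comb G (\<lambda>x. f x - g x) (z - w)"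
  using comb_add[OF _ comb_cmult[of G g w "-1"], of f z] by simp

section \<open>Step functions: coefficients against the norm of \<open>B\<close>\<close>

lemma comb_change: "comb G f z \<Longrightarrow> \<exists>w. comb G' f w"
  by (induction rule: comb.induct) (blast intro: comb.intros)+

text \<open>Repeated breakpoints are merged, because the lower bound on the norm needs distinct
  ones.\<close>

lemma comb_repr:
  assumes "comb G f z"
  shows "\<exists>A d. finite A \<and> A \<subseteq> X1 \<and> f = (\<lambda>x. \<Sum>a\<in>A. d a * ind a x) \<and> z = (\<Sum>a\<in>A. d a * G a)"
  using assms
proof (induction rule: comb.induct)
  case comb_0 then show ?case by (intro exI[of _ "{}"]) auto
next
  case (comb_Suc f z a c)
  then obtain A d where A: "finite A" "A \<subseteq> X1" "f = (\<lambda>x. \<Sum>a\<in>A. d a * ind a x)" "z = (\<Sum>a\<in>A. d a * G a)"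
    by blast
  define d' where "d' = d(a := (if a \<in> A then d a else 0) + c)"
  have "(\<Sum>b\<in>insert a A. d' b * F b) = (\<Sum>b\<in>A. d b * F b) + c * F a" for F :: "digits \<Rightarrow> complex"
  proof -
    have "(\<Sum>b\<in>insert a A. d' b * F b) = d' a * F a + (\<Sum>b\<in>A - {a}. d' b * F b)"
      using A by (simp add: sum.insert_remove)
    also have "(\<Sum>b\<in>A - {a}. d' b * F b) = (\<Sum>b\<in>A - {a}. d b * F b)"
      by (intro sum.cong) (auto simp: d'_def)
    also have "d' a * F a + \<dots> = (\<Sum>b\<in>A. d b * F b) + c * F a"
      using A by (auto simp: d'_def sum.remove[of A a] distrib_right)
    finally show ?thesis .
  qed
  then show ?case using A comb_Suc.hyps by (intro exI[of _ "insert a A"] exI[of _ d']) auto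
qed

text \<open>The variation along the listed points, closed by the modulus at the last one as if the
  function then dropped to 0. The closing term detects the largest breakpoint and is paid for by the
  supremum in the norm.\<close>

fun jumps :: "(digits \<Rightarrow> complex) \<Rightarrow> digits list \<Rightarrow> real" where
  "jumps f [] = 0"
| "jumps f [x] = cmod (f x)"
| "jumps f (x # y # zs) = cmod (f x - f y) + jumps f (y # zs)"

lemma jumps_cong: "(\<And>x. x \<in> set xs \<Longrightarrow> f x = g x) \<Longrightarrow> jumps f xs = jumps g xs"
  by (induction f xs rule: jumps.induct) auto

lemma jumps_sum: "xs \<noteq> [] \<Longrightarrow>
  jumps f xs = (\<Sum>i<length xs - 1. cmod (f (xs ! Suc i) - f (xs ! i))) + cmod (f (last xs))"
proof (induction f xs rule: jumps.induct)
  case (3 f x y zs)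
  then show ?case
    by (simp add: sum.lessThan_Suc_shift norm_minus_commute del: sum.lessThan_Suc)
qed auto

lemma jumps_le:
  assumes "f \<in> bv" "sorted_wrt less_fun xs" "set xs \<subseteq> X" shows "jumps f xs \<le> BVn f"
proof (cases "xs = []")
  case True then show ?thesis using BVn_nonneg[OF assms(1)] by simp
next
  case False
  have "(\<Sum>i<length xs - 1. cmod (f (xs ! Suc i) - f (xs ! i))) \<le> tv f"
  proof (intro chain_le_tv[OF assms(1)] allI impI)
    show "xs ! i \<in> X" if "i \<le> length xs - 1" for i
      using that False assms(3) nth_mem[of i xs] by (cases xs) auto
    show "xs ! i \<preceq> xs ! Suc i" if "i < length xs - 1" for i
      using that assms(2) by (auto simp: sorted_wrt_iff_nth_less lex_le_def)
  qed
  moreover have "cmod (f (last xs)) \<le> (SUP x\<in>X. cmod (f x))"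
    using False assms(3) by (intro sup_le[OF assms(1)]) auto
  ultimately show ?thesis using jumps_sum[OF False, of f] by (simp add: BVn_eq)
qed

text \<open>Induction from the smallest breakpoint upwards. One point off \<open>N\<close> is placed
  before each breakpoint, so that passing \<open>a0\<close> changes the combination by exactly
  \<open>d a0\<close>. The condition on \<open>hd xs\<close> keeps the first chosen point below all
  breakpoints of \<open>A\<close>, where the combination is the full sum of the
  coefficients.\<close>

lemma separating_points:
  assumes "finite A" "A \<subseteq> X1" "countable N" "b \<in> X" "\<forall>a\<in>A. less_fun b a"
  shows "\<exists>xs. sorted_wrt less_fun xs \<and> set xs \<subseteq> X - N \<and> (\<forall>x\<in>set xs. less_fun b x) \<and>
    (A \<noteq> {} \<longrightarrow> xs \<noteq> [] \<and> (\<forall>a\<in>A. hd xs \<preceq> a)) \<and>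
    (\<Sum>a\<in>A. cmod (d a)) \<le> jumps (\<lambda>x. \<Sum>a\<in>A. d a * ind a x) xs"
  using assms(1,2,4,5)
proof (induction A arbitrary: b rule: lex.finite_linorder_min_induct)
  case empty
  show ?case by (intro exI[of _ "[]"]) auto
next
  case (insert a0 A)
  have a0: "a0 \<in> X1" "a0 \<in> X" "less_fun b a0" using insert.prems X1_X by auto
  from insert.IH[of a0] insert.prems insert.hyps a0 obtain xs where
    xs: "sorted_wrt less_fun xs" "set xs \<subseteq> X - N" "\<forall>x\<in>set xs. less_fun a0 x"
      "A \<noteq> {} \<longrightarrow> xs \<noteq> [] \<and> (\<forall>a\<in>A. hd xs \<preceq> a)"
      "(\<Sum>a\<in>A. cmod (d a)) \<le> jumps (\<lambda>x. \<Sum>a\<in>A. d a * ind a x) xs" by auto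
  obtain x1 where x1: "x1 \<in> X" "x1 \<notin> N" "less_fun b x1" "x1 \<preceq> a0"
  proof -
    \<comment> \<open>An uncountable interval is not exhausted by \<open>N\<close>.\<close>
    have "\<not> {x \<in> X. less_fun b x \<and> x \<preceq> a0} \<subseteq> N"
      using between_uncountable[OF insert.prems(2) a0(1,3)] countable_subset[OF _ assms(3)] by metis
    then show thesis using that by blast
  qed
  have a0A: "a0 \<notin> A" using insert.hyps(2) lex.less_irrefl by blast
  define s where "s = (\<lambda>x. \<Sum>a\<in>insert a0 A. d a * ind a x)"
  define s' where "s' = (\<lambda>x. \<Sum>a\<in>A. d a * ind a x)"
  have s: "s x = d a0 * ind a0 x + s' x" for x using insert.hyps(1) a0A by (simp add: s_def s'_def)
  have sx: "s x = s' x" if "x \<in> X" "less_fun a0 x" for x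
    using that by (simp add: s ind_eq lex.not_le[symmetric])
  have s'x: "s' x = (\<Sum>a\<in>A. d a)" if "x \<in> X" "\<forall>a\<in>A. x \<preceq> a" for x
    unfolding s'_def using that by (intro sum.cong) (auto simp: ind_eq)
  have sx1: "s x1 = d a0 + (\<Sum>a\<in>A. d a)"
  proof -
    have "\<forall>a\<in>A. x1 \<preceq> a"
      using insert.hyps(2) lex.le_less_trans[OF x1(4)] lex.less_imp_le by blast
    then show ?thesis using s[of x1] s'x[OF x1(1)] x1(1,4) by (simp add: ind_eq)
  qed
  have eq: "jumps s xs = jumps s' xs" using xs sx by (intro jumps_cong) auto
  \<comment> \<open>Between \<open>x1\<close> and the next point only \<open>a0\<close> is crossed;
    if there is no next point, the closing modulus is that of \<open>d a0\<close>.\<close>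
  have "cmod (d a0) + jumps s' xs \<le> jumps s (x1 # xs)"
  proof (cases xs)
    case Nil
    then have "A = {}" using xs(4) by blast
    then show ?thesis using Nil sx1 by simp
  next
    case (Cons y ys)
    have "s y = (\<Sum>a\<in>A. d a)" using xs Cons sx[of y] s'x[of y] by (cases "A = {}") auto
    then show ?thesis using Cons eq sx1 by simp
  qed
  then have "(\<Sum>a\<in>insert a0 A. cmod (d a)) \<le> jumps s (x1 # xs)"
    using xs(5) insert.hyps(1) a0A by (simp add: s'_def)
  moreover have "sorted_wrt less_fun (x1 # xs)" using xs(1,3) x1(4) lex.le_less_trans by auto
  moreover have "\<forall>x\<in>set (x1 # xs). less_fun b x" using xs(3) x1(3) a0(3) lex.less_trans by auto
  moreover have "\<forall>a\<in>insert a0 A. x1 \<preceq> a" using x1(4) insert.hyps(2) lex.less_imp_le lex.order_trans by blast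
  ultimately show ?case using xs(2) x1 unfolding s_def by (intro exI[of _ "x1 # xs"]) auto
qed

lemma coefficient_bound:
  assumes "finite A" "A \<subseteq> X1" "f \<in> bv" "countable N"
    and "\<And>x. x \<in> X \<Longrightarrow> x \<notin> N \<Longrightarrow> f x = (\<Sum>a\<in>A. d a * ind a x)"
  shows "(\<Sum>a\<in>A. cmod (d a)) \<le> BVn f"
proof -
  have "\<forall>a\<in>A. less_fun zero_seq a"
  proof
    fix a assume "a \<in> A"
    then obtain i where "a i = 1" using assms(2) unfolding X1_def by blast
    then have "a \<noteq> zero_seq" by (auto simp: zero_seq_def)
    then show "less_fun zero_seq a" using zero_seq_le[of a] by (auto simp: lex_le_def)
  qed
  from separating_points[OF assms(1,2,4) zero_in this, of d] obtain xs where
    xs: "sorted_wrt less_fun xs" "set xs \<subseteq> X - N"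
      "(\<Sum>a\<in>A. cmod (d a)) \<le> jumps (\<lambda>x. \<Sum>a\<in>A. d a * ind a x) xs" by blast
  have "jumps (\<lambda>x. \<Sum>a\<in>A. d a * ind a x) xs = jumps f xs"
    using xs(2) assms(5) by (intro jumps_cong) auto
  also have "\<dots> \<le> BVn f" using xs by (intro jumps_le[OF assms(3)]) auto
  finally show ?thesis using xs(3) by linarith
qed

text \<open>The bound holds for every representative and so survives the infimum. This is the lower
  half of the comparison with \<open>l1\<close>; \<open>series_BV\<close> is the upper half.\<close>

lemma coefficient_bound_Nm:
  assumes "finite A" "A \<subseteq> X1"
  shows "(\<Sum>a\<in>A. cmod (d a)) \<le> Nm (\<lambda>x. \<Sum>a\<in>A. d a * ind a x)"
  unfolding B_norm_def
proof (rule cINF_greatest)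
  define s where "s = (\<lambda>x. \<Sum>a\<in>A. d a * ind a x)"
  have sBV: "s \<in> bv" unfolding s_def using assms(1)
    by (induction A rule: finite_induct) (auto intro!: BV_const BV_add BV_cmult ind_BV)
  show "cls \<beta> (\<lambda>x. \<Sum>a\<in>A. d a * ind a x) \<noteq> {}" using cls_self by blast
  fix f assume f: "f \<in> cls \<beta> (\<lambda>x. \<Sum>a\<in>A. d a * ind a x)"
  then show "(\<Sum>a\<in>A. cmod (d a)) \<le> BVn f"
    by (intro coefficient_bound[OF assms _ null_countable[OF f[unfolded cls_iff]]])
      (auto intro: cls_BV[OF sBV, unfolded s_def])
qed

text \<open>A bounded \<open>G\<close> gives a functional bounded in the norm of \<open>B\<close>.
  Applied to differences, this shows that \<open>z\<close> depends on the class of \<open>f\<close>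
  only.\<close>

lemma comb_bound:
  assumes "comb G f z" "\<And>a. a \<in> X1 \<Longrightarrow> cmod (G a) \<le> B"
  shows "cmod z \<le> B * Nm f"
proof -
  obtain A d where A: "finite A" "A \<subseteq> X1" "f = (\<lambda>x. \<Sum>a\<in>A. d a * ind a x)" "z = (\<Sum>a\<in>A. d a * G a)"
    using comb_repr[OF assms(1)] by blast
  have B: "0 \<le> B" using assms(2)[OF q_in1] norm_ge_zero order_trans by blast
  have "cmod z \<le> (\<Sum>a\<in>A. cmod (d a) * B)" unfolding A(4)
    using A(2) assms(2) by (intro sum_norm_le) (auto simp: norm_mult intro!: mult_left_mono)
  also have "\<dots> = B * (\<Sum>a\<in>A. cmod (d a))" by (simp add: sum_distrib_left mult.commute)
  also have "\<dots> \<le> B * Nm f" unfolding A(3) by (intro mult_left_mono coefficient_bound_Nm A B)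
  finally show ?thesis .
qed

lemma ind_comb: "a \<in> X1 \<Longrightarrow> comb G (ind a) (G a)"
  using comb_Suc[OF comb_0, of a G 1] by simp

lemma ind_comb_mod_null:
  assumes "a \<in> X" shows "\<exists>f z. comb G f z \<and> (\<lambda>x. ind a x - f x) \<in> null"
proof (cases "a \<in> X1")
  case True then show ?thesis using ind_comb null_zero by (intro exI[of _ "ind a"]) auto
next
  case False
  show ?thesis
  proof (cases "a = zero_seq")
    case True then show ?thesis using comb_0 ind_zero_null by (intro exI[of _ "\<lambda>_. 0"]) auto
  next
    case neq: False
    obtain a' where "a' \<in> X1" "(\<lambda>x. ind a x - ind a' x) \<in> null"
      using ind_lower_representative[OF assms False neq] by blast
    then show ?thesis using ind_comb[of a' G] by blast
  qed
qed

text \<open>Off the point \<open>a\<close> the indicator of \<open>[a,b]\<close> is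
  \<open>ind b - ind a\<close>. What remains to be seen is that a correction at a single point has
  bounded variation.\<close>

lemma ival_mod_null:
  assumes "a \<in> X" "b \<in> X"
  shows "(\<lambda>x. indicator (ival \<beta> a b) x - (if a \<preceq> b then ind b x - ind a x else 0)) \<in> null"
proof (rule nullI[of _ "{a}"])
  have *: "indicator (ival \<beta> a b) x - (if a \<preceq> b then ind b x - ind a x else 0) = (0 :: complex)"
    if "x \<in> X" "x \<notin> {a}" for x
    using that lex.linear[of a x] lex.order_trans[of a x b] lex.order_antisym[of x a] lex.order_trans[of x a b]
    by (auto simp: ind_eq indicator_def ival_def)
  then show "\<And>x. x \<in> X \<Longrightarrow> x \<notin> {a} \<Longrightarrow>
    indicator (ival \<beta> a b) x - (if a \<preceq> b then ind b x - ind a x else 0) = (0 :: complex)" .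
  have "(\<lambda>x. ind b x - ind a x) \<in> bv" by (intro BV_diff ind_BV)
  then have 1: "(\<lambda>x. if a \<preceq> b then ind b x - ind a x else 0) \<in> bv"
    using BV_const(1)[of 0] by (cases "a \<preceq> b") auto
  define g :: "digits \<Rightarrow> complex" where "g x = (if x = a then if a \<preceq> b then 1 else 0 else 0)" for x
  have "g \<in> bv"
  proof (rule BVI)
    show "cmod (g x) \<le> 1" for x by (simp add: g_def)
    fix n c assume c: "\<forall>i\<le>n. c i \<in> X" "\<forall>i<n. c i \<preceq> c (Suc i)"
    \<comment> \<open>The indicator of the point \<open>a\<close> is \<open>L - R\<close>. Both
      functions decrease with values in \<open>{0, 1}\<close>, hence the bound 2.\<close>
    define L R :: "digits \<Rightarrow> real" where "L x = (if x \<preceq> a then 1 else 0)" and "R x = (if less_fun x a then 1 else 0)" for x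
    have gLR: "cmod (g x - g y) \<le> (L y - L x) + (R y - R x)" if "y \<preceq> x" for x y
      using that lex.order_trans[of y x a] lex.le_less_trans[of y x a] lex.le_less
      by (auto simp: g_def L_def R_def)
    have "(\<Sum>i<n. cmod (g (c (Suc i)) - g (c i))) \<le>
        (\<Sum>i<n. (L (c i) - L (c (Suc i))) + (R (c i) - R (c (Suc i))))"
      using c by (intro sum_mono gLR) auto
    also have "\<dots> = (L (c 0) - L (c n)) + (R (c 0) - R (c n))"
      using sum_lessThan_telescope'[of "\<lambda>i. L (c i)" n] sum_lessThan_telescope'[of "\<lambda>i. R (c i)" n]
      by (simp only: sum.distrib)
    also have "\<dots> \<le> 2" by (auto simp: L_def R_def)
    finally show "(\<Sum>i<n. cmod (g (c (Suc i)) - g (c i))) \<le> 2" .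
  qed
  from BV_add(1)[where f = "\<lambda>x. if a \<preceq> b then ind b x - ind a x else 0", OF 1 this] have "(\<lambda>x. (if a \<preceq> b then ind b x - ind a x else 0) + g x) \<in> bv" .
  then have "indicator (ival \<beta> a b) \<in> bv"
  proof (rule BV_cong)
    fix x assume x: "x \<in> X"
    show "indicator (ival \<beta> a b) x = (if a \<preceq> b then ind b x - ind a x else 0) + g x"
      using *[OF x] x by (cases "x = a") (auto simp: g_def ind_eq indicator_def ival_def)
  qed
  from BV_diff(1)[where g = "\<lambda>x. if a \<preceq> b then ind b x - ind a x else 0", OF this 1]
  show "(\<lambda>x. indicator (ival \<beta> a b) x - (if a \<preceq> b then ind b x - ind a x else 0)) \<in> bv" .
qed simp

lemma step_comb:
  assumes "s \<in> step_fun \<beta>" shows "\<exists>f z. comb G f z \<and> (\<lambda>x. s x - f x) \<in> null"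
proof -
  obtain n :: nat and c a b where s: "s = (\<lambda>x. \<Sum>i<n. c i * indicator (ival \<beta> (a i) (b i)) x)"
    and ab: "\<forall>i<n. a i \<in> X \<and> b i \<in> X"
    using assms unfolding step_fun_def mem_Collect_eq by (elim exE conjE) (rule that)
  have one: "\<exists>f z. comb G f z \<and> (\<lambda>x. indicator (ival \<beta> a b) x - f x) \<in> null" if ab: "a \<in> X" "b \<in> X" for a b
  proof (cases "a \<preceq> b")
    case True
    obtain f z g w where fg: "comb G f z" "(\<lambda>x. ind a x - f x) \<in> null" "comb G g w" "(\<lambda>x. ind b x - g x) \<in> null"
      using ind_comb_mod_null ab by meson
    have "(\<lambda>x. indicator (ival \<beta> a b) x - (ind b x - ind a x) + ((ind b x - g x) - (ind a x - f x))) \<in> null"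
      using null_add[OF ival_mod_null[OF ab] null_diff[OF fg(4,2)]] True by simp
    then show ?thesis using comb_diff[OF fg(3,1)] by (intro exI[of _ "\<lambda>x. g x - f x"]) (auto simp: algebra_simps)
  next
    case False
    then have "comb G (\<lambda>_. 0) 0 \<and> (\<lambda>x. indicator (ival \<beta> a b) x - 0) \<in> null"
      using ival_mod_null[OF ab] comb_0[of G] by simp
    then show ?thesis by (rule_tac exI[of _ "\<lambda>_. 0"], rule_tac exI[of _ 0])
  qed
  show ?thesis unfolding s using ab
  proof (induction n)
    case 0 then show ?case using comb_0[of G] null_zero
      by (intro exI[of _ "\<lambda>_. 0"] exI[of _ "0 :: complex"]) simp
  next
    case (Suc n)
    then obtain f z where f: "comb G f z" "(\<lambda>x. (\<Sum>i<n. c i * indicator (ival \<beta> (a i) (b i)) x) - f x) \<in> null"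
      by auto
    obtain g w where g: "comb G g w" "(\<lambda>x. indicator (ival \<beta> (a n) (b n)) x - g x) \<in> null"
      using one Suc.prems by blast
    have "(\<lambda>x. (\<Sum>i<Suc n. c i * indicator (ival \<beta> (a i) (b i)) x) - (f x + c n * g x)) \<in> null"
      using null_add[OF f(2) null_cmult[OF g(2), of "c n"]] by (simp add: algebra_simps)
    then show ?case using comb_add[OF f(1) comb_cmult[OF g(1), of "c n"]] by blast
  qed
qed

lemma comb_step: "comb G f z \<Longrightarrow> f \<in> step_fun \<beta>"
proof (induction rule: comb.induct)
  case comb_0
  show ?case unfolding step_fun_def by (rule CollectI, rule exI[of _ 0]) auto
next
  case (comb_Suc f z a0 c0)
  then obtain n :: nat and c a b where f: "f = (\<lambda>x. \<Sum>i<n. c i * indicator (ival \<beta> (a i) (b i)) x)"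
    and ab: "\<forall>i<n. a i \<in> X \<and> b i \<in> X" unfolding step_fun_def mem_Collect_eq by (elim exE conjE) (rule that)
  show ?case unfolding step_fun_def
    using ab zero_in X1_X[OF comb_Suc.hyps(2)]
    by (intro CollectI exI[of _ "Suc n"] exI[of _ "c(n := c0)"] exI[of _ "a(n := zero_seq)"] exI[of _ "b(n := a0)"])
      (auto simp: f fun_eq_iff ind_def less_Suc_eq intro!: sum.cong)
qed

section \<open>The space F, through representatives\<close>

definition FF :: "(digits \<Rightarrow> complex) set" where "FF = {f. cls \<beta> f \<in> F_space \<beta>}"

text \<open>Intervals may be replaced by combinations of \<open>ind a\<close> with \<open>a\<close>
  in \<open>X1\<close>, since both kinds of step functions agree modulo null functions. The choice
  of \<open>G\<close> is free, so that values can be tracked during approximation.\<close>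

lemma FF_iff: "f \<in> FF \<longleftrightarrow> f \<in> bv \<and> (\<forall>e>0. \<exists>s z. comb G s z \<and> Nm (\<lambda>x. f x - s x) < e)"
proof -
  have "cls \<beta> f \<in> B_space \<beta> \<longleftrightarrow> f \<in> bv"
    unfolding B_space_def using cls_self[of f] cls_BV by blast
  moreover have "(\<exists>s\<in>step_fun \<beta>. Nm (\<lambda>x. f x - s x) < e) \<longleftrightarrow> (\<exists>s z. comb G s z \<and> Nm (\<lambda>x. f x - s x) < e)" for e
  proof
    assume "\<exists>s\<in>step_fun \<beta>. Nm (\<lambda>x. f x - s x) < e"
    then obtain s where s: "s \<in> step_fun \<beta>" "Nm (\<lambda>x. f x - s x) < e" by blast
    obtain g z where g: "comb G g z" "(\<lambda>x. s x - g x) \<in> null" using step_comb[OF s(1)] by blast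
    have "Nm (\<lambda>x. f x - g x) = Nm (\<lambda>x. f x - s x)" by (rule Nm_cong) (use g in simp)
    then show "\<exists>s z. comb G s z \<and> Nm (\<lambda>x. f x - s x) < e" using g s by metis
  next
    assume "\<exists>s z. comb G s z \<and> Nm (\<lambda>x. f x - s x) < e"
    then show "\<exists>s\<in>step_fun \<beta>. Nm (\<lambda>x. f x - s x) < e" using comb_step by blast
  qed
  ultimately show ?thesis unfolding FF_def F_space_def B_diff_cls mem_Collect_eq by simp
qed

lemma F_space_cls: "u \<in> F_space \<beta> \<longleftrightarrow> (\<exists>f\<in>FF. u = cls \<beta> f)"
  unfolding FF_def F_space_def B_space_def by blast

lemma FF_BV: "f \<in> FF \<Longrightarrow> f \<in> bv" using FF_iff by blast

lemma FF_approx: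
  assumes "f \<in> FF" "e > 0" obtains s z where "comb G s z" "Nm (\<lambda>x. f x - s x) < e"
  using assms FF_iff[of f G] by blast

lemma comb_FF: "comb G f z \<Longrightarrow> f \<in> FF"
  using Nm_le_BVn[OF BV_const(1)[of 0]] BV_const(2)[of 0] comb_BV[of G f z]
  by (subst FF_iff[of _ G]) (auto intro!: exI[of _ f] exI[of _ z])

lemma FF_add: assumes "f \<in> FF" "g \<in> FF" shows "(\<lambda>x. f x + g x) \<in> FF"
proof (subst FF_iff[of _ "\<lambda>_. 0"], intro conjI allI impI)
  show "(\<lambda>x. f x + g x) \<in> bv" using assms FF_BV BV_add by blast
  fix e :: real assume "e > 0"
  then have e: "e / 2 > 0" by simp
  obtain s z s' z' where s: "comb (\<lambda>_. 0) s z" "Nm (\<lambda>x. f x - s x) < e/2" "comb (\<lambda>_. 0) s' z'" "Nm (\<lambda>x. g x - s' x) < e/2"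
    by (rule FF_approx[OF assms(1) e, of "\<lambda>_. 0"], rule FF_approx[OF assms(2) e, of "\<lambda>_. 0"], rule that)
  have "Nm (\<lambda>x. (f x - s x) + (g x - s' x)) < e"
    using Nm_add[of "\<lambda>x. f x - s x" "\<lambda>x. g x - s' x"] s assms FF_BV BV_diff(1) comb_BV by fastforce
  then show "\<exists>s z. comb (\<lambda>_. 0) s z \<and> Nm (\<lambda>x. f x + g x - s x) < e"
    using comb_add[OF s(1,3)] by (intro exI[of _ "\<lambda>x. s x + s' x"]) (auto simp: algebra_simps)
qed

lemma FF_cmult: assumes "f \<in> FF" shows "(\<lambda>x. c * f x) \<in> FF"
proof (subst FF_iff[of _ "\<lambda>_. 0"], intro conjI allI impI)
  show "(\<lambda>x. c * f x) \<in> bv" using assms FF_BV BV_cmult by blast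
  fix e :: real assume e: "e > 0"
  have e': "0 < e / (cmod c + 1)" using e by (simp add: add_nonneg_pos)
  obtain s z where s: "comb (\<lambda>_. 0) s z" "Nm (\<lambda>x. f x - s x) < e / (cmod c + 1)"
    using FF_approx[OF assms e'] by metis
  have B: "(\<lambda>x. f x - s x) \<in> bv" using s comb_BV FF_BV[OF assms] BV_diff by blast
  have "Nm (\<lambda>x. c * (f x - s x)) \<le> cmod c * Nm (\<lambda>x. f x - s x)" using Nm_cmult[OF B] .
  also have "\<dots> \<le> (cmod c + 1) * Nm (\<lambda>x. f x - s x)" using Nm_nonneg[OF B] by (intro mult_right_mono) auto
  also have "\<dots> < (cmod c + 1) * (e / (cmod c + 1))"
    using s by (intro mult_strict_left_mono) (auto simp: add_nonneg_pos)
  also have "\<dots> = e" by (simp add: add_nonneg_pos[THEN less_imp_neq, symmetric])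
  finally show "\<exists>s z. comb (\<lambda>_. 0) s z \<and> Nm (\<lambda>x. c * f x - s x) < e"
    using comb_cmult[OF s(1), of c] by (intro exI[of _ "\<lambda>x. c * s x"]) (auto simp: algebra_simps)
qed

lemma FF_diff: "f \<in> FF \<Longrightarrow> g \<in> FF \<Longrightarrow> (\<lambda>x. f x - g x) \<in> FF"
  using FF_add[OF _ FF_cmult[of g "-1"], of f] by simp

lemma FF_cls: "f \<in> FF \<Longrightarrow> cls \<beta> f = cls \<beta> g \<Longrightarrow> g \<in> FF" by (simp add: FF_def)

lemma ind_FF: "a \<in> X \<Longrightarrow> ind a \<in> FF"
  using ind_comb_mod_null[of a "\<lambda>_. 0"] comb_FF FF_cls cls_eqI by metis

lemma FF_zero: "(\<lambda>_. 0) \<in> FF" using comb_FF comb_0 by blast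

lemma FF_closed:
  assumes "f \<in> bv" "\<And>e. e > 0 \<Longrightarrow> \<exists>g\<in>FF. Nm (\<lambda>x. f x - g x) < e"
  shows "f \<in> FF"
proof (subst FF_iff[of _ "\<lambda>_. 0"], intro conjI allI impI)
  fix e :: real assume e: "e > 0"
  obtain g where g: "g \<in> FF" "Nm (\<lambda>x. f x - g x) < e/2" using assms(2)[of "e/2"] e by auto
  obtain s z where s: "comb (\<lambda>_. 0) s z" "Nm (\<lambda>x. g x - s x) < e/2"
    using FF_approx[OF g(1), of "e/2"] e by (metis half_gt_zero)
  have "Nm (\<lambda>x. (f x - g x) + (g x - s x)) < e"
    using Nm_add[of "\<lambda>x. f x - g x" "\<lambda>x. g x - s x"] s g assms(1) FF_BV BV_diff(1) comb_BV by fastforce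
  then show "\<exists>s z. comb (\<lambda>_. 0) s z \<and> Nm (\<lambda>x. f x - s x) < e" using s by auto
qed (rule assms)

text \<open>Truncations lie in \<open>F\<close>, and the remainder is a series of the same kind, so
  \<open>series_BV\<close> bounds it by a tail.\<close>

lemma series_FF:
  assumes sc: "summable (\<lambda>i. cmod (c i))" and f: "\<And>x. x \<in> X \<Longrightarrow> f x = (\<Sum>i. c i * ind (a i) x)"
    and a: "\<And>i. a i \<in> X"
  shows "f \<in> FF" "\<And>n. Nm (\<lambda>x. f x - (\<Sum>i<n. c i * ind (a i) x)) \<le> 2 * (\<Sum>i. cmod (c (i + n)))"
    "\<And>n. (\<lambda>x. \<Sum>i<n. c i * ind (a i) x) \<in> FF"
proof -
  show P: "(\<lambda>x. \<Sum>i<n. c i * ind (a i) x) \<in> FF" for n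
    by (induction n) (auto intro!: FF_zero FF_add FF_cmult ind_FF a)
  have N: "(\<lambda>x. f x - (\<Sum>i<n. c i * ind (a i) x)) \<in> bv \<and>
      BVn (\<lambda>x. f x - (\<Sum>i<n. c i * ind (a i) x)) \<le> 2 * (\<Sum>i. cmod (c (i + n)))" for n
  proof -
    have sn: "summable (\<lambda>i. cmod (c (i + n)))" using sc by (subst summable_iff_shift)
    have "f x - (\<Sum>i<n. c i * ind (a i) x) = (\<Sum>i. c (i + n) * ind (a (i + n)) x)" if "x \<in> X" for x
    proof -
      have "summable (\<lambda>i. c i * ind (a i) x)"
        by (rule summable_norm_cancel, rule summable_comparison_test'[OF sc, of 0])
          (use that in \<open>auto simp: norm_mult ind_eq\<close>)
      from suminf_split_initial_segment[OF this, of n] show ?thesis using f[OF that] by simp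
    qed
    from series_BV[OF sn this] show ?thesis by blast
  qed
  show N2: "Nm (\<lambda>x. f x - (\<Sum>i<n. c i * ind (a i) x)) \<le> 2 * (\<Sum>i. cmod (c (i + n)))" for n
    using N[of n] Nm_le_BVn order_trans by blast
  show "f \<in> FF"
  proof (rule FF_closed)
    show "f \<in> bv" using series_BV[OF sc f] by blast
    fix e :: real assume "e > 0"
    then obtain n where "norm (\<Sum>i. cmod (c (i + n))) < e / 2"
      using suminf_exist_split[OF _ sc, of "e/2"] by auto
    then show "\<exists>g\<in>FF. Nm (\<lambda>x. f x - g x) < e" using N2[of n] P[of n] by (intro bexI[OF _ P[of n]]) auto
  qed
qed

section \<open>The transfer operator\<close>

abbreviation "T \<equiv> transfer_fun \<beta> t"

text \<open>The candidates for preimages are \<open>0x\<close>, always admissible, and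
  \<open>1x\<close>, admissible exactly when \<open>x \<preceq> shift q\<close>.\<close>

lemma T_eq:
  assumes "x \<in> X"
  shows "T f x = f (prepend 0 x) + (if x \<preceq> shift q then of_real (exp t) * f (prepend 1 x) else 0)"
proof -
  have "{y. y \<in> X \<and> shift y = x} = (if x \<preceq> shift q then {prepend 0 x, prepend 1 x} else {prepend 0 x})"
  proof (rule set_eqI)
    fix y
    have "y = prepend (y 0) x" if "shift y = x" using prepend_shift[of y] that by simp
    then have "y \<in> X \<and> shift y = x \<longleftrightarrow> (y = prepend 0 x \<or> y = prepend 1 x) \<and> y \<in> X"
      using X_digit[of y 0] by (metis insertE prepend_simps(3) singletonD)
    then show "y \<in> {y. y \<in> X \<and> shift y = x} \<longleftrightarrow>
        y \<in> (if x \<preceq> shift q then {prepend 0 x, prepend 1 x} else {prepend 0 x})"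
      using prepend0_in[OF assms] prepend1_in_iff[OF assms] by auto
  qed
  moreover have "prepend 0 x \<noteq> prepend 1 x" by (metis prepend_simps(1) zero_neq_one)
  ultimately show ?thesis unfolding transfer_fun_def
    using assms prepend0_in prepend1_in_iff[OF assms] by (auto simp: cyl1_def)
qed

lemma T_add: "T (\<lambda>x. f x + g x) = (\<lambda>x. T f x + T g x)"
  by (simp add: fun_eq_iff transfer_fun_def distrib_left sum.distrib)

lemma T_cmult: "T (\<lambda>x. c * f x) = (\<lambda>x. c * T f x)"
  by (simp add: fun_eq_iff transfer_fun_def sum_distrib_left mult.left_commute)

lemma T_diff: "T (\<lambda>x. f x - g x) = (\<lambda>x. T f x - T g x)"
  using T_add[of f "\<lambda>x. -1 * g x"] T_cmult[of "-1" g] by simp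

text \<open>If \<open>a\<close> starts with 0, the preimage \<open>1x\<close> is above
  \<open>a\<close>. If \<open>a\<close> starts with 1, every \<open>0x\<close> is below
  \<open>a\<close>, which contributes the constant 1, that is \<open>ind q\<close> on
  \<open>X\<close>; and \<open>1x\<close> is compared with \<open>a\<close> through the tails, where
  \<open>x \<preceq> shift a\<close> already makes \<open>1x\<close> admissible.\<close>

lemma T_ind:
  assumes "a \<in> X" "x \<in> X"
  shows "T (ind a) x = of_nat (a 0) + of_real (exp (t * real (a 0))) * ind (shift a) x"
proof -
  have P: "prepend 0 x \<in> X" "x \<preceq> shift q \<Longrightarrow> prepend 1 x \<in> X"
    using assms prepend0_in prepend1_in_iff by auto
  show ?thesis
  proof (cases "a 0 = 0")
    case True
    have "prepend 0 x \<preceq> a \<longleftrightarrow> x \<preceq> shift a" using lex_le_first[of "prepend 0 x" a] True by simp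
    moreover have "\<not> prepend 1 x \<preceq> a" using lex_le_head[of "prepend 1 x" a] True by auto
    ultimately show ?thesis using P assms True by (auto simp: T_eq ind_eq)
  next
    case False
    then have a0: "a 0 = 1" using X_digit[OF assms(1), of 0] by auto
    have "prepend 0 x \<preceq> a" using less_fun_head[of "prepend 0 x" a] a0 by (simp add: lex_le_def)
    moreover have "prepend 1 x \<preceq> a \<longleftrightarrow> x \<preceq> shift a" using lex_le_first[of "prepend 1 x" a] a0 by simp
    moreover have "shift a \<preceq> shift q" using lex_le_first[of a q] a0 q0 X_le[OF assms(1)] by simp
    ultimately show ?thesis using P assms a0 lex.order_trans[of x "shift a" "shift q"]
      by (auto simp: T_eq ind_eq)
  qed
qed

text \<open>The branch \<open>A\<close> is composition with an increasing map. The branch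
  \<open>B\<close> is cut off at \<open>shift q\<close>, and the cut costs the supremum of
  \<open>f\<close> once more.\<close>

lemma T_BV:
  assumes "f \<in> bv"
  shows "T f \<in> bv" "BVn (T f) \<le> (1 + 2 * exp t) * BVn f"
proof -
  define S where "S = (SUP x\<in>X. cmod (f x))"
  define A where "A x = f (prepend 0 x)" for x
  define B where "B x = (if x \<preceq> shift q then f (prepend 1 x) else 0)" for x
  have S: "cmod (f x) \<le> S" if "x \<in> X" for x using sup_le[OF assms that] by (simp add: S_def)
  have S0: "0 \<le> S" using sup_nonneg[OF assms] by (simp add: S_def)
  have A1: "cmod (A x) \<le> S" if "x \<in> X" for x using S[OF prepend0_in[OF that]] by (simp add: A_def)
  have A2: "(\<Sum>i<n. cmod (A (c (Suc i)) - A (c i))) \<le> tv f"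
    if "\<forall>i\<le>n. c i \<in> X" "\<forall>i<n. c i \<preceq> c (Suc i)" for n c
    unfolding A_def using that prepend0_in lex_le_first[of "prepend 0 _" "prepend 0 _"]
    by (intro chain_le_tv[OF assms]) auto
  have B1: "cmod (B x) \<le> S" if "x \<in> X" for x using S S0 prepend1_in_iff[OF that] by (simp add: B_def)
  have B2: "(\<Sum>i<n. cmod (B (c (Suc i)) - B (c i))) \<le> tv f + S"
    if c: "\<forall>i\<le>n. c i \<in> X" "\<forall>i<n. c i \<preceq> c (Suc i)" for n c
  proof -
    \<comment> \<open>Sending the rest of \<open>X\<close> to \<open>q\<close> extends
      \<open>prepend 1\<close> to an increasing map of \<open>X\<close>; the drop to 0 at the cut is
      recorded by \<open>k\<close>, which telescopes.\<close>
    define g where "g x = (if x \<preceq> shift q then prepend 1 x else q)" for x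
    define k where "k x = (if x \<preceq> shift q then S else 0)" for x
    have gX: "g x \<in> X" if "x \<in> X" for x using prepend1_in_iff[OF that] q_in by (simp add: g_def)
    have gm: "g x \<preceq> g y" if "x \<in> X" "x \<preceq> y" for x y
      using that lex_le_first[of "prepend 1 x" "prepend 1 y"] X_le[OF gX[OF that(1)]]
        lex.order_trans[of x y "shift q"] by (auto simp: g_def)
    have "cmod (B y - B x) \<le> cmod (f (g y) - f (g x)) + (k x - k y)" if "x \<in> X" "x \<preceq> y" for x y
      using that S0 S[of "prepend 1 x"] prepend1_in_iff[OF that(1)] lex.order_trans[of x y "shift q"]
        add_increasing[OF norm_ge_zero[of "f q - f (prepend 1 x)"], of "cmod (f (prepend 1 x))" S]
      by (auto simp: B_def g_def k_def)
    then have "(\<Sum>i<n. cmod (B (c (Suc i)) - B (c i))) \<le>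
        (\<Sum>i<n. cmod (f (g (c (Suc i))) - f (g (c i))) + (k (c i) - k (c (Suc i))))"
      using c by (intro sum_mono) auto
    also have "\<dots> = (\<Sum>i<n. cmod (f (g (c (Suc i))) - f (g (c i)))) + (k (c 0) - k (c n))"
      using sum_lessThan_telescope'[of "\<lambda>i. k (c i)" n] by (simp only: sum.distrib)
    also have "\<dots> \<le> tv f + S"
      using c gX gm S0 by (intro add_mono chain_le_tv[OF assms]) (auto simp: k_def)
    finally show ?thesis .
  qed
  have Abv: "A \<in> bv" "BVn A \<le> BVn f" using BVI[where f = A, OF A1 A2] by (auto simp: BVn_eq S_def)
  have Bbv: "B \<in> bv" "BVn B \<le> 2 * BVn f"
    using BVI[where f = B, OF B1 B2] tv_nonneg[of f] by (auto simp: BVn_eq S_def)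
  have EB: "(\<lambda>x. of_real (exp t) * B x) \<in> bv" "BVn (\<lambda>x. of_real (exp t) * B x) \<le> exp t * BVn B"
    using BV_cmult[OF Bbv(1), of "of_real (exp t)"] by auto
  note s = BV_add[OF Abv(1) EB(1)]
  have eq: "T f x = A x + of_real (exp t) * B x" if "x \<in> X" for x
    using that by (simp add: T_eq A_def B_def)
  show "T f \<in> bv" by (rule BV_cong(1)[OF s(1) eq])
  have "BVn (T f) \<le> BVn A + exp t * BVn B" using BV_cong(2)[OF s(1) eq] s(2) EB(2) by linarith
  also have "\<dots> \<le> BVn f + exp t * (2 * BVn f)" using Abv Bbv by (intro add_mono mult_left_mono) auto
  finally show "BVn (T f) \<le> (1 + 2 * exp t) * BVn f" by (simp add: algebra_simps)
qed

text \<open>A nonzero value at \<open>x\<close> requires a preimage of \<open>x\<close> where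
  \<open>f\<close> is nonzero, and the image of a countable set is countable.\<close>

lemma T_null:
  assumes "f \<in> null" shows "T f \<in> null"
proof (rule nullI)
  show "T f \<in> bv" using T_BV null_BV assms by blast
  show "countable (shift ` {y \<in> X. f y \<noteq> 0})" using null_countable[OF assms] by simp
  show "T f x = 0" if "x \<in> X" "x \<notin> shift ` {y \<in> X. f y \<noteq> 0}" for x
    unfolding transfer_fun_def using that by (intro sum.neutral) auto
qed

lemma transfer_cls: "transfer \<beta> t (cls \<beta> f) = cls \<beta> (T f)"
  unfolding transfer_def
proof (intro UN_const[OF cls_self] cls_eqI)
  fix g assume "g \<in> cls \<beta> f"
  from T_null[OF this[unfolded cls_iff]] show "(\<lambda>x. T g x - T f x) \<in> null" by (simp add: T_diff)
qed

lemma Nm_T: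
  assumes "f \<in> bv" shows "Nm (T f) \<le> (1 + 2 * exp t) * Nm f"
proof (rule field_le_epsilon)
  fix e :: real assume "e > 0"
  define d where "d = e / (1 + 2 * exp t)"
  have E: "0 < 1 + 2 * exp t" by (simp add: add_pos_pos)
  then have d: "d > 0" "(1 + 2 * exp t) * d = e" using \<open>e > 0\<close> by (auto simp: d_def)
  then have "Nm f < Nm f + d" by simp
  then obtain g where g: "g \<in> cls \<beta> f" "g \<in> bv" "BVn g < Nm f + d" by (rule Nm_approx[OF assms])
  have "T g \<in> cls \<beta> (T f)" using T_null[OF g(1)[unfolded cls_iff]] by (simp add: cls_iff T_diff)
  then have "Nm (T f) \<le> BVn (T g)" using Nm_le T_BV assms by blast
  also have "\<dots> \<le> (1 + 2 * exp t) * BVn g" using T_BV g by blast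
  also have "\<dots> \<le> (1 + 2 * exp t) * (Nm f + d)" using g E by (intro mult_left_mono) auto
  finally show "Nm (T f) \<le> (1 + 2 * exp t) * Nm f + e" using d by (simp add: distrib_left)
qed

text \<open>The transpose of the transfer operator: if \<open>G\<close> lists the values of a
  functional on unit vectors, this lists the values of the functional composed with
  \<open>T\<close>, by \<open>T_ind\<close>.\<close>

definition dualT :: "(digits \<Rightarrow> complex) \<Rightarrow> digits \<Rightarrow> complex"
  where "dualT G a = of_nat (a 0) * G q + of_real (exp (t * real (a 0))) * G (shift a)"

lemma comb_T:
  "comb (dualT G) f z \<Longrightarrow> \<exists>f'. comb G f' z \<and> (\<forall>x\<in>X. T f x = f' x)"
proof (induction rule: comb.induct)
  case comb_0
  show ?case using comb.comb_0[of G] by (intro exI[of _ "\<lambda>_. 0"]) (auto simp: transfer_fun_def)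
next
  case (comb_Suc f z a c)
  then obtain f' where f': "comb G f' z" "\<forall>x\<in>X. T f x = f' x" by blast
  have aX: "a \<in> X" using comb_Suc.hyps X1_X by blast
  have "comb G (\<lambda>x. f' x + (c * of_nat (a 0)) * ind q x + (c * of_real (exp (t * real (a 0)))) * ind (shift a) x)
      (z + (c * of_nat (a 0)) * G q + (c * of_real (exp (t * real (a 0)))) * G (shift a))"
    by (intro comb.comb_Suc f' q_in1 X1_shift comb_Suc.hyps)
  moreover have "z + (c * of_nat (a 0)) * G q + (c * of_real (exp (t * real (a 0)))) * G (shift a) = z + c * dualT G a"
    by (simp add: dualT_def algebra_simps)
  moreover have "T (\<lambda>x. f x + c * ind a x) x =
      f' x + (c * of_nat (a 0)) * ind q x + (c * of_real (exp (t * real (a 0)))) * ind (shift a) x" if "x \<in> X" for x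
    using f' that T_ind[OF aX that] X_le[OF that] by (simp add: T_add T_cmult ind_eq algebra_simps)
  ultimately show ?case by (intro exI conjI ballI) auto
qed

lemma T_FF:
  assumes "f \<in> FF" shows "T f \<in> FF"
proof (rule FF_closed)
  show "T f \<in> bv" using assms FF_BV T_BV by blast
  fix e :: real assume "e > 0"
  have E: "0 < 1 + 2 * exp t" by (simp add: add_pos_pos)
  have e: "0 < e / (1 + 2 * exp t)" using E \<open>e > 0\<close> by simp
  obtain s z where s: "comb (dualT (\<lambda>_. 0)) s z" "Nm (\<lambda>x. f x - s x) < e / (1 + 2 * exp t)"
    by (rule FF_approx[OF assms e])
  obtain s' where s': "comb (\<lambda>_. 0) s' z" "\<forall>x\<in>X. T s x = s' x" using comb_T[OF s(1)] by blast
  have B: "(\<lambda>x. f x - s x) \<in> bv" using BV_diff FF_BV assms comb_BV s(1) by blast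
  have "Nm (\<lambda>x. T f x - s' x) = Nm (T (\<lambda>x. f x - s x))"
    using s'(2) by (simp add: T_diff cong: cls_cong)
  also have "\<dots> \<le> (1 + 2 * exp t) * Nm (\<lambda>x. f x - s x)" by (rule Nm_T[OF B])
  also have "\<dots> < (1 + 2 * exp t) * (e / (1 + 2 * exp t))" by (rule mult_strict_left_mono[OF s(2) E])
  also have "\<dots> = e" using E by simp
  finally show "\<exists>g\<in>FF. Nm (\<lambda>x. T f x - g x) < e" using comb_FF[OF s'(1)] by blast
qed

section \<open>Functionals on F as bounded functions on X1\<close>

text \<open>The function and the value are approximated through the same step function; for bounded
  \<open>G\<close> this ties \<open>z\<close> to the class of \<open>f\<close>.\<close>

definition rep :: "(digits \<Rightarrow> complex) \<Rightarrow> (digits \<Rightarrow> complex) \<Rightarrow> complex \<Rightarrow> bool" where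
  "rep G f z \<longleftrightarrow> (\<forall>e>0. \<exists>s w. comb G s w \<and> Nm (\<lambda>x. f x - s x) < e \<and> cmod (z - w) < e)"

definition bounded_on :: "(digits \<Rightarrow> complex) \<Rightarrow> bool" where
  "bounded_on G \<longleftrightarrow> (\<exists>B. \<forall>a\<in>X1. cmod (G a) \<le> B)"

lemma bounded_onE:
  assumes "bounded_on G" obtains B where "B > 0" "\<And>a. a \<in> X1 \<Longrightarrow> cmod (G a) \<le> B"
proof -
  obtain B where B: "\<forall>a\<in>X1. cmod (G a) \<le> B" using assms by (auto simp: bounded_on_def)
  then have "\<And>a. a \<in> X1 \<Longrightarrow> cmod (G a) \<le> \<bar>B\<bar> + 1" by fastforce
  then show thesis using that[of "\<bar>B\<bar> + 1"] by simp
qed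

lemma rep_comb: "comb G f z \<Longrightarrow> rep G f z"
  unfolding rep_def using Nm_le_BVn[OF BV_const(1)[of 0]] BV_const(2)[of 0]
  by (auto intro!: exI[of _ f] exI[of _ z])

text \<open>The estimate behind the passages to the limit below: any step function near
  \<open>f\<close> has a value near \<open>z\<close>, whichever approximants led to
  \<open>z\<close>.\<close>

lemma rep_near:
  assumes G: "\<And>a. a \<in> X1 \<Longrightarrow> cmod (G a) \<le> B" and r: "rep G f z" and f: "f \<in> FF" and s: "comb G s w"
  shows "cmod (z - w) \<le> B * Nm (\<lambda>x. f x - s x)"
proof (rule field_le_epsilon)
  fix e :: real assume "e > 0"
  have B: "0 \<le> B" using G[OF q_in1] norm_ge_zero order_trans by blast
  define d where "d = e / (1 + B)"
  have d: "d > 0" "d + B * d = e" using \<open>e > 0\<close> B by (auto simp: d_def divide_simps) (simp add: algebra_simps)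
  obtain s' w' where s': "comb G s' w'" "Nm (\<lambda>x. f x - s' x) < d" "cmod (z - w') < d"
    using r d(1) unfolding rep_def by blast
  have BVs: "s \<in> bv" "s' \<in> bv" "f \<in> bv" using comb_BV s s' FF_BV f by auto
  have "cmod (w' - w) \<le> B * Nm (\<lambda>x. s' x - s x)" by (rule comb_bound[OF comb_diff[OF s'(1) s] G])
  also have "Nm (\<lambda>x. s' x - s x) \<le> Nm (\<lambda>x. f x - s' x) + Nm (\<lambda>x. f x - s x)"
    using Nm_diff[of "\<lambda>x. f x - s x" "\<lambda>x. f x - s' x"] BVs BV_diff(1) by simp
  finally have "cmod (w' - w) \<le> B * (d + Nm (\<lambda>x. f x - s x))"
    using s'(2) B by (smt (verit) mult_left_mono)
  moreover have "cmod (z - w) \<le> cmod (z - w') + cmod (w' - w)"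
    using norm_triangle_ineq[of "z - w'" "w' - w"] by simp
  ultimately show "cmod (z - w) \<le> B * Nm (\<lambda>x. f x - s x) + e" using s'(3) d by (simp add: distrib_left)
qed

lemma rep_bound:
  assumes "\<And>a. a \<in> X1 \<Longrightarrow> cmod (G a) \<le> B" "rep G f z" "f \<in> FF" shows "cmod z \<le> B * Nm f"
  using rep_near[OF assms comb_0] by simp

lemma rep_add:
  assumes "rep G f z" "rep G g w" "f \<in> FF" "g \<in> FF" shows "rep G (\<lambda>x. f x + g x) (z + w)"
  unfolding rep_def
proof (intro allI impI)
  fix e :: real assume "e > 0"
  then have "e / 2 > 0" by simp
  then obtain s a s' b where s: "comb G s a" "Nm (\<lambda>x. f x - s x) < e / 2" "cmod (z - a) < e / 2"
    "comb G s' b" "Nm (\<lambda>x. g x - s' x) < e / 2" "cmod (w - b) < e / 2"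
    using assms(1,2) unfolding rep_def by meson
  have "Nm (\<lambda>x. (f x - s x) + (g x - s' x)) \<le> Nm (\<lambda>x. f x - s x) + Nm (\<lambda>x. g x - s' x)"
    using Nm_add comb_BV s(1,4) BV_diff(1) assms(3,4) FF_BV by blast
  then have "Nm (\<lambda>x. f x + g x - (s x + s' x)) < e" using s by (simp add: algebra_simps)
  moreover have "cmod (z + w - (a + b)) < e"
    using norm_triangle_ineq[of "z - a" "w - b"] s(3,6) by (simp add: algebra_simps)
  ultimately show "\<exists>s v. comb G s v \<and> Nm (\<lambda>x. f x + g x - s x) < e \<and> cmod (z + w - v) < e"
    using comb_add[OF s(1,4)] by blast
qed

lemma rep_cmult:
  assumes "rep G f z" "f \<in> FF" shows "rep G (\<lambda>x. c * f x) (c * z)"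
  unfolding rep_def
proof (intro allI impI)
  fix e :: real assume "e > 0"
  define d where "d = e / (cmod c + 1)"
  have c1: "0 < cmod c + 1" by (simp add: add_nonneg_pos)
  have d: "d > 0" "(cmod c + 1) * d = e" using \<open>e > 0\<close> c1 by (auto simp: d_def)
  then have d2: "cmod c * d < e" by (simp add: algebra_simps)
  obtain s w where s: "comb G s w" "Nm (\<lambda>x. f x - s x) < d" "cmod (z - w) < d"
    using assms(1) d(1) unfolding rep_def by blast
  have "(\<lambda>x. f x - s x) \<in> bv" using BV_diff FF_BV assms(2) comb_BV s(1) by blast
  from Nm_cmult[OF this, of c] have "Nm (\<lambda>x. c * f x - c * s x) \<le> cmod c * Nm (\<lambda>x. f x - s x)"
    by (simp add: right_diff_distrib)
  also have "\<dots> \<le> cmod c * d" using s by (intro mult_left_mono) auto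
  finally have 1: "Nm (\<lambda>x. c * f x - c * s x) < e" using d2 by simp
  have "cmod (c * z - c * w) \<le> cmod c * d"
    using s(3) by (simp add: norm_mult mult_left_mono flip: right_diff_distrib)
  then have 2: "cmod (c * z - c * w) < e" using d2 by simp
  show "\<exists>s w. comb G s w \<and> Nm (\<lambda>x. c * f x - s x) < e \<and> cmod (c * z - w) < e"
    using comb_cmult[OF s(1)] 1 2 by blast
qed

lemma rep_unique:
  assumes "bounded_on G" "rep G f z" "rep G f w" "f \<in> FF" shows "z = w"
proof -
  obtain B where B: "B > 0" "\<And>a. a \<in> X1 \<Longrightarrow> cmod (G a) \<le> B" by (rule bounded_onE[OF assms(1)]) blast
  have "rep G (\<lambda>x. f x + (-1) * f x) (z + (-1) * w)" using assms by (intro rep_add rep_cmult FF_cmult)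
  then have "rep G (\<lambda>_. 0) (z - w)" by simp
  from rep_bound[OF B(2) this FF_zero] have "cmod (z - w) \<le> B * Nm (\<lambda>_. 0)" .
  also have "\<dots> = 0" using Nm_le_BVn[OF BV_const(1)[of 0]] BV_const(2)[of 0] Nm_nonneg[OF BV_const(1)[of 0]]
    by simp
  finally show ?thesis by simp
qed

text \<open>By \<open>comb_bound\<close>, approximants with errors \<open>1 / Suc n\<close> have
  values that form a Cauchy sequence.\<close>

lemma rep_exists:
  assumes "bounded_on G" "f \<in> FF" shows "\<exists>z. rep G f z"
proof -
  obtain B where B: "B > 0" "\<And>a. a \<in> X1 \<Longrightarrow> cmod (G a) \<le> B" by (rule bounded_onE[OF assms(1)]) blast
  have "\<exists>s z. comb G s z \<and> Nm (\<lambda>x. f x - s x) < 1 / real (Suc n)" for n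
    by (rule FF_approx[OF assms(2), of "1 / real (Suc n)" G]) auto
  then obtain s z where s: "\<And>n. comb G (s n) (z n)" "\<And>n. Nm (\<lambda>x. f x - s n x) < 1 / real (Suc n)"
    by metis
  have bvs: "s n \<in> bv" "f \<in> bv" for n using comb_BV s(1) FF_BV assms(2) by blast+
  have close: "cmod (z m - z n) \<le> B * (1 / real (Suc m) + 1 / real (Suc n))" for m n
  proof -
    have "cmod (z m - z n) \<le> B * Nm (\<lambda>x. s m x - s n x)" by (rule comb_bound[OF comb_diff[OF s(1) s(1)] B(2)])
    also have "Nm (\<lambda>x. s m x - s n x) \<le> Nm (\<lambda>x. f x - s n x) + Nm (\<lambda>x. f x - s m x)"
      using Nm_diff[of "\<lambda>x. f x - s n x" "\<lambda>x. f x - s m x"] bvs BV_diff(1) by simp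
    also have "\<dots> \<le> 1 / real (Suc m) + 1 / real (Suc n)" using s(2)[of m] s(2)[of n] by linarith
    finally show ?thesis using B(1) by (simp add: mult_left_mono)
  qed
  have small: "\<exists>N. \<forall>n\<ge>N. B * (2 / real (Suc n)) < e \<and> 1 / real (Suc n) < e" if e: "e > 0" for e :: real
  proof -
    obtain N where N: "real N > max (2 * B / e) (1 / e)" using reals_Archimedean2 by blast
    have "B * (2 / real (Suc n)) < e \<and> 1 / real (Suc n) < e" if "n \<ge> N" for n
    proof -
      have "real (Suc n) > 2 * B / e" "real (Suc n) > 1 / e" using N that by auto
      then show ?thesis using e by (simp add: field_simps)
    qed
    then show ?thesis by blast
  qed
  have "Cauchy z"
  proof (rule metric_CauchyI)
    fix e :: real assume "e > 0"
    then obtain N where N: "\<forall>n\<ge>N. B * (2 / real (Suc n)) < e \<and> 1 / real (Suc n) < e" using small by blast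
    have "dist (z m) (z n) < e" if "m \<ge> N" "n \<ge> N" for m n
    proof -
      have "1 / real (Suc m) \<le> 1 / real (Suc N)" "1 / real (Suc n) \<le> 1 / real (Suc N)"
        using that by (auto simp: divide_simps)
      then have "1 / real (Suc m) + 1 / real (Suc n) \<le> 2 / real (Suc N)" by linarith
      then have "B * (1 / real (Suc m) + 1 / real (Suc n)) \<le> B * (2 / real (Suc N))"
        using B(1) by (intro mult_left_mono) auto
      then show ?thesis using close[of m n] N unfolding dist_norm
        by (meson le_less_trans order_refl order_trans)
    qed
    then show "\<exists>N. \<forall>m\<ge>N. \<forall>n\<ge>N. dist (z m) (z n) < e" by blast
  qed
  then obtain L where L: "z \<longlonglongrightarrow> L" using Cauchy_convergent convergent_def by blast
  have "rep G f L" unfolding rep_def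
  proof (intro allI impI)
    fix e :: real assume e: "e > 0"
    then obtain N where N: "\<forall>n\<ge>N. B * (2 / real (Suc n)) < e \<and> 1 / real (Suc n) < e" using small by blast
    obtain M where M: "\<forall>n\<ge>M. dist (z n) L < e" using L e unfolding lim_sequentially by blast
    show "\<exists>s w. comb G s w \<and> Nm (\<lambda>x. f x - s x) < e \<and> cmod (L - w) < e"
      using s(1)[of "max M N"] s(2)[of "max M N"] N[rule_format, of "max M N"] M[rule_format, of "max M N"]
      by (intro exI[of _ "s (max M N)"] exI[of _ "z (max M N)"]) (auto simp: dist_norm norm_minus_commute)
  qed
  then show ?thesis ..
qed

lemma rep_cls: "cls \<beta> f = cls \<beta> g \<Longrightarrow> rep G f z \<Longrightarrow> rep G g z"
proof -
  assume eq: "cls \<beta> f = cls \<beta> g"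
  have "cls \<beta> (\<lambda>x. f x - s x) = cls \<beta> (\<lambda>x. g x - s x)" for s
    using eq by (simp flip: B_diff_cls)
  then show "rep G f z \<Longrightarrow> rep G g z" unfolding rep_def by simp
qed

text \<open>By \<open>comb_T\<close>, applying \<open>T\<close> to a step function and replacing
  \<open>dualT G\<close> by \<open>G\<close> leaves the value unchanged; boundedness of
  \<open>T\<close> carries this to limits.\<close>

lemma rep_T:
  assumes r: "rep (dualT G) f z" and f: "f \<in> FF" shows "rep G (T f) z"
  unfolding rep_def
proof (intro allI impI)
  fix e :: real assume "e > 0"
  have E: "0 < 1 + 2 * exp t" by (simp add: add_pos_pos)
  define d where "d = e / (1 + 2 * exp t)"
  have d: "d > 0" "(1 + 2 * exp t) * d = e" "d \<le> e"
    using \<open>e > 0\<close> E by (auto simp: d_def divide_simps)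
  obtain s w where s: "comb (dualT G) s w" "Nm (\<lambda>x. f x - s x) < d" "cmod (z - w) < d"
    using r d(1) unfolding rep_def by blast
  obtain s' where s': "comb G s' w" "\<forall>x\<in>X. T s x = s' x" using comb_T[OF s(1)] by blast
  have B: "(\<lambda>x. f x - s x) \<in> bv" using BV_diff FF_BV f comb_BV s(1) by blast
  have "Nm (\<lambda>x. T f x - s' x) = Nm (T (\<lambda>x. f x - s x))"
    using s'(2) by (simp add: T_diff cong: cls_cong)
  also have "\<dots> \<le> (1 + 2 * exp t) * Nm (\<lambda>x. f x - s x)" by (rule Nm_T[OF B])
  also have "\<dots> < e" unfolding d(2)[symmetric] by (rule mult_strict_left_mono[OF s(2) E])
  finally show "\<exists>s w. comb G s w \<and> Nm (\<lambda>x. T f x - s x) < e \<and> cmod (z - w) < e"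
    using s'(1) s(3) d(3) by (intro exI[of _ s'] exI[of _ w]) auto
qed

text \<open>Linearity in \<open>G\<close>. One step function near \<open>f\<close> is read under all
  three functions at once, and \<open>rep_near\<close> controls the values under \<open>G'\<close>
  and \<open>G''\<close>.\<close>

lemma rep_change:
  assumes "rep G f z" "\<And>a. a \<in> X1 \<Longrightarrow> G a = c * G' a + d * G'' a" "bounded_on G'" "bounded_on G''" "f \<in> FF"
    "rep G' f z'" "rep G'' f z''"
  shows "z = c * z' + d * z''"
proof -
  obtain B where B: "B > 0" "\<And>a. a \<in> X1 \<Longrightarrow> cmod (G' a) \<le> B" by (rule bounded_onE[OF assms(3)]) blast
  obtain B' where B': "B' > 0" "\<And>a. a \<in> X1 \<Longrightarrow> cmod (G'' a) \<le> B'" by (rule bounded_onE[OF assms(4)]) blast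
  have *: "\<exists>u v. comb G' s u \<and> comb G'' s v \<and> w = c * u + d * v" if "comb G s w" for s w
    using that
  proof (induction rule: comb.induct)
    case comb_0 then show ?case using comb.comb_0 by fastforce
  next
    case (comb_Suc s w a k)
    then obtain u v where "comb G' s u" "comb G'' s v" "w = c * u + d * v" by blast
    then show ?case using comb.comb_Suc[of G' s u a k] comb.comb_Suc[of G'' s v a k] comb_Suc.hyps assms(2)[of a]
      by (intro exI[of _ "u + k * G' a"] exI[of _ "v + k * G'' a"]) (auto simp: algebra_simps)
  qed
  have "cmod (z - (c * z' + d * z'')) \<le> 0 + e" if "e > 0" for e
  proof -
    \<comment> \<open>The three errors have weights 1, \<open>cmod c * B\<close> and
      \<open>cmod d * B'\<close>, so with \<open>e / M\<close> for each they add up to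
      \<open>e\<close>.\<close>
    define M where "M = 1 + cmod c * B + cmod d * B'"
    have M: "M > 0" using B(1) B'(1) by (auto simp: M_def intro!: add_pos_nonneg)
    have "e / M > 0" using that M by simp
    then obtain s w where s: "comb G s w" "Nm (\<lambda>x. f x - s x) < e / M" "cmod (z - w) < e / M"
      using assms(1) unfolding rep_def by blast
    obtain u v where uv: "comb G' s u" "comb G'' s v" "w = c * u + d * v" using *[OF s(1)] by blast
    have Bd: "B * Nm (\<lambda>x. f x - s x) \<le> B * (e / M)" "B' * Nm (\<lambda>x. f x - s x) \<le> B' * (e / M)"
      using s(2) B(1) B'(1) by (intro mult_left_mono; simp)+
    have "cmod (z' - u) \<le> B * (e / M)" "cmod (z'' - v) \<le> B' * (e / M)"
      using rep_near[OF B(2) assms(6,5) uv(1)] rep_near[OF B'(2) assms(7,5) uv(2)] Bd by linarith+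
    then have le: "cmod (c * (u - z')) \<le> cmod c * (B * (e / M))" "cmod (d * (v - z'')) \<le> cmod d * (B' * (e / M))"
      unfolding norm_mult by (intro mult_left_mono; simp add: norm_minus_commute)+
    have eqn: "z - (c * z' + d * z'') = (z - w) + (c * (u - z') + d * (v - z''))"
      using uv(3) by (simp add: algebra_simps)
    have "cmod ((z - w) + (c * (u - z') + d * (v - z''))) \<le> cmod (z - w) + (cmod (c * (u - z')) + cmod (d * (v - z'')))"
      by (intro order_trans[OF norm_triangle_ineq] add_left_mono norm_triangle_ineq)
    then have "cmod (z - (c * z' + d * z'')) \<le> e / M + (cmod c * (B * (e / M)) + cmod d * (B' * (e / M)))"
      unfolding eqn using s(3) le by linarith
    also have "\<dots> = M * (e / M)" unfolding M_def by (simp only: distrib_right mult_1 mult.assoc add.assoc)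
    also have "\<dots> = e" using M by simp
    finally show ?thesis by simp
  qed
  from field_le_epsilon[OF this] show ?thesis by simp
qed

text \<open>Evaluations, the functionals with \<open>G a = ind a x\<close>, separate the points of \<open>F\<close>.\<close>

lemma rep_eval:
  assumes f: "f \<in> FF" and z: "\<And>x. x \<in> X \<Longrightarrow> rep (\<lambda>a. ind a x) f (z x)"
  shows "\<exists>N. countable N \<and> (\<forall>x\<in>X - N. f x = z x)"
proof -
  have ev: "w = s x" if "comb (\<lambda>a. ind a x) s w" for s w x
    using that by (induction rule: comb.induct) auto
  have "\<exists>s w. comb (\<lambda>_. 0) s w \<and> Nm (\<lambda>x. f x - s x) < 1 / real (Suc n)" for n
    by (rule FF_approx[OF f, of "1 / real (Suc n)" "\<lambda>_. 0"]) auto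
  then obtain s w where s: "\<And>n. comb (\<lambda>_. 0) (s n) (w n)" "\<And>n. Nm (\<lambda>x. f x - s n x) < 1 / real (Suc n)"
    by metis
  have B: "(\<lambda>x. f x - s n x) \<in> bv" for n using BV_diff FF_BV f comb_BV s(1) by blast
  have "\<exists>g. g \<in> cls \<beta> (\<lambda>x. f x - s n x) \<and> g \<in> bv \<and> BVn g < 1 / real (Suc n)" for n
    by (rule Nm_approx[OF B[of n] s(2)]) blast
  then obtain g where g: "\<And>n. g n \<in> cls \<beta> (\<lambda>x. f x - s n x)" "\<And>n. g n \<in> bv" "\<And>n. BVn (g n) < 1 / real (Suc n)"
    by metis
  \<comment> \<open>The exceptional sets of countably many representatives together; off
    \<open>N\<close> the approximants converge to \<open>f\<close> uniformly.\<close>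
  define N where "N = (\<Union>n. {x \<in> X. g n x - (f x - s n x) \<noteq> 0})"
  have "countable N" unfolding N_def
    using null_countable[OF g(1)[unfolded cls_iff]] by (intro countable_UN) auto
  moreover have "f x = z x" if x: "x \<in> X - N" for x
  proof -
    have "cmod (f x - z x) \<le> 0 + e" if "e > 0" for e
    proof -
      obtain n where n: "1 / real (Suc n) < e / 2" using \<open>e > 0\<close> nat_approx_posE[of "e/2"] by auto
      have "f x - s n x = g n x" using x by (auto simp: N_def)
      then have 1: "cmod (f x - s n x) < e / 2" using BVn_sup[OF g(2), of x n] x g(3)[of n] n by simp
      obtain w' where w': "comb (\<lambda>a. ind a x) (s n) w'" using comb_change[OF s(1)] by blast
      have "cmod (z x - s n x) \<le> 1 * Nm (\<lambda>x. f x - s n x)"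
        using rep_near[OF _ z f w', of 1] x ev[OF w'] by (auto simp: ind_eq)
      then have 2: "cmod (z x - s n x) < e / 2" using s(2)[of n] n by simp
      show ?thesis using norm_triangle_ineq4[of "f x - s n x" "z x - s n x"] 1 2 by simp
    qed
    from field_le_epsilon[OF this] show ?thesis by simp
  qed
  ultimately show ?thesis by blast
qed

section \<open>The dual of F\<close>

definition functional_of :: "(digits \<Rightarrow> complex) \<Rightarrow> fclass \<Rightarrow> complex" where
  "functional_of G u = (if u \<in> F_space \<beta> then THE z. \<exists>f\<in>FF. u = cls \<beta> f \<and> rep G f z else undefined)"

lemma functional_of_cls:
  assumes "bounded_on G" "f \<in> FF" "rep G f z" shows "functional_of G (cls \<beta> f) = z"
proof -
  have "(THE z. \<exists>g\<in>FF. cls \<beta> f = cls \<beta> g \<and> rep G g z) = z"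
  proof (rule the_equality)
    show "\<exists>g\<in>FF. cls \<beta> f = cls \<beta> g \<and> rep G g z" using assms by blast
    show "w = z" if "\<exists>g\<in>FF. cls \<beta> f = cls \<beta> g \<and> rep G g w" for w
      using that rep_cls rep_unique[OF assms(1)] assms by metis
  qed
  then show ?thesis using assms(2) by (auto simp: functional_of_def F_space_cls)
qed

lemma functional_of_dual:
  assumes "bounded_on G" shows "functional_of G \<in> F_dual \<beta>"
proof -
  obtain B where B: "B > 0" "\<And>a. a \<in> X1 \<Longrightarrow> cmod (G a) \<le> B" by (rule bounded_onE[OF assms]) blast
  have ex: "\<exists>f z. f \<in> FF \<and> u = cls \<beta> f \<and> rep G f z \<and> functional_of G u = z" if "u \<in> F_space \<beta>" for u
    using that rep_exists[OF assms] functional_of_cls[OF assms] unfolding F_space_cls by metis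
  show ?thesis unfolding F_dual_def
  proof (intro CollectI conjI ballI allI)
    show "functional_of G \<in> extensional (F_space \<beta>)" by (auto simp: extensional_def functional_of_def)
    fix u assume u: "u \<in> F_space \<beta>"
    from ex[OF u] obtain f z where f: "f \<in> FF" "u = cls \<beta> f" "rep G f z" "functional_of G u = z" by blast
    show "functional_of G (B_scale \<beta> c u) = c * functional_of G u" for c
      using functional_of_cls[OF assms FF_cmult rep_cmult] f by (simp add: B_scale_cls)
    fix v assume v: "v \<in> F_space \<beta>"
    from ex[OF v] obtain g w where g: "g \<in> FF" "v = cls \<beta> g" "rep G g w" "functional_of G v = w" by blast
    show "functional_of G (B_add \<beta> u v) = functional_of G u + functional_of G v"
      using functional_of_cls[OF assms FF_add rep_add] f g by (simp add: B_add_cls)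
  next
    show "\<exists>C. \<forall>u\<in>F_space \<beta>. cmod (functional_of G u) \<le> C * B_norm \<beta> u"
      using ex rep_bound[of G B, OF B(2)] by metis
  qed
qed

lemma functional_of_ind: "bounded_on G \<Longrightarrow> a \<in> X1 \<Longrightarrow> functional_of G (cls \<beta> (ind a)) = G a"
  using functional_of_cls rep_comb ind_comb ind_FF X1_X by metis

lemma dual_add: "\<nu> \<in> F_dual \<beta> \<Longrightarrow> f \<in> FF \<Longrightarrow> g \<in> FF \<Longrightarrow>
    \<nu> (cls \<beta> (\<lambda>x. f x + g x)) = \<nu> (cls \<beta> f) + \<nu> (cls \<beta> g)"
  unfolding B_add_cls[symmetric] F_dual_def mem_Collect_eq using F_space_cls by blast

lemma dual_cmult: "\<nu> \<in> F_dual \<beta> \<Longrightarrow> f \<in> FF \<Longrightarrow> \<nu> (cls \<beta> (\<lambda>x. c * f x)) = c * \<nu> (cls \<beta> f)"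
  unfolding B_scale_cls[symmetric] F_dual_def mem_Collect_eq using F_space_cls by blast

lemma dual_diff: "\<nu> \<in> F_dual \<beta> \<Longrightarrow> f \<in> FF \<Longrightarrow> g \<in> FF \<Longrightarrow>
    \<nu> (cls \<beta> (\<lambda>x. f x - g x)) = \<nu> (cls \<beta> f) - \<nu> (cls \<beta> g)"
  using dual_add[of \<nu> f "\<lambda>x. (-1) * g x"] dual_cmult[of \<nu> g "-1"] FF_cmult[of g "-1"] by simp

lemma dual_bound:
  assumes "\<nu> \<in> F_dual \<beta>" obtains C where "C > 0" "\<And>f. f \<in> FF \<Longrightarrow> cmod (\<nu> (cls \<beta> f)) \<le> C * Nm f"
proof -
  obtain C where C: "\<forall>u\<in>F_space \<beta>. cmod (\<nu> u) \<le> C * B_norm \<beta> u" using assms by (auto simp: F_dual_def)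
  have "cmod (\<nu> (cls \<beta> f)) \<le> (\<bar>C\<bar> + 1) * Nm f" if "f \<in> FF" for f
  proof -
    have "cmod (\<nu> (cls \<beta> f)) \<le> C * Nm f" using C that F_space_cls by blast
    also have "\<dots> \<le> (\<bar>C\<bar> + 1) * Nm f" using Nm_nonneg[OF FF_BV[OF that]] by (intro mult_right_mono) auto
    finally show ?thesis .
  qed
  then show thesis using that[of "\<bar>C\<bar> + 1"] by simp
qed

lemma dual_comb:
  assumes "\<nu> \<in> F_dual \<beta>" "comb (\<lambda>a. \<nu> (cls \<beta> (ind a))) s w" shows "\<nu> (cls \<beta> s) = w"
  using assms(2)
proof (induction rule: comb.induct)
  case comb_0
  then show ?case using dual_cmult[OF assms(1) FF_zero, of 0] by simp
next
  case (comb_Suc s w a c)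
  have i: "ind a \<in> FF" by (intro ind_FF X1_X comb_Suc.hyps)
  show ?case using dual_add[OF assms(1) comb_FF[OF comb_Suc.hyps(1)] FF_cmult[OF i]]
      dual_cmult[OF assms(1) i] comb_Suc.IH by simp
qed

text \<open>Step functions are dense and both functionals are bounded; outside
  \<open>F_space \<beta>\<close> both are undefined by extensionality.\<close>

lemma dual_determined:
  assumes "\<nu> \<in> F_dual \<beta>" "\<mu> \<in> F_dual \<beta>" "\<And>a. a \<in> X1 \<Longrightarrow> \<nu> (cls \<beta> (ind a)) = \<mu> (cls \<beta> (ind a))"
  shows "\<nu> = \<mu>"
proof (rule extensionalityI)
  show "\<nu> \<in> extensional (F_space \<beta>)" "\<mu> \<in> extensional (F_space \<beta>)"
    using assms by (auto simp: F_dual_def)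
  fix u assume "u \<in> F_space \<beta>"
  then obtain f where f: "f \<in> FF" "u = cls \<beta> f" by (auto simp: F_space_cls)
  obtain C where C: "C > 0" "\<And>f. f \<in> FF \<Longrightarrow> cmod (\<nu> (cls \<beta> f)) \<le> C * Nm f" by (rule dual_bound[OF assms(1)]) blast
  obtain D where D: "D > 0" "\<And>f. f \<in> FF \<Longrightarrow> cmod (\<mu> (cls \<beta> f)) \<le> D * Nm f" by (rule dual_bound[OF assms(2)]) blast
  have "cmod (\<nu> u - \<mu> u) \<le> 0 + e" if "e > 0" for e
  proof -
    have CD: "C + D > 0" using C D by simp
    then have "e / (C + D) > 0" using that by simp
    then obtain s w where s: "comb (\<lambda>a. \<nu> (cls \<beta> (ind a))) s w" "Nm (\<lambda>x. f x - s x) < e / (C + D)"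
      by (rule FF_approx[OF f(1)])
    have "comb (\<lambda>a. \<mu> (cls \<beta> (ind a))) s w"
      using s(1) by (induction rule: comb.induct) (auto simp: assms(3) intro: comb.intros)
    then have eq: "\<nu> (cls \<beta> s) = \<mu> (cls \<beta> s)" using dual_comb assms(1,2) s(1) by metis
    have sF: "s \<in> FF" by (rule comb_FF[OF s(1)])
    have "\<nu> u - \<mu> u = \<nu> (cls \<beta> (\<lambda>x. f x - s x)) - \<mu> (cls \<beta> (\<lambda>x. f x - s x))"
      using eq f sF assms(1,2) by (simp add: dual_diff)
    also have "cmod \<dots> \<le> C * Nm (\<lambda>x. f x - s x) + D * Nm (\<lambda>x. f x - s x)"
      using C(2)[OF FF_diff[OF f(1) sF]] D(2)[OF FF_diff[OF f(1) sF]] norm_triangle_ineq4 add_mono order_trans by blast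
    also have "\<dots> = (C + D) * Nm (\<lambda>x. f x - s x)" by (simp add: algebra_simps)
    also have "\<dots> \<le> (C + D) * (e / (C + D))" using s(2) CD by (intro mult_left_mono) auto
    also have "\<dots> = e" using CD by simp
    finally show ?thesis by simp
  qed
  from field_le_epsilon[OF this] show "\<nu> u = \<mu> u" by simp
qed

text \<open>The series converges in norm and not only pointwise, so a bounded functional acts
  termwise.\<close>

lemma dual_series:
  assumes "\<nu> \<in> F_dual \<beta>" "summable (\<lambda>i. cmod (c i))" "\<And>x. x \<in> X \<Longrightarrow> f x = (\<Sum>i. c i * ind (a i) x)"
    "\<And>i. a i \<in> X"
  shows "(\<lambda>i. c i * \<nu> (cls \<beta> (ind (a i)))) sums \<nu> (cls \<beta> f)"
proof -
  note S = series_FF[OF assms(2-4)]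
  obtain C where C: "C > 0" "\<And>f. f \<in> FF \<Longrightarrow> cmod (\<nu> (cls \<beta> f)) \<le> C * Nm f" by (rule dual_bound[OF assms(1)]) blast
  have part: "\<nu> (cls \<beta> (\<lambda>x. \<Sum>i<n. c i * ind (a i) x)) = (\<Sum>i<n. c i * \<nu> (cls \<beta> (ind (a i))))" for n
  proof (induction n)
    case 0 then show ?case using dual_cmult[OF assms(1) FF_zero, of 0] by simp
  next
    case (Suc n)
    then show ?case using dual_add[OF assms(1) S(3)[of n] FF_cmult[OF ind_FF[OF assms(4)], of "c n" n]]
      dual_cmult[OF assms(1) ind_FF[OF assms(4)]] by simp
  qed
  have le: "cmod ((\<Sum>i<n. c i * \<nu> (cls \<beta> (ind (a i)))) - \<nu> (cls \<beta> f)) \<le> C * (2 * (\<Sum>i. cmod (c (i + n))))" for n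
  proof -
    have "cmod (\<nu> (cls \<beta> (\<lambda>x. f x - (\<Sum>i<n. c i * ind (a i) x)))) \<le> C * (2 * (\<Sum>i. cmod (c (i + n))))"
      using C(2)[OF FF_diff[OF S(1) S(3)[of n]]] S(2)[of n] C(1)
      by (meson less_imp_le mult_left_mono order_trans)
    then show ?thesis using dual_diff[OF assms(1) S(1) S(3)[of n]] part[of n]
      by (simp add: norm_minus_commute)
  qed
  have "(\<lambda>n. \<Sum>i. cmod (c (i + n))) \<longlonglongrightarrow> 0" by (rule suminf_exist_split2[OF assms(2)])
  then have "(\<lambda>n. C * (2 * (\<Sum>i. cmod (c (i + n))))) \<longlonglongrightarrow> C * (2 * 0)"
    by (rule tendsto_mult_left[OF tendsto_mult_left])
  then have lim: "(\<lambda>n. C * (2 * (\<Sum>i. cmod (c (i + n))))) \<longlonglongrightarrow> 0" by simp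
  have "(\<lambda>n. (\<Sum>i<n. c i * \<nu> (cls \<beta> (ind (a i)))) - \<nu> (cls \<beta> f)) \<longlonglongrightarrow> 0"
    by (rule Lim_null_comparison[OF _ lim]) (rule always_eventually, rule allI, rule le)
  then show ?thesis unfolding sums_def by (rule LIM_zero_cancel)
qed

end

lemma H_pos: "0 < H n t x" by (simp add: H_def)

lemma H_0 [simp]: "H 0 t x = 1" by (simp add: H_def)

lemma H_Suc: "H (Suc n) t x = exp (t * real (x 0)) * H n t (shift x)"
  by (simp add: H_def shift_def sum.lessThan_Suc_shift distrib_left exp_add del: sum.lessThan_Suc)

lemma H_Suc_right: "H (Suc n) t x = H n t x * exp (t * real (x n))"
  by (simp add: H_def distrib_left exp_add)

context beta begin

section \<open>Growth of the weights\<close>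

lemma H_le_exp: assumes "x \<in> X" shows "H n t x \<le> exp (\<bar>t\<bar> * real n)"
proof -
  have "real (x i) \<le> 1" for i using X_digit[OF assms, of i] by auto
  then have "(\<Sum>i<n. real (x i)) \<le> (\<Sum>i<n. 1)" by (intro sum_mono)
  then have "\<bar>t\<bar> * (\<Sum>i<n. real (x i)) \<le> \<bar>t\<bar> * real n" by (intro mult_left_mono) auto
  moreover have "t * (\<Sum>i<n. real (x i)) \<le> \<bar>t\<bar> * (\<Sum>i<n. real (x i))"
    by (intro mult_right_mono sum_nonneg) auto
  ultimately show ?thesis by (simp add: H_def)
qed

definition supH :: "nat \<Rightarrow> real" where "supH n = (SUP x\<in>X. H n t x)"

lemma H_le_supH: "x \<in> X \<Longrightarrow> H n t x \<le> supH n"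
  unfolding supH_def by (rule cSUP_upper) (auto intro!: bdd_aboveI2 H_le_exp)

lemma supH_bounds: "1 \<le> supH n" "supH n \<le> exp \<bar>t\<bar> ^ n"
proof -
  show "1 \<le> supH n" using H_le_supH[OF zero_in, of n] by (simp add: H_def zero_seq_def)
  have "supH n \<le> exp (\<bar>t\<bar> * real n)" unfolding supH_def
    using q_in H_le_exp by (intro cSUP_least) auto
  then show "supH n \<le> exp \<bar>t\<bar> ^ n" by (simp add: exp_of_nat_mult[symmetric] mult.commute)
qed

lemma r_rad_eq: "r_rad \<beta> t = real_of_ereal (limsup (\<lambda>n. ereal (root n (supH n))))"
proof -
  have "exp (t * (\<Sum>i<n. indicator (cyl1 \<beta>) ((shift ^^ i) x))) = H n t x" if "x \<in> X" for x n
  proof -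
    have "indicator (cyl1 \<beta>) ((shift ^^ i) x) = real (x i)" for i
      using X_shift_pow[OF that, of i] X_digit[OF that, of i]
      by (auto simp: indicator_def cyl1_def shift_pow)
    then show ?thesis by (simp add: H_def)
  qed
  then show ?thesis unfolding r_rad_def supH_def by simp
qed

text \<open>The sequence of zeros has all weights equal to 1, whence the lower bound.\<close>

lemma limsup_eq: "limsup (\<lambda>n. ereal (root n (supH n))) = ereal (r_rad \<beta> t)" and r_rad_ge1: "1 \<le> r_rad \<beta> t"
proof -
  let ?l = "limsup (\<lambda>n. ereal (root n (supH n)))"
  have 1: "ereal 1 \<le> ?l"
  proof (rule le_Limsup)
    show "eventually (\<lambda>n. ereal 1 \<le> ereal (root n (supH n))) sequentially"
      using eventually_gt_at_top[of 0] by eventually_elim (use supH_bounds in auto)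
  qed simp
  have "?l \<le> ereal (exp \<bar>t\<bar>)"
  proof (rule Limsup_bounded)
    show "eventually (\<lambda>n. ereal (root n (supH n)) \<le> ereal (exp \<bar>t\<bar>)) sequentially"
      using eventually_gt_at_top[of 0]
    proof eventually_elim
      case (elim n)
      have "root n (supH n) \<le> root n (exp \<bar>t\<bar> ^ n)" using elim supH_bounds by (intro real_root_le_mono) auto
      also have "\<dots> = exp \<bar>t\<bar>" using elim by (simp add: real_root_power_cancel)
      finally show ?case by simp
    qed
  qed
  \<comment> \<open>There are finite bounds on both sides, so the conversion to a real number loses
    nothing.\<close>
  then have "\<bar>?l\<bar> \<noteq> \<infinity>" using 1 by auto
  then show "?l = ereal (r_rad \<beta> t)" unfolding r_rad_eq by (simp add: ereal_real')
  then show "1 \<le> r_rad \<beta> t" using 1 by simp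
qed

text \<open>A number \<open>\<rho>\<close> strictly between \<open>r_rad \<beta> t\<close> and
  \<open>K\<close> dominates the weights up to a constant, uniformly in \<open>x\<close>; then
  \<open>\<delta> = \<rho> / K\<close>. This bound makes the resolvent series below
  converge.\<close>

lemma growth:
  assumes "r_rad \<beta> t < K"
  obtains C \<delta> where "C > 0" "0 < \<delta>" "\<delta> < 1" "\<And>n x. x \<in> X \<Longrightarrow> H n t x / K ^ n \<le> C * \<delta> ^ n"
proof -
  obtain \<rho> where \<rho>: "r_rad \<beta> t < \<rho>" "\<rho> < K" using assms dense by blast
  have \<rho>1: "1 \<le> \<rho>" using \<rho> r_rad_ge1 by linarith
  have "eventually (\<lambda>n. ereal (root n (supH n)) < ereal \<rho>) sequentially"
    using \<rho>(1) by (intro Limsup_lessD) (simp add: limsup_eq)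
  then obtain N where N: "\<And>n. n \<ge> N \<Longrightarrow> root n (supH n) < \<rho>"
    unfolding eventually_sequentially by auto
  \<comment> \<open>Large enough for the finitely many \<open>n\<close> up to \<open>N\<close>, by
    the crude bound on \<open>supH n\<close>.\<close>
  define C where "C = exp \<bar>t\<bar> ^ (N + 1)"
  have C1: "1 \<le> C" unfolding C_def by (rule one_le_power) simp
  have le: "supH n \<le> C * \<rho> ^ n" for n
  proof (cases "n \<ge> N \<and> n > 0")
    case True
    then have "supH n = root n (supH n) ^ n" using supH_bounds[of n] by simp
    also have "\<dots> \<le> \<rho> ^ n" using N[of n] True supH_bounds[of n] by (intro power_mono) auto
    also have "\<dots> \<le> C * \<rho> ^ n" using C1 \<rho>1 by simp
    finally show ?thesis .
  next
    case False
    then have "exp \<bar>t\<bar> ^ n \<le> C" unfolding C_def by (intro power_increasing) auto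
    moreover have "C * 1 \<le> C * \<rho> ^ n" using C1 \<rho>1 by (intro mult_left_mono one_le_power) auto
    ultimately show ?thesis using supH_bounds(2)[of n] by linarith
  qed
  have K: "0 < K" using \<rho> \<rho>1 by linarith
  show thesis
  proof (rule that[of C "\<rho> / K"])
    show "C > 0" "0 < \<rho> / K" "\<rho> / K < 1" using C1 \<rho>1 \<rho> K by auto
    show "H n t x / K ^ n \<le> C * (\<rho> / K) ^ n" if "x \<in> X" for n x
      using H_le_supH[OF that, of n] le[of n] K by (simp add: power_divide divide_simps)
  qed
qed

text \<open>The constant disappears because \<open>root n C\<close> tends to 1.\<close>

lemma r_rad_le:
  assumes "C > 0" "\<rho> > 0" "\<And>n x. x \<in> X \<Longrightarrow> H n t x \<le> C * \<rho> ^ n"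
  shows "r_rad \<beta> t \<le> \<rho>"
proof -
  have le: "supH n \<le> C * \<rho> ^ n" for n unfolding supH_def using q_in assms(3) by (intro cSUP_least) auto
  have "(\<lambda>n. root n C * \<rho>) \<longlonglongrightarrow> 1 * \<rho>" by (intro tendsto_mult LIMSEQ_root_const assms) auto
  then have "(\<lambda>n. ereal (root n C * \<rho>)) \<longlonglongrightarrow> ereal \<rho>" by simp
  then have l: "limsup (\<lambda>n. ereal (root n C * \<rho>)) = ereal \<rho>" by (intro lim_imp_Limsup) auto
  have "limsup (\<lambda>n. ereal (root n (supH n))) \<le> limsup (\<lambda>n. ereal (root n C * \<rho>))"
  proof (rule Limsup_mono)
    show "eventually (\<lambda>n. ereal (root n (supH n)) \<le> ereal (root n C * \<rho>)) sequentially"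
      using eventually_gt_at_top[of 0]
    proof eventually_elim
      case (elim n)
      have "root n (supH n) \<le> root n (C * \<rho> ^ n)" using elim le by simp
      also have "\<dots> = root n C * \<rho>" using elim assms by (simp add: real_root_mult real_root_power_cancel)
      finally show ?case by simp
    qed
  qed
  then show ?thesis unfolding l limsup_eq by simp
qed

section \<open>Eigenvalues outside the essential spectral radius\<close>

text \<open>The Neumann series of the resolvent at \<open>\<kappa>\<close> of the transposed
  weighted shift, which sends \<open>G\<close> to
  \<open>\<lambda>a. exp (t * a 0) * G (shift a)\<close>. Applied to the first digit it is the
  series claimed for the eigenfunctional, so \<open>psi \<kappa> q = 1\<close> is the equation for
  the eigenvalues.\<close>

definition resolv :: "complex \<Rightarrow> (digits \<Rightarrow> complex) \<Rightarrow> digits \<Rightarrow> complex" where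
  "resolv \<kappa> G a = (\<Sum>n. of_real (H n t a) / \<kappa> ^ Suc n * G ((shift ^^ n) a))"

abbreviation "psi \<kappa> \<equiv> resolv \<kappa> (\<lambda>a. of_nat (a 0))"

lemma resolv_summable:
  assumes "r_rad \<beta> t < cmod \<kappa>" "a \<in> X" "\<And>n. cmod (G ((shift ^^ n) a)) \<le> B"
  shows "summable (\<lambda>n. cmod (of_real (H n t a) / \<kappa> ^ Suc n * G ((shift ^^ n) a)))"
proof -
  obtain C \<delta> where g: "C > 0" "0 < \<delta>" "\<delta> < 1" "\<And>n x. x \<in> X \<Longrightarrow> H n t x / cmod \<kappa> ^ n \<le> C * \<delta> ^ n"
    by (rule growth[OF assms(1)]) blast
  have B: "0 \<le> B" using assms(3) norm_ge_zero order_trans by blast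
  have \<kappa>: "0 < cmod \<kappa>" using assms(1) r_rad_ge1 by linarith
  show ?thesis
  proof (rule summable_comparison_test'[of "\<lambda>n. (C * B / cmod \<kappa>) * \<delta> ^ n" 0])
    show "summable (\<lambda>n. (C * B / cmod \<kappa>) * \<delta> ^ n)" using g by (intro summable_mult summable_geometric) auto
    fix n
    have "cmod (of_real (H n t a) / \<kappa> ^ Suc n * G ((shift ^^ n) a)) = (H n t a / cmod \<kappa> ^ n) * cmod (G ((shift ^^ n) a)) / cmod \<kappa>"
      using H_pos[of n t a] by (simp add: norm_mult norm_divide norm_power)
    also have "\<dots> \<le> (C * \<delta> ^ n) * B / cmod \<kappa>"
      using g(4)[OF assms(2), of n] assms(3)[of n] g B \<kappa> by (intro divide_right_mono mult_mono) auto
    finally show "norm (cmod (of_real (H n t a) / \<kappa> ^ Suc n * G ((shift ^^ n) a))) \<le> (C * B / cmod \<kappa>) * \<delta> ^ n"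
      by (simp add: mult_ac)
  qed
qed

lemma resolv_bounded:
  assumes "r_rad \<beta> t < cmod \<kappa>" "bounded_on G" shows "bounded_on (resolv \<kappa> G)"
proof -
  obtain C \<delta> where g: "C > 0" "0 < \<delta>" "\<delta> < 1" "\<And>n x. x \<in> X \<Longrightarrow> H n t x / cmod \<kappa> ^ n \<le> C * \<delta> ^ n"
    by (rule growth[OF assms(1)]) blast
  obtain B where B: "B > 0" "\<And>a. a \<in> X1 \<Longrightarrow> cmod (G a) \<le> B" by (rule bounded_onE[OF assms(2)]) blast
  have \<kappa>: "0 < cmod \<kappa>" using assms(1) r_rad_ge1 by linarith
  have s: "summable (\<lambda>n. (C * B / cmod \<kappa>) * \<delta> ^ n)" using g by (intro summable_mult summable_geometric) auto
  have "cmod (resolv \<kappa> G a) \<le> (\<Sum>n. (C * B / cmod \<kappa>) * \<delta> ^ n)" if "a \<in> X1" for a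
    unfolding resolv_def
  proof (rule norm_suminf_le[OF _ s])
    fix n
    have "cmod (of_real (H n t a) / \<kappa> ^ Suc n * G ((shift ^^ n) a)) = (H n t a / cmod \<kappa> ^ n) * cmod (G ((shift ^^ n) a)) / cmod \<kappa>"
      using H_pos[of n t a] by (simp add: norm_mult norm_divide norm_power)
    also have "\<dots> \<le> (C * \<delta> ^ n) * B / cmod \<kappa>"
      using g(4)[OF X1_X[OF that], of n] B(2)[OF X1_shift_pow[OF that, of n]] g B \<kappa>
      by (intro divide_right_mono mult_mono) auto
    finally show "cmod (of_real (H n t a) / \<kappa> ^ Suc n * G ((shift ^^ n) a)) \<le> (C * B / cmod \<kappa>) * \<delta> ^ n"
      by (simp add: mult_ac)
  qed
  then show ?thesis unfolding bounded_on_def by blast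
qed

text \<open>Splitting off the first term gives the resolvent equation
  \<open>(\<kappa> - W) R = G\<close>, where \<open>W\<close> is the transposed weighted
  shift.\<close>

lemma resolv_rec:
  assumes "r_rad \<beta> t < cmod \<kappa>" "a \<in> X" "\<And>n. cmod (G ((shift ^^ n) a)) \<le> B"
  shows "\<kappa> * resolv \<kappa> G a = G a + of_real (exp (t * real (a 0))) * resolv \<kappa> G (shift a)"
proof -
  have \<kappa>: "\<kappa> \<noteq> 0" using assms(1) r_rad_ge1 by auto
  define u where "u = (\<lambda>n. of_real (H n t a) / \<kappa> ^ Suc n * G ((shift ^^ n) a))"
  have s: "summable u" unfolding u_def by (rule summable_norm_cancel[OF resolv_summable[where G = G and a = a, OF assms]])
  have "cmod (G ((shift ^^ n) (shift a))) \<le> B" for n using assms(3)[of "Suc n"] by (simp add: shift_funpow_Suc del: funpow.simps)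
  then have s': "summable (\<lambda>n. of_real (H n t (shift a)) / \<kappa> ^ Suc n * G ((shift ^^ n) (shift a)))"
    by (rule summable_norm_cancel[OF resolv_summable[where G = G, OF assms(1) X_shift[OF assms(2)]]])
  have "u (Suc n) * \<kappa> = of_real (exp (t * real (a 0))) * (of_real (H n t (shift a)) / \<kappa> ^ Suc n * G ((shift ^^ n) (shift a)))" for n
    unfolding u_def shift_funpow_Suc H_Suc using \<kappa> by (simp add: field_simps)
  then have "(\<Sum>n. u (Suc n)) * \<kappa> = of_real (exp (t * real (a 0))) * resolv \<kappa> G (shift a)"
    unfolding resolv_def using s s' by (simp add: suminf_mult2 summable_Suc_iff flip: suminf_mult)
  moreover have "resolv \<kappa> G a = u 0 + (\<Sum>n. u (Suc n))"
    unfolding resolv_def u_def[symmetric] using suminf_split_head[OF s] by simp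
  moreover have "u 0 * \<kappa> = G a" using \<kappa> by (simp add: u_def)
  ultimately show ?thesis by (simp add: algebra_simps)
qed

lemma digit_bound: "a \<in> X \<Longrightarrow> cmod (of_nat (((shift ^^ n) a) 0)) \<le> 1"
  using X_digit[of a n] by (auto simp: shift_pow)

lemma digit_bounded_on: "bounded_on (\<lambda>a. of_nat (a 0))"
  unfolding bounded_on_def using digit_bound[OF X1_X, of _ 0] by (intro exI[of _ 1] ballI) simp

lemma psi_sums:
  assumes "r_rad \<beta> t < cmod \<kappa>" "a \<in> X"
  shows "(\<lambda>n. of_nat (a n) * of_real (H n t a) / \<kappa> ^ Suc n) sums psi \<kappa> a"
  using summable_sums[OF summable_norm_cancel[OF resolv_summable[OF assms, of "\<lambda>a. of_nat (a 0)" 1]]]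
    digit_bound[OF assms(2)]
  unfolding resolv_def by (simp add: shift_pow mult.commute)

lemma B_one_ind: "B_one \<beta> = cls \<beta> (ind q)"
  unfolding B_one_def by (rule cls_cong) (simp add: ind_eq X_le)

lemma eigfun_series: "eigfun \<beta> t \<kappa> x = (\<Sum>n. of_real (H n t q) / \<kappa> ^ n * ind ((shift ^^ n) q) x)"
  by (simp add: eigfun_def ind_def)

lemma eigfun_coeff_summable:
  assumes "r_rad \<beta> t < cmod \<kappa>" shows "summable (\<lambda>n. cmod (of_real (H n t q) / \<kappa> ^ n))"
proof -
  have "\<kappa> \<noteq> 0" using assms r_rad_ge1 by auto
  then show ?thesis
    using summable_mult[OF resolv_summable[OF assms q_in, of "\<lambda>_. 1" 1], of "cmod \<kappa>"]
    by (simp add: norm_mult norm_divide norm_power)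
qed

lemma eigfun_FF: "r_rad \<beta> t < cmod \<kappa> \<Longrightarrow> eigfun \<beta> t \<kappa> \<in> FF"
  by (rule series_FF(1)[OF eigfun_coeff_summable eigfun_series X_shift_pow[OF q_in]])

text \<open>Only two preimages are involved, so \<open>T\<close> acts termwise at each
  point.\<close>

lemma T_series:
  assumes c: "summable (\<lambda>i. cmod (c i))" and f: "\<And>x. x \<in> X \<Longrightarrow> f x = (\<Sum>i. c i * ind (a i) x)"
    and x: "x \<in> X"
  shows "T f x = (\<Sum>i. c i * T (ind (a i)) x)"
proof -
  have s: "summable (\<lambda>i. c i * ind (a i) y)" if "y \<in> X" for y
    by (rule summable_norm_cancel, rule summable_comparison_test'[OF c, of 0])
      (use that in \<open>auto simp: norm_mult ind_eq\<close>)
  have P: "prepend 0 x \<in> X" "x \<preceq> shift q \<Longrightarrow> prepend 1 x \<in> X"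
    using x prepend0_in prepend1_in_iff by auto
  show ?thesis
  proof (cases "x \<preceq> shift q")
    case True
    have s1: "summable (\<lambda>i. of_real (exp t) * (c i * ind (a i) (prepend 1 x)))"
      by (intro summable_mult s P True)
    have "T f x = (\<Sum>i. c i * ind (a i) (prepend 0 x)) + (\<Sum>i. of_real (exp t) * (c i * ind (a i) (prepend 1 x)))"
      using True P f x s by (simp add: T_eq suminf_mult)
    also have "\<dots> = (\<Sum>i. c i * ind (a i) (prepend 0 x) + of_real (exp t) * (c i * ind (a i) (prepend 1 x)))"
      by (rule suminf_add[OF s[OF P(1)] s1])
    finally show ?thesis using True x by (simp add: T_eq algebra_simps)
  next
    case False
    then show ?thesis using P f x by (simp add: T_eq)
  qed
qed

text \<open>Each term passes its weight on to the next shift of \<open>q\<close> and leaves a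
  multiple of the constant function. These multiples sum to
  \<open>\<kappa> * psi \<kappa> q = \<kappa>\<close>, exactly the missing term for
  \<open>n = 0\<close>.\<close>

lemma T_eigfun:
  assumes \<kappa>: "r_rad \<beta> t < cmod \<kappa>" and root: "psi \<kappa> q = 1" and x: "x \<in> X"
  shows "T (eigfun \<beta> t \<kappa>) x = \<kappa> * eigfun \<beta> t \<kappa> x"
proof -
  have \<kappa>0: "\<kappa> \<noteq> 0" using \<kappa> r_rad_ge1 by auto
  define c where "c n = of_real (H n t q) / \<kappa> ^ n" for n
  have sc: "summable (\<lambda>n. cmod (c n))" unfolding c_def by (rule eigfun_coeff_summable[OF \<kappa>])
  have si: "summable (\<lambda>n. c n * ind ((shift ^^ n) q) x)"
    by (rule summable_norm_cancel, rule summable_comparison_test'[OF sc, of 0])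
      (use x in \<open>auto simp: norm_mult ind_eq\<close>)
  have e: "eigfun \<beta> t \<kappa> x = (\<Sum>n. c n * ind ((shift ^^ n) q) x)"
    by (simp add: eigfun_series c_def)
  have p: "(\<lambda>n. c n * of_nat (q n)) sums \<kappa>"
    using sums_mult[OF psi_sums[OF \<kappa> q_in], of \<kappa>] \<kappa>0 root by (simp add: c_def field_simps)
  have step: "c n * T (ind ((shift ^^ n) q)) x = c n * of_nat (q n) + \<kappa> * (c (Suc n) * ind ((shift ^^ Suc n) q) x)" for n
    using T_ind[OF X_shift_pow[OF q_in] x, of n] \<kappa>0
    by (simp add: shift_pow c_def H_Suc_right field_simps)
  have ss: "summable (\<lambda>n. \<kappa> * (c (Suc n) * ind ((shift ^^ Suc n) q) x))"
    using si by (intro summable_mult) (subst summable_Suc_iff)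
  have "T (eigfun \<beta> t \<kappa>) x = (\<Sum>n. c n * T (ind ((shift ^^ n) q)) x)"
    by (rule T_series[OF sc _ x]) (simp add: eigfun_series c_def)
  also have "\<dots> = (\<Sum>n. c n * of_nat (q n)) + (\<Sum>n. \<kappa> * (c (Suc n) * ind ((shift ^^ Suc n) q) x))"
    unfolding step by (rule suminf_add[symmetric, OF sums_summable[OF p] ss])
  also have "(\<Sum>n. \<kappa> * (c (Suc n) * ind ((shift ^^ Suc n) q) x)) = \<kappa> * (\<Sum>n. c (Suc n) * ind ((shift ^^ Suc n) q) x)"
    using si by (intro suminf_mult) (subst summable_Suc_iff)
  also have "(\<Sum>n. c (Suc n) * ind ((shift ^^ Suc n) q) x) = eigfun \<beta> t \<kappa> x - c 0 * ind q x"
    using suminf_split_head[OF si] e by simp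
  finally show ?thesis unfolding sums_unique[OF p, symmetric] using X_le[OF x] x
    by (simp add: c_def ind_eq right_diff_distrib)
qed

text \<open>For the resolvent \<open>R\<close> of \<open>G\<close> and the first digit
  \<open>P\<close>, the identity \<open>\<kappa> R + R q P = G + dualT R\<close> is applied to
  \<open>f\<close>. As \<open>dualT R\<close> at \<open>f\<close> is \<open>R\<close> at
  \<open>T f\<close>, hence \<open>\<kappa>\<close> times \<open>R\<close> at \<open>f\<close>, the
  unknown value of \<open>R\<close> cancels.\<close>

lemma eigen_rep:
  assumes \<kappa>: "r_rad \<beta> t < cmod \<kappa>" and f: "f \<in> FF" and eig: "cls \<beta> (T f) = cls \<beta> (\<lambda>x. \<kappa> * f x)"
    and G: "bounded_on G" and z: "rep G f z" and p: "rep (\<lambda>a. of_nat (a 0)) f p"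
  shows "z = p * resolv \<kappa> G q"
proof -
  define R where "R = resolv \<kappa> G"
  define P :: "digits \<Rightarrow> complex" where "P = (\<lambda>a. of_nat (a 0))"
  have bR: "bounded_on R" unfolding R_def by (rule resolv_bounded[OF \<kappa> G])
  have bP: "bounded_on P" unfolding P_def by (rule digit_bounded_on)
  obtain B where B: "B > 0" "\<And>a. a \<in> X1 \<Longrightarrow> cmod (G a) \<le> B" by (rule bounded_onE[OF G]) blast
  obtain B' where B': "B' > 0" "\<And>a. a \<in> X1 \<Longrightarrow> cmod (R a) \<le> B'" by (rule bounded_onE[OF bR]) blast
  have bD: "bounded_on (dualT R)" unfolding bounded_on_def
  proof (intro exI ballI)
    fix a assume a: "a \<in> X1"
    have "cmod (dualT R a) \<le> cmod (of_nat (a 0) * R q) + cmod (of_real (exp (t * real (a 0))) * R (shift a))"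
      unfolding dualT_def by (rule norm_triangle_ineq)
    also have "\<dots> \<le> 1 * B' + exp \<bar>t\<bar> * B'"
      using X_digit[OF X1_X[OF a], of 0] B' q_in1 X1_shift[OF a] unfolding norm_mult
      by (intro add_mono mult_mono) auto
    finally show "cmod (dualT R a) \<le> 1 * B' + exp \<bar>t\<bar> * B'" .
  qed
  have rec: "\<kappa> * R a + R q * P a = 1 * G a + 1 * dualT R a" if "a \<in> X1" for a
    using resolv_rec[where G = G, OF \<kappa> X1_X[OF that] B(2)[OF X1_shift_pow[OF that]]]
    by (simp add: R_def dualT_def P_def)
  \<comment> \<open>The common function on both sides of the identity; its value at \<open>f\<close>
    is computed in two ways.\<close>
  define M where "M = (\<lambda>a. \<kappa> * R a + R q * P a)"
  have bM: "bounded_on M" unfolding bounded_on_def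
  proof (intro exI ballI)
    fix a assume a: "a \<in> X1"
    have "cmod (M a) \<le> cmod (\<kappa> * R a) + cmod (R q * P a)" unfolding M_def by (rule norm_triangle_ineq)
    also have "\<dots> \<le> cmod \<kappa> * B' + B' * 1"
      using X_digit[OF X1_X[OF a], of 0] B' q_in1 a unfolding norm_mult P_def
      by (intro add_mono mult_mono) auto
    finally show "cmod (M a) \<le> cmod \<kappa> * B' + B' * 1" .
  qed
  obtain zM where zM: "rep M f zM" using rep_exists[OF bM f] ..
  obtain zR where zR: "rep R f zR" using rep_exists[OF bR f] ..
  obtain zD where zD: "rep (dualT R) f zD" using rep_exists[OF bD f] ..
  have "rep R (\<lambda>x. \<kappa> * f x) zD" by (rule rep_cls[OF eig rep_T[OF zD f]])
  then have "zD = \<kappa> * zR" using rep_unique[OF bR _ rep_cmult[OF zR f] FF_cmult[OF f]] by blast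
  moreover have "zM = \<kappa> * zR + R q * p"
    by (rule rep_change[OF zM _ bR bP f zR]) (use p in \<open>auto simp: M_def P_def\<close>)
  moreover have "zM = 1 * z + 1 * zD"
    by (rule rep_change[OF zM _ G bD f z zD]) (use rec in \<open>auto simp: M_def\<close>)
  ultimately show ?thesis by (simp add: R_def)
qed

text \<open>With \<open>G\<close> the evaluation at \<open>x\<close>, the previous lemma determines
  \<open>f x\<close> off a countable set; with \<open>G\<close> the first digit, it gives
  \<open>p = p * psi \<kappa> q\<close>.\<close>

lemma eigen_form:
  assumes \<kappa>: "r_rad \<beta> t < cmod \<kappa>" and f: "f \<in> FF" and eig: "cls \<beta> (T f) = cls \<beta> (\<lambda>x. \<kappa> * f x)"
  obtains C where "cls \<beta> f = cls \<beta> (\<lambda>x. C * eigfun \<beta> t \<kappa> x)" "C = 0 \<or> psi \<kappa> q = 1"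
proof -
  have \<kappa>0: "\<kappa> \<noteq> 0" using \<kappa> r_rad_ge1 by auto
  obtain p where p: "rep (\<lambda>a. of_nat (a 0)) f p" using rep_exists[OF digit_bounded_on f] ..
  have bi: "bounded_on (\<lambda>a. ind a x)" if "x \<in> X" for x
    unfolding bounded_on_def using that by (intro exI[of _ 1]) (auto simp: ind_eq)
  have "rep (\<lambda>a. ind a x) f ((p / \<kappa>) * eigfun \<beta> t \<kappa> x)" if x: "x \<in> X" for x
  proof -
    obtain z where z: "rep (\<lambda>a. ind a x) f z" using rep_exists[OF bi[OF x] f] ..
    have "z = p * resolv \<kappa> (\<lambda>a. ind a x) q" by (rule eigen_rep[OF \<kappa> f eig bi[OF x] z p])
    also have "resolv \<kappa> (\<lambda>a. ind a x) q = eigfun \<beta> t \<kappa> x / \<kappa>"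
    proof -
      have "summable (\<lambda>n. of_real (H n t q) / \<kappa> ^ n * ind ((shift ^^ n) q) x)"
        by (rule summable_norm_cancel, rule summable_comparison_test'[OF eigfun_coeff_summable[OF \<kappa>], of 0])
          (use x in \<open>auto simp: norm_mult ind_eq\<close>)
      from suminf_divide[OF this, of \<kappa>] show ?thesis
        by (simp add: resolv_def eigfun_series mult.commute)
    qed
    finally show ?thesis using z by simp
  qed
  from rep_eval[OF f this] obtain N where N: "countable N" "\<forall>x\<in>X - N. f x = (p / \<kappa>) * eigfun \<beta> t \<kappa> x"
    by blast
  have "(\<lambda>x. f x - (p / \<kappa>) * eigfun \<beta> t \<kappa> x) \<in> null"
    by (rule nullI[OF BV_diff(1)[OF FF_BV[OF f] FF_BV[OF FF_cmult[OF eigfun_FF[OF \<kappa>]]]] N(1)])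
      (use N(2) in auto)
  moreover have "p / \<kappa> = 0 \<or> psi \<kappa> q = 1"
    using eigen_rep[OF \<kappa> f eig digit_bounded_on p p] \<kappa>0 by auto
  ultimately show thesis by (rule that[OF cls_eqI])
qed

section \<open>Eigenspaces and their dimension\<close>

lemma shifted_op_cls: "shifted_op \<beta> t \<kappa> (cls \<beta> f) = cls \<beta> (\<lambda>x. \<kappa> * f x - T f x)"
  by (simp add: shifted_op_def B_scale_cls transfer_cls B_diff_cls)

lemma eigenspace_cls:
  "cls \<beta> f \<in> eigenspace \<beta> t \<kappa> \<longleftrightarrow> f \<in> FF \<and> cls \<beta> (T f) = cls \<beta> (\<lambda>x. \<kappa> * f x)"
proof -
  have "cls \<beta> (\<lambda>x. \<kappa> * f x - T f x) = B_zero \<beta> \<longleftrightarrow> cls \<beta> (\<lambda>x. \<kappa> * f x) = cls \<beta> (T f)"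
    by (simp add: B_zero_def cls_eq_iff)
  then show ?thesis unfolding eigenspace_def FF_def by (auto simp: shifted_op_cls)
qed

lemma eigenfunctions_cls:
  "cls \<beta> f \<in> eigenfunctions \<beta> t \<kappa> \<longleftrightarrow> f \<in> FF \<and> f \<notin> null \<and> cls \<beta> (T f) = cls \<beta> (\<lambda>x. \<kappa> * f x)"
  unfolding eigenfunctions_def FF_def by (auto simp: B_scale_cls transfer_cls B_zero_def cls_eq_iff)

lemma has_dim_line:
  assumes "f \<notin> null" "V = {cls \<beta> (\<lambda>x. c * f x) | c. True}" shows "has_dim \<beta> V 1"
proof -
  have l: "lincomb \<beta> c (\<lambda>_. cls \<beta> f) 1 = cls \<beta> (\<lambda>x. c 0 * f x)" for c :: "nat \<Rightarrow> complex"
    by (simp add: B_zero_def B_scale_cls B_add_cls)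
  have "bij_betw (\<lambda>c. lincomb \<beta> c (\<lambda>_. cls \<beta> f) 1) ({..<1} \<rightarrow>\<^sub>E UNIV) V"
    unfolding bij_betw_def
  proof
    show "inj_on (\<lambda>c. lincomb \<beta> c (\<lambda>_. cls \<beta> f) 1) ({..<1} \<rightarrow>\<^sub>E UNIV)"
    proof (rule inj_onI)
      fix c d :: "nat \<Rightarrow> complex" assume c: "c \<in> {..<1} \<rightarrow>\<^sub>E UNIV" "d \<in> {..<1} \<rightarrow>\<^sub>E UNIV"
        and "lincomb \<beta> c (\<lambda>_. cls \<beta> f) 1 = lincomb \<beta> d (\<lambda>_. cls \<beta> f) 1"
      then have "(\<lambda>x. c 0 * f x - d 0 * f x) \<in> null" unfolding l cls_eq_iff by simp
      then have n: "(\<lambda>x. (c 0 - d 0) * f x) \<in> null" by (simp add: left_diff_distrib)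
      have "c 0 = d 0"
      proof (rule ccontr)
        assume "c 0 \<noteq> d 0"
        then have "(\<lambda>x. (1 / (c 0 - d 0)) * ((c 0 - d 0) * f x)) = f" by auto
        then show False using null_cmult[OF n, of "1 / (c 0 - d 0)"] assms(1) by simp
      qed
      then show "c = d" using c by (intro PiE_ext[OF c]) auto
    qed
    show "(\<lambda>c. lincomb \<beta> c (\<lambda>_. cls \<beta> f) 1) ` ({..<1} \<rightarrow>\<^sub>E UNIV) = V"
    proof
      show "(\<lambda>c. lincomb \<beta> c (\<lambda>_. cls \<beta> f) 1) ` ({..<1} \<rightarrow>\<^sub>E UNIV) \<subseteq> V" unfolding l assms(2) by auto
      show "V \<subseteq> (\<lambda>c. lincomb \<beta> c (\<lambda>_. cls \<beta> f) 1) ` ({..<1} \<rightarrow>\<^sub>E UNIV)"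
      proof
        fix v assume "v \<in> V"
        then obtain k where "v = cls \<beta> (\<lambda>x. k * f x)" unfolding assms(2) by blast
        then show "v \<in> (\<lambda>c. lincomb \<beta> c (\<lambda>_. cls \<beta> f) 1) ` ({..<1} \<rightarrow>\<^sub>E UNIV)"
          unfolding l by (intro image_eqI[of _ _ "\<lambda>i\<in>{..<1}. k"]) auto
      qed
    qed
  qed
  then show ?thesis unfolding has_dim_def by blast
qed

lemma eigenspace_eq:
  assumes \<kappa>: "r_rad \<beta> t < cmod \<kappa>" and root: "psi \<kappa> q = 1"
  shows "eigenspace \<beta> t \<kappa> = {cls \<beta> (\<lambda>x. c * eigfun \<beta> t \<kappa> x) | c. True}"
proof (intro equalityI subsetI)
  fix u assume u: "u \<in> eigenspace \<beta> t \<kappa>"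
  then obtain f where f: "u = cls \<beta> f" unfolding eigenspace_def using F_space_cls by auto
  obtain C where "cls \<beta> f = cls \<beta> (\<lambda>x. C * eigfun \<beta> t \<kappa> x)"
    using eigen_form[OF \<kappa>] u f eigenspace_cls by metis
  then show "u \<in> {cls \<beta> (\<lambda>x. c * eigfun \<beta> t \<kappa> x) | c. True}" using f by blast
next
  fix u assume "u \<in> {cls \<beta> (\<lambda>x. c * eigfun \<beta> t \<kappa> x) | c. True}"
  then obtain c where u: "u = cls \<beta> (\<lambda>x. c * eigfun \<beta> t \<kappa> x)" by blast
  have "cls \<beta> (T (\<lambda>x. c * eigfun \<beta> t \<kappa> x)) = cls \<beta> (\<lambda>x. \<kappa> * (c * eigfun \<beta> t \<kappa> x))"
    by (rule cls_cong) (simp add: T_cmult T_eigfun[OF \<kappa> root])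
  then show "u \<in> eigenspace \<beta> t \<kappa>" unfolding u eigenspace_cls using FF_cmult[OF eigfun_FF[OF \<kappa>]] by blast
qed

section \<open>Eigenfunctionals\<close>

lemma eigenfunctional_rec:
  assumes \<nu>: "eigenfunctional \<beta> t \<kappa> \<nu>" "\<nu> (B_one \<beta>) = 1" and a: "a \<in> X"
  shows "\<kappa> * \<nu> (cls \<beta> (ind a)) = of_nat (a 0) + of_real (exp (t * real (a 0))) * \<nu> (cls \<beta> (ind (shift a)))"
proof -
  have d: "\<nu> \<in> F_dual \<beta>" using \<nu> by (simp add: eigenfunctional_def)
  have "\<kappa> * \<nu> (cls \<beta> (ind a)) = \<nu> (transfer \<beta> t (cls \<beta> (ind a)))"
    using \<nu>(1) ind_FF[OF a] by (simp add: eigenfunctional_def FF_def)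
  also have "transfer \<beta> t (cls \<beta> (ind a)) =
      cls \<beta> (\<lambda>x. of_nat (a 0) * ind q x + of_real (exp (t * real (a 0))) * ind (shift a) x)"
    unfolding transfer_cls by (rule cls_cong) (use a in \<open>simp add: T_ind ind_eq[of _ q] X_le\<close>)
  also have "\<nu> \<dots> = of_nat (a 0) * \<nu> (cls \<beta> (ind q)) + of_real (exp (t * real (a 0))) * \<nu> (cls \<beta> (ind (shift a)))"
    using dual_add[OF d FF_cmult[OF ind_FF[OF q_in]] FF_cmult[OF ind_FF[OF X_shift[OF a]]]]
      dual_cmult[OF d ind_FF[OF q_in]] dual_cmult[OF d ind_FF[OF X_shift[OF a]]] by simp
  finally show ?thesis using \<nu>(2) by (simp add: B_one_ind)
qed

lemma eigenfunctional_iterate: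
  assumes \<nu>: "eigenfunctional \<beta> t \<kappa> \<nu>" "\<nu> (B_one \<beta>) = 1" and a: "a \<in> X" and \<kappa>: "\<kappa> \<noteq> 0"
  shows "\<nu> (cls \<beta> (ind a)) = (\<Sum>k<n. of_nat (a k) * of_real (H k t a) / \<kappa> ^ Suc k)
    + of_real (H n t a) / \<kappa> ^ n * \<nu> (cls \<beta> (ind ((shift ^^ n) a)))"
proof (induction n)
  case (Suc n)
  have gn: "\<nu> (cls \<beta> (ind ((shift ^^ n) a))) =
      (of_nat (a n) + of_real (exp (t * real (a n))) * \<nu> (cls \<beta> (ind ((shift ^^ Suc n) a)))) / \<kappa>"
    using eigenfunctional_rec[OF \<nu> X_shift_pow[OF a], of n] \<kappa> by (simp add: shift_pow field_simps)
  show ?case unfolding Suc.IH gn using \<kappa>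
    by (simp add: H_Suc_right add_divide_distrib distrib_left mult_ac)
qed simp

text \<open>Iterating the recursion leaves a remainder: a weight over \<open>\<kappa> ^ n\<close>,
  which is exponentially small, times a value of \<open>\<nu>\<close> at an indicator, which is
  bounded since indicators have norm at most 2.\<close>

lemma eigenfunctional_sums:
  assumes \<nu>: "eigenfunctional \<beta> t \<kappa> \<nu>" "\<nu> (B_one \<beta>) = 1" and a: "a \<in> X" and \<kappa>: "r_rad \<beta> t < cmod \<kappa>"
  shows "\<nu> (cls \<beta> (ind a)) = psi \<kappa> a"
proof -
  have \<kappa>0: "\<kappa> \<noteq> 0" using \<kappa> r_rad_ge1 by auto
  obtain C where C: "C > 0" "\<And>f. f \<in> FF \<Longrightarrow> cmod (\<nu> (cls \<beta> f)) \<le> C * Nm f"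
    using \<nu>(1) dual_bound unfolding eigenfunctional_def by blast
  obtain D \<delta> where g: "D > 0" "0 < \<delta>" "\<delta> < 1" "\<And>n x. x \<in> X \<Longrightarrow> H n t x / cmod \<kappa> ^ n \<le> D * \<delta> ^ n"
    by (rule growth[OF \<kappa>]) blast
  have "BVn (ind b) \<le> 2" for b using BVI(2)[of "ind b" 1 1] ind_chain by (auto simp: ind_eq)
  then have "Nm (ind b) \<le> 2" for b using Nm_le_BVn[OF ind_BV] order_trans by blast
  then have b2: "cmod (\<nu> (cls \<beta> (ind b))) \<le> C * 2" if "b \<in> X" for b
    using C(2)[OF ind_FF[OF that]] C(1) by (meson less_imp_le mult_left_mono order_trans)
  have le: "cmod (of_real (H n t a) / \<kappa> ^ n * \<nu> (cls \<beta> (ind ((shift ^^ n) a)))) \<le> D * \<delta> ^ n * (C * 2)" for n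
  proof -
    have "cmod (of_real (H n t a) / \<kappa> ^ n * \<nu> (cls \<beta> (ind ((shift ^^ n) a)))) =
        (H n t a / cmod \<kappa> ^ n) * cmod (\<nu> (cls \<beta> (ind ((shift ^^ n) a))))"
      using H_pos[of n t a] by (simp add: norm_mult norm_divide norm_power)
    also have "\<dots> \<le> D * \<delta> ^ n * (C * 2)"
      using g b2[OF X_shift_pow[OF a]] a by (intro mult_mono) auto
    finally show ?thesis .
  qed
  have "(\<lambda>n. D * \<delta> ^ n * (C * 2)) \<longlonglongrightarrow> D * 0 * (C * 2)"
    using g by (intro tendsto_intros LIMSEQ_power_zero) auto
  then have lim: "(\<lambda>n. D * \<delta> ^ n * (C * 2)) \<longlonglongrightarrow> 0" by simp
  have "(\<lambda>n. of_real (H n t a) / \<kappa> ^ n * \<nu> (cls \<beta> (ind ((shift ^^ n) a)))) \<longlonglongrightarrow> 0"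
    by (rule Lim_null_comparison[OF _ lim]) (rule always_eventually, rule allI, rule le)
  moreover have "(\<lambda>n. \<Sum>k<n. of_nat (a k) * of_real (H k t a) / \<kappa> ^ Suc k) \<longlonglongrightarrow> psi \<kappa> a"
    using psi_sums[OF \<kappa> a] unfolding sums_def .
  ultimately have "(\<lambda>n. (\<Sum>k<n. of_nat (a k) * of_real (H k t a) / \<kappa> ^ Suc k) +
      of_real (H n t a) / \<kappa> ^ n * \<nu> (cls \<beta> (ind ((shift ^^ n) a)))) \<longlonglongrightarrow> psi \<kappa> a + 0"
    by (intro tendsto_add)
  then have "(\<lambda>n. \<nu> (cls \<beta> (ind a))) \<longlonglongrightarrow> psi \<kappa> a"
    unfolding eigenfunctional_iterate[OF \<nu> a \<kappa>0, symmetric] by simp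
  then show ?thesis using LIMSEQ_unique tendsto_const by blast
qed

text \<open>\<open>dualT\<close> multiplies \<open>psi \<kappa>\<close> by \<open>\<kappa>\<close>:
  its digit term carries the factor \<open>psi \<kappa> q = 1\<close>, which is what the resolvent
  equation asks for.\<close>

lemma eigenfunctional_exists:
  assumes \<kappa>: "r_rad \<beta> t < cmod \<kappa>" and root: "psi \<kappa> q = 1"
  shows "eigenfunctional \<beta> t \<kappa> (functional_of (psi \<kappa>))" "functional_of (psi \<kappa>) (B_one \<beta>) = 1"
proof -
  have b: "bounded_on (psi \<kappa>)" by (rule resolv_bounded[OF \<kappa> digit_bounded_on])
  show one: "functional_of (psi \<kappa>) (B_one \<beta>) = 1"
    using functional_of_ind[OF b q_in1] root by (simp add: B_one_ind)
  \<comment> \<open>The summand with factor 0 fits the shape of \<open>rep_change\<close>.\<close>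
  have dT: "dualT (psi \<kappa>) a = \<kappa> * psi \<kappa> a + 0 * psi \<kappa> a" if "a \<in> X1" for a
    using resolv_rec[where G = "\<lambda>a. of_nat (a 0)", OF \<kappa> X1_X[OF that] digit_bound[OF X1_X[OF that]]] root by (simp add: dualT_def)
  obtain B where B: "B > 0" "\<And>a. a \<in> X1 \<Longrightarrow> cmod (psi \<kappa> a) \<le> B" by (rule bounded_onE[OF b]) blast
  have bD: "bounded_on (dualT (psi \<kappa>))"
    unfolding bounded_on_def using B dT by (intro exI[of _ "cmod \<kappa> * B"]) (auto simp: norm_mult intro!: mult_left_mono)
  have "functional_of (psi \<kappa>) (transfer \<beta> t u) = \<kappa> * functional_of (psi \<kappa>) u" if u: "u \<in> F_space \<beta>" for u
  proof -
    obtain f where f: "f \<in> FF" "u = cls \<beta> f" using u unfolding F_space_cls by blast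
    obtain z where z: "rep (psi \<kappa>) f z" using rep_exists[OF b f(1)] ..
    obtain w where w: "rep (dualT (psi \<kappa>)) f w" using rep_exists[OF bD f(1)] ..
    have "w = \<kappa> * z + 0 * z" by (rule rep_change[OF w dT b b f(1) z z])
    then show ?thesis
      using functional_of_cls[OF b f(1) z] functional_of_cls[OF b T_FF[OF f(1)] rep_T[OF w f(1)]] f(2)
      by (simp add: transfer_cls)
  qed
  moreover have "B_one \<beta> \<in> F_space \<beta>" using ind_FF[OF q_in] by (simp add: B_one_ind FF_def)
  ultimately show "eigenfunctional \<beta> t \<kappa> (functional_of (psi \<kappa>))"
    unfolding eigenfunctional_def using functional_of_dual[OF b] one by force
qed

text \<open>A nonzero eigenfunction has \<open>C \<noteq> 0\<close> in \<open>eigen_form\<close>,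
  which leaves the second alternative.\<close>

lemma eigenvalue_root:
  assumes \<kappa>: "r_rad \<beta> t < cmod \<kappa>" and "eigenfunctions \<beta> t \<kappa> \<noteq> {}"
  shows "psi \<kappa> q = 1" "eigfun \<beta> t \<kappa> \<notin> null"
proof -
  obtain u where u: "u \<in> eigenfunctions \<beta> t \<kappa>" using assms(2) by blast
  then obtain f where f: "u = cls \<beta> f" unfolding eigenfunctions_def using F_space_cls by auto
  have ff: "f \<in> FF" "f \<notin> null" "cls \<beta> (T f) = cls \<beta> (\<lambda>x. \<kappa> * f x)" using u f eigenfunctions_cls by auto
  obtain C where C: "cls \<beta> f = cls \<beta> (\<lambda>x. C * eigfun \<beta> t \<kappa> x)" "C = 0 \<or> psi \<kappa> q = 1"
    by (rule eigen_form[OF \<kappa> ff(1,3)]) blast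
  have "C \<noteq> 0"
  proof
    assume "C = 0"
    then have "cls \<beta> f = cls \<beta> (\<lambda>_. 0)" using C by simp
    then show False using ff(2) by (simp add: cls_eq_iff)
  qed
  then show "psi \<kappa> q = 1" using C by blast
  show "eigfun \<beta> t \<kappa> \<notin> null"
  proof
    assume "eigfun \<beta> t \<kappa> \<in> null"
    from null_add[OF C(1)[unfolded cls_eq_iff] null_cmult[OF this, of C]] show False using ff(2) by simp
  qed
qed

lemma eigenvalue_part:
  assumes \<kappa>: "r_rad \<beta> t < cmod \<kappa>" and ne: "eigenfunctions \<beta> t \<kappa> \<noteq> {}"
  shows "has_dim \<beta> (eigenspace \<beta> t \<kappa>) 1"
    and "\<exists>!\<nu>. eigenfunctional \<beta> t \<kappa> \<nu> \<and> \<nu> (B_one \<beta>) = 1"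
    and "\<And>\<nu> a. eigenfunctional \<beta> t \<kappa> \<nu> \<Longrightarrow> \<nu> (B_one \<beta>) = 1 \<Longrightarrow> a \<in> X \<Longrightarrow>
      (\<lambda>n. of_nat (a n) * of_real (H n t a) / \<kappa> ^ Suc n) sums \<nu> (cls \<beta> (indicator (ival \<beta> zero_seq a)))"
    and "\<And>h. h \<in> eigenfunctions \<beta> t \<kappa> \<Longrightarrow> \<exists>C. h = cls \<beta> (\<lambda>x. C * eigfun \<beta> t \<kappa> x)"
proof -
  note root = eigenvalue_root[OF \<kappa> ne]
  show "has_dim \<beta> (eigenspace \<beta> t \<kappa>) 1" by (rule has_dim_line[OF root(2) eigenspace_eq[OF \<kappa> root(1)]])
  show "\<exists>!\<nu>. eigenfunctional \<beta> t \<kappa> \<nu> \<and> \<nu> (B_one \<beta>) = 1"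
  proof (rule ex1I)
    show "eigenfunctional \<beta> t \<kappa> (functional_of (psi \<kappa>)) \<and> functional_of (psi \<kappa>) (B_one \<beta>) = 1"
      using eigenfunctional_exists[OF \<kappa> root(1)] by blast
    fix \<nu> assume \<nu>: "eigenfunctional \<beta> t \<kappa> \<nu> \<and> \<nu> (B_one \<beta>) = 1"
    show "\<nu> = functional_of (psi \<kappa>)"
    proof (rule dual_determined)
      show "\<nu> \<in> F_dual \<beta>" "functional_of (psi \<kappa>) \<in> F_dual \<beta>"
        using \<nu> eigenfunctional_exists[OF \<kappa> root(1)] by (auto simp: eigenfunctional_def)
      show "\<nu> (cls \<beta> (ind a)) = functional_of (psi \<kappa>) (cls \<beta> (ind a))" if "a \<in> X1" for a
        using eigenfunctional_sums[OF _ _ X1_X[OF that] \<kappa>] \<nu> eigenfunctional_exists[OF \<kappa> root(1)] by metis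
    qed
  qed
  show "(\<lambda>n. of_nat (a n) * of_real (H n t a) / \<kappa> ^ Suc n) sums \<nu> (cls \<beta> (indicator (ival \<beta> zero_seq a)))"
    if "eigenfunctional \<beta> t \<kappa> \<nu>" "\<nu> (B_one \<beta>) = 1" "a \<in> X" for \<nu> a
    using psi_sums[OF \<kappa> that(3)] eigenfunctional_sums[OF that \<kappa>] by (simp add: ind_def)
  show "\<exists>C. h = cls \<beta> (\<lambda>x. C * eigfun \<beta> t \<kappa> x)" if h: "h \<in> eigenfunctions \<beta> t \<kappa>" for h
  proof -
    obtain f where f: "h = cls \<beta> f" using h unfolding eigenfunctions_def F_space_cls by auto
    show ?thesis using eigen_form[OF \<kappa>] h f eigenfunctions_cls by metis
  qed
qed

end

section \<open>A renewal theorem with exponential rate\<close>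

text \<open>Aperiodicity is built in, as \<open>p 0 > 0\<close> multiplies \<open>w\<close> itself.
  If \<open>S = 1\<close>, the nonnegative numbers \<open>p n * (1 - Re (w ^ Suc n))\<close> sum to
  0, and the first of them forces \<open>Re w = 1\<close>.\<close>

lemma renewal_root_unique:
  fixes p :: "nat \<Rightarrow> real" and w :: complex
  assumes p: "\<And>n. 0 \<le> p n" "p sums 1" "0 < p 0" and w: "cmod w \<le> 1" "w \<noteq> 1"
    and s: "(\<lambda>n. of_real (p n) * w ^ Suc n) sums S"
  shows "S \<noteq> 1"
proof
  assume S: "S = 1"
  have Re: "(\<lambda>n. p n * Re (w ^ Suc n)) sums 1" using sums_Re[OF s] S by simp
  have d: "(\<lambda>n. p n - p n * Re (w ^ Suc n)) sums (1 - 1)" by (rule sums_diff[OF p(2) Re])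
  have nn: "0 \<le> p n - p n * Re (w ^ Suc n)" for n
  proof -
    have "cmod (w ^ Suc n) \<le> 1" unfolding norm_power using w(1) by (intro power_le_one) auto
    then have "Re (w ^ Suc n) \<le> 1" using complex_Re_le_cmod order_trans by blast
    then have "p n * Re (w ^ Suc n) \<le> p n * 1" using p(1) by (intro mult_left_mono)
    then show ?thesis by simp
  qed
  have "Re w \<noteq> 1"
  proof
    assume r: "Re w = 1"
    have "(cmod w)\<^sup>2 \<le> 1" using w(1) by (simp add: power_le_one)
    then have "Im w = 0" using r cmod_power2[of w] by simp
    then show False using r w(2) by (simp add: complex_eq_iff)
  qed
  then have "Re w < 1" using complex_Re_le_cmod[of w] w(1) by linarith
  then have "0 < p 0 - p 0 * Re (w ^ Suc 0)" using p(3) by simp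
  then have "0 < (\<Sum>n. p n - p n * Re (w ^ Suc n))"
    using nn by (intro suminf_pos2[OF sums_summable[OF d], of 0]) auto
  then show False using sums_unique[OF d] by simp
qed

text \<open>\<open>p k\<close> is the probability of a step of length \<open>k + 1\<close>, hence
  the index \<open>n - 1 - k\<close>. The solution has the generating function
  \<open>W / (1 - P)\<close>. Dividing the zero of \<open>1 - P\<close> at 1 out leaves the
  generating function \<open>Q\<close> of the tails, which has no zero in the closed unit disc. So
  \<open>1 / Q\<close> has exponentially small coefficients, and their partial sums form the renewal
  sequence. \<open>K\<close> and \<open>\<theta>\<close> are chosen before \<open>v\<close>,
  \<open>w\<close> and \<open>A\<close>, so the rate is uniform.\<close>

lemma renewal_theorem:
  fixes p :: "nat \<Rightarrow> real"
  assumes p: "\<And>n. 0 \<le> p n" "p sums 1" "0 < p 0" "\<And>n. p n \<le> C * \<delta> ^ n" and \<delta>: "0 < \<delta>" "\<delta> < 1"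
  shows "(\<lambda>n. 1 - (\<Sum>k<n. p k)) sums (\<Sum>n. 1 - (\<Sum>k<n. p k))" "0 < (\<Sum>n. 1 - (\<Sum>k<n. p k))"
    and "\<exists>K \<theta>. 0 < K \<and> \<delta> < \<theta> \<and> \<theta> < 1 \<and> (\<forall>v w A. (\<forall>n. v n = w n + (\<Sum>k<n. p k * v (n - 1 - k))) \<longrightarrow>
      (\<forall>n. \<bar>w n\<bar> \<le> A * \<delta> ^ n) \<longrightarrow> (\<forall>n. \<bar>v n - suminf w / (\<Sum>n. 1 - (\<Sum>k<n. p k))\<bar> \<le> K * A * \<theta> ^ n))"
proof -
  define T where "T n = 1 - (\<Sum>k<n. p k)" for n
  define L where "L = (\<Sum>n. T n)"
  have C0: "0 \<le> C" using p(1)[of 0] p(4)[of 0] by simp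
  have T_tail: "T n = (\<Sum>k. p (k + n))" for n
    using suminf_split_initial_segment[OF sums_summable[OF p(2)], of n] sums_unique[OF p(2)]
    by (simp add: T_def)
  have psn: "summable (\<lambda>k. p (k + n))" for n using sums_summable[OF p(2)] by (simp add: summable_iff_shift)
  have T_nonneg: "0 \<le> T n" for n unfolding T_tail by (intro suminf_nonneg psn p(1))
  define C' where "C' = C / (1 - \<delta>)"
  have T_le: "T n \<le> C' * \<delta> ^ n" for n
  proof -
    have g: "summable (\<lambda>k. C * \<delta> ^ n * \<delta> ^ k)" using \<delta> by (intro summable_mult summable_geometric) auto
    have "T n \<le> (\<Sum>k. C * \<delta> ^ n * \<delta> ^ k)" unfolding T_tail
    proof (rule suminf_le[OF _ psn g])
      show "p (k + n) \<le> C * \<delta> ^ n * \<delta> ^ k" for k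
        using p(4)[of "k + n"] by (simp add: power_add mult_ac)
    qed
    also have "\<dots> = C' * \<delta> ^ n" using \<delta> by (subst suminf_mult) (auto simp: suminf_geometric C'_def)
    finally show ?thesis .
  qed
  have T_summable: "summable T"
    by (rule summable_comparison_test'[of "\<lambda>n. C' * \<delta> ^ n" 0])
      (use \<delta> T_le T_nonneg in \<open>auto intro!: summable_mult summable_geometric\<close>)
  have T0: "T 0 = 1" by (simp add: T_def)
  have L: "0 < L" unfolding L_def using T0 T_nonneg by (intro suminf_pos2[OF T_summable, of 0]) auto
  show "(\<lambda>n. 1 - (\<Sum>k<n. p k)) sums (\<Sum>n. 1 - (\<Sum>k<n. p k))" "0 < (\<Sum>n. 1 - (\<Sum>k<n. p k))"
    using summable_sums[OF T_summable] L unfolding L_def T_def by auto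

  define Q :: "complex fps" where "Q = Abs_fps (\<lambda>n. of_real (T n))"
  define P :: "complex fps" where "P = Abs_fps (\<lambda>n. if n = 0 then 0 else of_real (p (n - 1)))"
  have QP: "(1 - fps_X) * Q = 1 - P"
  proof (rule fps_ext)
    fix n show "((1 - fps_X) * Q) $ n = (1 - P) $ n"
      by (cases n) (auto simp: Q_def P_def T_def left_diff_distrib)
  qed
  have rad: "ereal (1 / \<delta>) \<le> fps_conv_radius F" if F: "\<And>n. cmod (F $ n) \<le> c * \<delta> ^ n" for F :: "complex fps" and c
    unfolding fps_conv_radius_def
  proof (rule conv_radius_geI_ex)
    fix r :: real assume r: "0 < r" "ereal r < ereal (1 / \<delta>)"
    have "summable (\<lambda>n. F $ n * of_real r ^ n)"
    proof (rule summable_comparison_test'[of "\<lambda>n. c * (\<delta> * r) ^ n" 0])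
      show "summable (\<lambda>n. c * (\<delta> * r) ^ n)"
        using r \<delta> by (intro summable_mult summable_geometric) (auto simp: field_simps)
      show "norm (F $ n * of_real r ^ n) \<le> c * (\<delta> * r) ^ n" for n
        using mult_right_mono[OF F[of n], of "r ^ n"] r by (simp add: norm_mult norm_power power_mult_distrib mult_ac)
    qed
    then show "\<exists>z. norm z = r \<and> summable (\<lambda>n. F $ n * z ^ n)"
      using r by (intro exI[of _ "of_real r"]) auto
  qed
  have radQ: "ereal (1 / \<delta>) \<le> fps_conv_radius Q"
    by (rule rad[of _ C']) (use T_le T_nonneg in \<open>auto simp: Q_def\<close>)
  have radP: "ereal (1 / \<delta>) \<le> fps_conv_radius P"
  proof (rule rad[of _ "C / \<delta>"])
    fix n show "cmod (P $ n) \<le> C / \<delta> * \<delta> ^ n"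
      using p(1,4)[of "n - 1"] C0 \<delta> by (cases n) (auto simp: P_def)
  qed
  have inr: "ereal (norm z) < fps_conv_radius Q" "ereal (norm z) < fps_conv_radius P" if "cmod z < 1 / \<delta>" for z :: complex
    using that radQ radP by (meson less_ereal.simps(1) less_le_trans)+
  have one\<delta>: "1 < 1 / \<delta>" using \<delta> by simp
  \<comment> \<open>At 1 the value is the mean \<open>L > 0\<close>; elsewhere a zero of
    \<open>Q\<close> would be a root of \<open>P = 1\<close>.\<close>
  have Qz: "eval_fps Q z \<noteq> 0" if z: "cmod z \<le> 1" for z
  proof (cases "z = 1")
    case True
    have "(\<lambda>n. of_real (T n)) sums (of_real L :: complex)" unfolding L_def using T_summable by (simp add: sums_of_real_iff summable_sums)
    then have "eval_fps Q z = of_real L" using True by (simp add: eval_fps_def Q_def sums_unique[symmetric])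
    then show ?thesis using L by simp
  next
    case False
    have zr: "cmod z < 1 / \<delta>" using z one\<delta> by linarith
    have "(\<lambda>n. P $ n * z ^ n) sums eval_fps P z" by (rule sums_eval_fps[OF inr(2)[OF zr]])
    then have "(\<lambda>n. P $ Suc n * z ^ Suc n) sums eval_fps P z"
      by (subst sums_Suc_iff) (simp add: P_def)
    then have "(\<lambda>n. of_real (p n) * z ^ Suc n) sums eval_fps P z" by (simp add: P_def)
    from renewal_root_unique[OF p(1-3) z False this] have "eval_fps P z \<noteq> 1" .
    moreover have "(1 - z) * eval_fps Q z = 1 - eval_fps P z"
    proof -
      have "eval_fps ((1 - fps_X) * Q) z = eval_fps (1 - fps_X) z * eval_fps Q z"
        by (rule eval_fps_mult) (use inr[OF zr] in \<open>auto intro: less_le_trans[OF _ fps_conv_radius_diff]\<close>)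
      moreover have "eval_fps (1 - P) z = 1 - eval_fps P z" using inr[OF zr] by (subst eval_fps_diff) auto
      moreover have "eval_fps (1 - fps_X) z = 1 - z" by (subst eval_fps_diff) auto
      ultimately show ?thesis using QP by simp
    qed
    ultimately show ?thesis by auto
  qed
  \<comment> \<open>The closed unit disc is compact inside the open set where \<open>Q\<close> does
    not vanish, which leaves room for a larger disc.\<close>
  obtain R where R: "1 < R" "R < 1 / \<delta>" "\<And>z. cmod z < R \<Longrightarrow> eval_fps Q z \<noteq> 0"
  proof -
    define U where "U = {z \<in> ball 0 (1 / \<delta>). eval_fps Q z \<noteq> 0}"
    have "continuous_on (ball 0 (1 / \<delta>)) (eval_fps Q)"
      by (rule continuous_on_subset[OF continuous_on_eval_fps]) (use inr in auto)
    then have "open U" unfolding U_def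
      using continuous_open_preimage[of "ball 0 (1 / \<delta>)" "eval_fps Q" "- {0}"]
      by (simp add: vimage_def Int_def conj_commute open_Compl)
    moreover have "cball 0 1 \<subseteq> U" unfolding U_def using Qz one\<delta> by auto
    ultimately obtain e where e: "e > 0" "(\<Union>x\<in>cball 0 1. ball x e) \<subseteq> U"
      using compact_subset_open_imp_ball_epsilon_subset[of "cball 0 (1::real)" U] compact_cball by (metis compact_subset_open_imp_ball_epsilon_subset)
    \<comment> \<open>The second bound keeps \<open>R\<close> below \<open>1 / \<delta>\<close>,
      where \<open>Q\<close> is analytic.\<close>
    define R where "R = min (1 + e) ((1 + 1 / \<delta>) / 2)"
    have "eval_fps Q z \<noteq> 0" if "cmod z < R" for z
    proof (cases "cmod z \<le> 1")
      case False
      define z1 where "z1 = z / of_real (cmod z)"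
      have "cmod z1 = 1" using False by (auto simp: z1_def norm_divide)
      moreover have "dist z1 z < e"
      proof -
        have "z1 * of_real (cmod z) = z" using False by (auto simp: z1_def)
        then have "z1 - z = z1 * of_real (1 - cmod z)" by (simp add: right_diff_distrib)
        then have "cmod (z1 - z) = \<bar>1 - cmod z\<bar>" using \<open>cmod z1 = 1\<close> by (simp only: norm_mult norm_of_real) simp
        then show ?thesis using False that by (simp add: R_def dist_norm)
      qed
      ultimately have "z1 \<in> cball 0 1" "z \<in> ball z1 e" by auto
      then have "z \<in> U" by (intro subsetD[OF e(2)] UN_I[of z1])
      then show ?thesis by (simp add: U_def)
    qed (use Qz in auto)
    then show thesis using e one\<delta> by (intro that[of R]) (auto simp: R_def min_less_iff_disj)
  qed
  define D where "D = inverse Q"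
  have Q0: "Q $ 0 \<noteq> 0" by (simp add: Q_def T0)
  have expD: "(\<lambda>z. inverse (eval_fps Q z)) has_fps_expansion D"
    unfolding D_def
    using radQ one\<delta> \<delta> by (intro has_fps_expansion_inverse eval_fps_has_fps_expansion Q0) (auto intro: less_le_trans[rotated])
  have holQ: "eval_fps Q holomorphic_on ball 0 R"
    by (rule holomorphic_on_eval_fps) (use inr R in auto)
  have "(\<lambda>z. inverse (eval_fps Q z)) holomorphic_on eball 0 (ereal R)"
    using R(3) by (auto intro!: holomorphic_intros holQ)
  from holomorphic_on_imp_fps_conv_radius_ge[OF expD this] have radD: "ereal R \<le> fps_conv_radius D" .
  \<comment> \<open>Inside the radius \<open>R\<close>, so that the coefficients of \<open>D\<close>
    times \<open>\<rho> ^ n\<close> are bounded, and above 1, so that \<open>1 / \<rho>\<close> is a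
    rate of decay.\<close>
  define \<rho> where "\<rho> = (1 + R) / 2"
  have \<rho>: "1 < \<rho>" "\<rho> < R" using R by (auto simp: \<rho>_def)
  have "summable (\<lambda>n. D $ n * of_real \<rho> ^ n)"
    using \<rho> radD by (intro summable_fps) (auto intro: less_le_trans[rotated])
  then have "Bseq (\<lambda>n. D $ n * of_real \<rho> ^ n)"
    using summable_LIMSEQ_zero convergent_imp_Bseq convergentI by blast
  then obtain M where M: "M > 0" "\<And>n. cmod (D $ n * of_real \<rho> ^ n) \<le> M" unfolding Bseq_def by blast
  define \<theta> where "\<theta> = 1 / \<rho>"
  have "\<rho> < 1 / \<delta>" using \<rho> R by linarith
  then have \<theta>: "\<delta> < \<theta>" "\<theta> < 1" "0 < \<theta>" using \<rho> \<delta> by (auto simp: \<theta>_def field_simps)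
  have D_le: "cmod (D $ n) \<le> M * \<theta> ^ n" for n
    using M(2)[of n] \<rho> by (simp add: norm_mult norm_power \<theta>_def power_divide field_simps)
  have sumD: "(\<lambda>n. D $ n) sums of_real (1 / L)"
  proof -
    have "(\<lambda>n. D $ n * 1 ^ n) sums inverse (eval_fps Q 1)"
      by (rule has_fps_expansion_imp_sums_complex[OF expD, of "ereal R"]) (use R(1,3) in \<open>auto intro!: holomorphic_intros holQ\<close>)
    moreover have "eval_fps Q 1 = of_real L"
    proof -
      have "(\<lambda>n. of_real (T n)) sums (of_real L :: complex)" unfolding L_def using T_summable by (simp add: sums_of_real_iff summable_sums)
      then show ?thesis by (simp add: eval_fps_def Q_def sums_unique[symmetric])
    qed
    ultimately show ?thesis by (simp add: inverse_eq_divide)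
  qed
  \<comment> \<open>Dividing by \<open>1 - X\<close> is summation, so \<open>u\<close> has the
    generating function \<open>1 / (1 - P)\<close>.\<close>
  define u where "u n = (\<Sum>k\<le>n. D $ k)" for n
  define U where "U = Abs_fps u"
  have UX: "(1 - fps_X) * U = D"
  proof (rule fps_ext)
    fix n show "((1 - fps_X) * U) $ n = D $ n"
      by (cases n) (auto simp: U_def u_def left_diff_distrib)
  qed
  have "Q * D = 1" unfolding D_def using Q0 by (simp add: inverse_mult_eq_1')
  then have UP: "U * (1 - P) = 1" unfolding QP[symmetric] UX[symmetric] by (simp add: algebra_simps)
  have u_close: "cmod (u n - of_real (1 / L)) \<le> M / (1 - \<theta>) * \<theta> ^ n" for n
  proof -
    have sD: "summable (\<lambda>k. D $ k)" using sumD sums_summable by blast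
    have g: "summable (\<lambda>k. M * \<theta> ^ Suc n * \<theta> ^ k)" using \<theta> by (intro summable_mult summable_geometric) auto
    have "of_real (1 / L) = (\<Sum>k. D $ (k + Suc n)) + u n"
      using suminf_split_initial_segment[OF sD, of "Suc n"] sums_unique[OF sumD]
      by (simp add: u_def lessThan_Suc_atMost del: sum.lessThan_Suc)
    then have "cmod (u n - of_real (1 / L)) = cmod (\<Sum>k. D $ (k + Suc n))" by (simp add: norm_minus_commute)
    also have "\<dots> \<le> (\<Sum>k. M * \<theta> ^ Suc n * \<theta> ^ k)"
    proof (rule norm_suminf_le[OF _ g])
      show "cmod (D $ (k + Suc n)) \<le> M * \<theta> ^ Suc n * \<theta> ^ k" for k
        using D_le[of "k + Suc n"] by (simp add: power_add mult_ac)
    qed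
    also have "\<dots> = M * \<theta> ^ Suc n / (1 - \<theta>)" using \<theta> g by (subst suminf_mult) (auto simp: suminf_geometric)
    also have "\<dots> \<le> M * \<theta> ^ n / (1 - \<theta>)"
      using \<theta> M power_decreasing[of n "Suc n" \<theta>] by (intro divide_right_mono mult_left_mono) auto
    finally show ?thesis by simp
  qed
  \<comment> \<open>The first summand comes from the convolution of the rates
    \<open>\<theta>\<close> and \<open>\<delta>\<close>, the second from the tail of
    \<open>w\<close>.\<close>
  define K where "K = M / (1 - \<theta>) * \<theta> / (\<theta> - \<delta>) + (1 / L) / (1 - \<delta>)"
  have K: "0 < K" using M \<theta> \<delta> L by (auto simp: K_def intro!: add_pos_pos)
  have "\<bar>v n - suminf w / L\<bar> \<le> K * A * \<theta> ^ n"
    if v: "\<forall>n. v n = w n + (\<Sum>k<n. p k * v (n - 1 - k))" and w: "\<forall>n. \<bar>w n\<bar> \<le> A * \<delta> ^ n" for v w :: "nat \<Rightarrow> real" and A n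
  proof -
    have A: "0 \<le> A" using w[rule_format, of 0] by simp
    define V where "V = Abs_fps (\<lambda>n. of_real (v n) :: complex)"
    define W where "W = Abs_fps (\<lambda>n. of_real (w n) :: complex)"
    have "V = W + P * V"
    proof (rule fps_ext)
      fix n
      have "(P * V) $ n = (\<Sum>k<n. of_real (p k) * of_real (v (n - 1 - k)))"
      proof (cases n)
        case (Suc m)
        have "(P * V) $ n = (\<Sum>i\<le>Suc m. P $ i * V $ (Suc m - i))" using Suc by (simp add: fps_mult_nth atLeast0AtMost)
        also have "\<dots> = (\<Sum>i\<le>m. P $ Suc i * V $ (m - i))" by (subst sum.atMost_Suc_shift) (simp add: P_def)
        finally show ?thesis using Suc by (simp add: P_def V_def lessThan_Suc_atMost)
      qed (simp add: P_def)
      then show "V $ n = (W + P * V) $ n"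
        unfolding fps_add_nth V_def W_def fps_nth_Abs_fps by (subst v[rule_format]) simp
    qed
    then have "V * (1 - P) = W" by (simp add: algebra_simps)
    then have VUW: "V = W * U" using UP by (metis mult.commute mult.left_commute mult_1)
    have "of_real (v n) = V $ n" by (simp add: V_def)
    also have "\<dots> = (\<Sum>j\<le>n. W $ j * U $ (n - j))" unfolding VUW by (simp add: fps_mult_nth atLeast0AtMost)
    finally have vn: "of_real (v n) = (\<Sum>j\<le>n. u (n - j) * of_real (w j))"
      by (simp add: U_def W_def mult.commute)
    have ws: "summable w"
      by (rule summable_comparison_test'[of "\<lambda>n. A * \<delta> ^ n" 0]) (use w \<delta> in \<open>auto intro!: summable_mult summable_geometric\<close>)
    have split: "suminf w = (\<Sum>j. w (j + Suc n)) + (\<Sum>j\<le>n. w j)"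
      using suminf_split_initial_segment[OF ws, of "Suc n"] by (simp add: lessThan_Suc_atMost del: sum.lessThan_Suc)
    have tail: "\<bar>\<Sum>j. w (j + Suc n)\<bar> \<le> A * \<theta> ^ n / (1 - \<delta>)"
    proof -
      have g: "summable (\<lambda>j. A * \<delta> ^ Suc n * \<delta> ^ j)" using \<delta> by (intro summable_mult summable_geometric) auto
      have "norm (\<Sum>j. w (j + Suc n)) \<le> (\<Sum>j. A * \<delta> ^ Suc n * \<delta> ^ j)"
      proof (rule norm_suminf_le[OF _ g])
        show "norm (w (j + Suc n)) \<le> A * \<delta> ^ Suc n * \<delta> ^ j" for j
          using w[rule_format, of "j + Suc n"] by (simp add: power_add mult_ac)
      qed
      also have "\<dots> = A * \<delta> ^ Suc n / (1 - \<delta>)" using \<delta> g by (subst suminf_mult) (auto simp: suminf_geometric)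
      also have "\<dots> \<le> A * \<theta> ^ n / (1 - \<delta>)"
      proof -
        have "\<delta> ^ Suc n \<le> \<delta> ^ n" using \<delta> by (intro power_decreasing) auto
        also have "\<delta> ^ n \<le> \<theta> ^ n" using \<delta> \<theta> by (intro power_mono) auto
        finally show ?thesis using A \<delta> by (intro divide_right_mono mult_left_mono) auto
      qed
      finally show ?thesis by simp
    qed
    have main: "cmod (\<Sum>j\<le>n. (u (n - j) - of_real (1 / L)) * of_real (w j)) \<le> M / (1 - \<theta>) * A * (\<theta> / (\<theta> - \<delta>)) * \<theta> ^ n"
    proof -
      have "cmod (\<Sum>j\<le>n. (u (n - j) - of_real (1 / L)) * of_real (w j)) \<le> (\<Sum>j\<le>n. (M / (1 - \<theta>) * \<theta> ^ (n - j)) * (A * \<delta> ^ j))"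
      proof (rule sum_norm_le)
        fix j
        have "cmod (u (n - j) - of_real (1 / L)) * \<bar>w j\<bar> \<le> (M / (1 - \<theta>) * \<theta> ^ (n - j)) * (A * \<delta> ^ j)"
          using M \<theta> by (intro mult_mono u_close w[rule_format]) auto
        then show "cmod ((u (n - j) - of_real (1 / L)) * of_real (w j)) \<le> (M / (1 - \<theta>) * \<theta> ^ (n - j)) * (A * \<delta> ^ j)"
          by (simp only: norm_mult norm_of_real)
      qed
      also have "\<dots> = (\<Sum>j\<le>n. (M / (1 - \<theta>) * A * \<theta> ^ n) * (\<delta> / \<theta>) ^ j)"
        using \<theta> by (intro sum.cong) (auto simp: power_diff power_divide)
      also have "\<dots> = (M / (1 - \<theta>) * A * \<theta> ^ n) * (\<Sum>j\<le>n. (\<delta> / \<theta>) ^ j)" by (simp add: sum_distrib_left)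
      also have "\<dots> \<le> (M / (1 - \<theta>) * A * \<theta> ^ n) * (\<theta> / (\<theta> - \<delta>))"
      proof -
        have "(\<Sum>j\<le>n. (\<delta> / \<theta>) ^ j) \<le> (\<Sum>j. (\<delta> / \<theta>) ^ j)"
          using \<delta> \<theta> by (intro sum_le_suminf summable_geometric) auto
        also have "\<dots> = 1 / (1 - \<delta> / \<theta>)" using \<delta> \<theta> by (intro suminf_geometric) auto
        also have "\<dots> = \<theta> / (\<theta> - \<delta>)" using \<theta> by (simp add: field_simps)
        finally show ?thesis using M A \<theta> by (intro mult_left_mono) auto
      qed
      finally show ?thesis by (simp add: mult_ac)
    qed
    have "of_real (v n - suminf w / L) = (\<Sum>j\<le>n. (u (n - j) - of_real (1 / L)) * of_real (w j)) - of_real ((1 / L) * (\<Sum>j. w (j + Suc n)))"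
      unfolding of_real_diff vn split by (simp add: left_diff_distrib sum_subtractf sum_distrib_left add_divide_distrib sum_divide_distrib)
    then have "\<bar>v n - suminf w / L\<bar> = cmod ((\<Sum>j\<le>n. (u (n - j) - of_real (1 / L)) * of_real (w j)) - of_real ((1 / L) * (\<Sum>j. w (j + Suc n))))"
      by (metis norm_of_real)
    also have "\<dots> \<le> M / (1 - \<theta>) * A * (\<theta> / (\<theta> - \<delta>)) * \<theta> ^ n + (1 / L) * (A * \<theta> ^ n / (1 - \<delta>))"
    proof (intro order_trans[OF norm_triangle_ineq4] add_mono main)
      have "\<bar>1 / L\<bar> * \<bar>\<Sum>j. w (j + Suc n)\<bar> \<le> (1 / L) * (A * \<theta> ^ n / (1 - \<delta>))"
        using tail L by (intro mult_mono) auto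
      then show "cmod (of_real ((1 / L) * (\<Sum>j. w (j + Suc n)))) \<le> (1 / L) * (A * \<theta> ^ n / (1 - \<delta>))"
        by (simp only: norm_of_real abs_mult)
    qed
    also have "\<dots> = K * A * \<theta> ^ n" unfolding K_def by (simp add: distrib_right distrib_left mult_ac)
    finally show ?thesis .
  qed
  then show "\<exists>K \<theta>. 0 < K \<and> \<delta> < \<theta> \<and> \<theta> < 1 \<and> (\<forall>v w A. (\<forall>n. v n = w n + (\<Sum>k<n. p k * v (n - 1 - k))) \<longrightarrow>
      (\<forall>n. \<bar>w n\<bar> \<le> A * \<delta> ^ n) \<longrightarrow> (\<forall>n. \<bar>v n - suminf w / (\<Sum>n. 1 - (\<Sum>k<n. p k))\<bar> \<le> K * A * \<theta> ^ n))"
    using K \<theta> unfolding L_def T_def by blast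
qed

section \<open>The positive eigenpair\<close>

lemma power_powr: "0 < x \<Longrightarrow> (x ^ m) powr s = (x powr s) ^ m" for x s :: real
  by (induction m) (simp_all add: powr_mult)

locale positive_pair = beta +
  fixes \<kappa> :: real and \<nu> :: "fclass \<Rightarrow> complex"
  assumes pair: "positive_eigenpair \<beta> t \<kappa> \<nu>"
begin

text \<open>The distribution function of the eigenfunctional; positivity makes it real, increasing
  and bounded by 1.\<close>

definition G :: "digits \<Rightarrow> real" where "G a = Re (\<nu> (cls \<beta> (ind a)))"

lemma \<kappa>_pos: "0 < \<kappa>" and eigf: "eigenfunctional \<beta> t (of_real \<kappa>) \<nu>" and \<nu>_one: "\<nu> (B_one \<beta>) = 1"
  and \<nu>_dual: "\<nu> \<in> F_dual \<beta>"
  using pair by (auto simp: positive_eigenpair_def eigenfunctional_def)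

lemma \<nu>_nonneg: "f \<in> FF \<Longrightarrow> (\<And>x. x \<in> X \<Longrightarrow> f x \<in> \<real>\<^sub>\<ge>\<^sub>0) \<Longrightarrow> \<nu> (cls \<beta> f) \<in> \<real>\<^sub>\<ge>\<^sub>0"
  using pair cls_self[of f] unfolding positive_eigenpair_def nonneg_class_def FF_def by blast

lemma \<nu>_ind: assumes "a \<in> X" shows "\<nu> (cls \<beta> (ind a)) = of_real (G a)" "0 \<le> G a"
proof -
  have "\<nu> (cls \<beta> (ind a)) \<in> \<real>\<^sub>\<ge>\<^sub>0" using assms by (intro \<nu>_nonneg ind_FF) (auto simp: ind_eq)
  then show "\<nu> (cls \<beta> (ind a)) = of_real (G a)" "0 \<le> G a"
    by (auto simp: G_def complex_nonneg_Reals_iff complex_eq_iff)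
qed

lemma G_mono: assumes "a \<in> X" "b \<in> X" "a \<preceq> b" shows "G a \<le> G b"
proof -
  have "\<nu> (cls \<beta> (\<lambda>x. ind b x - ind a x)) \<in> \<real>\<^sub>\<ge>\<^sub>0"
  proof (rule \<nu>_nonneg)
    show "(\<lambda>x. ind b x - ind a x) \<in> FF" using assms by (intro FF_diff ind_FF)
    fix x assume "x \<in> X"
    then show "ind b x - ind a x \<in> \<real>\<^sub>\<ge>\<^sub>0" using assms(3) lex.order_trans[of x a b] by (auto simp: ind_eq)
  qed
  then show ?thesis using dual_diff[OF \<nu>_dual ind_FF[OF assms(2)] ind_FF[OF assms(1)]] \<nu>_ind assms
    by (auto simp: complex_nonneg_Reals_iff)
qed

lemma G_q: "G q = 1" using \<nu>_one by (simp add: G_def B_one_ind)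

lemma G_le1: "a \<in> X \<Longrightarrow> G a \<le> 1" using G_mono[OF _ q_in X_le] G_q by simp

lemma G_rec: assumes "a \<in> X" shows "\<kappa> * G a = real (a 0) + exp (t * real (a 0)) * G (shift a)"
proof -
  have "of_real (\<kappa> * G a) = (of_real (real (a 0) + exp (t * real (a 0)) * G (shift a)) :: complex)"
    using eigenfunctional_rec[OF eigf \<nu>_one assms] \<nu>_ind(1)[OF assms] \<nu>_ind(1)[OF X_shift[OF assms]] by simp
  then show ?thesis unfolding of_real_eq_iff .
qed

lemma G_rec0: "a \<in> X \<Longrightarrow> a 0 = 0 \<Longrightarrow> \<kappa> * G a = G (shift a)"
  and G_rec1: "a \<in> X \<Longrightarrow> a 0 = 1 \<Longrightarrow> \<kappa> * G a = 1 + exp t * G (shift a)"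
  using G_rec[of a] by auto

text \<open>From \<open>\<kappa> = 1 + exp t * G (shift q)\<close> one has
  \<open>\<kappa> \<ge> 1\<close>. Equality would make \<open>G\<close> vanish along the orbit of
  \<open>shift q\<close>, and with it all later digits of \<open>q\<close>, which has infinitely
  many ones.\<close>

lemma \<kappa>_gt1: "1 < \<kappa>"
proof (rule ccontr)
  assume "\<not> 1 < \<kappa>"
  then have k: "\<kappa> \<le> 1" by simp
  have r: "\<kappa> = 1 + exp t * G (shift q)" using G_rec1[OF q_in q0] G_q by simp
  have g0: "0 \<le> G (shift q)" by (rule \<nu>_ind(2)[OF X_shift[OF q_in]])
  have "exp t * G (shift q) \<le> 0" using r k by linarith
  then have z: "G (shift q) = 0" using g0 by (simp add: mult_le_0_iff)
  have "G ((shift ^^ Suc n) q) = 0" for n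
  proof (induction n)
    case (Suc n)
    let ?a = "(shift ^^ Suc n) q"
    have aX: "?a \<in> X" by (rule X_shift_pow[OF q_in])
    have "real (?a 0) + exp (t * real (?a 0)) * G (shift ?a) = 0" using G_rec[OF aX] Suc by simp
    moreover have "0 \<le> exp (t * real (?a 0)) * G (shift ?a)" using \<nu>_ind(2)[OF X_shift[OF aX]] by simp
    ultimately have "exp (t * real (?a 0)) * G (shift ?a) = 0" by (smt (verit) of_nat_0_le_iff)
    then show ?case by simp
  qed (use z in simp)
  then have "q (Suc n) = 0" for n
  proof -
    let ?a = "(shift ^^ Suc n) q"
    have aX: "?a \<in> X" by (rule X_shift_pow[OF q_in])
    have "G ?a = 0" "G (shift ?a) = 0"
      using \<open>\<And>n. G ((shift ^^ Suc n) q) = 0\<close>[of n] \<open>\<And>n. G ((shift ^^ Suc n) q) = 0\<close>[of "Suc n"] by auto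
    then have "real (?a 0) = 0" using G_rec[OF aX] by simp
    then show ?thesis by (simp add: shift_pow del: funpow.simps)
  qed
  moreover obtain i where "i \<ge> 1" "q i = 1" using q_ones by blast
  ultimately show False by (cases i) auto
qed

text \<open>Replacing ones by zeros keeps a word admissible, so an admissible word with \<open>m\<close> ones accounts
  for a factor \<open>(1 + exp t) ^ m\<close> of \<open>\<kappa> ^ n\<close>, which strictly exceeds \<open>exp t ^ m\<close>.\<close>

lemma subword_growth:
  assumes "x \<in> X" shows "(1 + exp t) ^ (\<Sum>i<n. x i) * G ((shift ^^ n) x) \<le> \<kappa> ^ n * G x"
proof (induction n)
  case (Suc n)
  let ?a = "(shift ^^ n) x"
  have aX: "?a \<in> X" by (rule X_shift_pow[OF assms])
  \<comment> \<open>For a digit 1 the right side is \<open>1 + exp t * G (shift ?a)\<close>, and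
    \<open>G (shift ?a) \<le> 1\<close>.\<close>
  have "(1 + exp t) ^ x n * G (shift ?a) \<le> \<kappa> * G ?a"
    using X_digit[OF assms, of n] G_rec0[OF aX] G_rec1[OF aX] G_le1[OF X_shift[OF aX]]
    by (auto simp: shift_pow algebra_simps)
  then have "(1 + exp t) ^ (\<Sum>i<n. x i) * ((1 + exp t) ^ x n * G (shift ?a)) \<le> (1 + exp t) ^ (\<Sum>i<n. x i) * (\<kappa> * G ?a)"
    by (intro mult_left_mono) (auto simp: add_nonneg_nonneg)
  also have "\<dots> = \<kappa> * ((1 + exp t) ^ (\<Sum>i<n. x i) * G ?a)" by simp
  also have "\<dots> \<le> \<kappa> * (\<kappa> ^ n * G x)" using Suc \<kappa>_pos by (intro mult_left_mono) auto
  finally show ?case by (simp add: power_add mult_ac)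
qed simp

text \<open>The factor \<open>G\<close> in the previous bound may be tiny, so that bound is used at
  the last one of the word, where \<open>G\<close> is at least \<open>1 / \<kappa>\<close>. That one
  costs the additional factor \<open>1 + exp t\<close>.\<close>

lemma ones_growth:
  assumes "x \<in> X" shows "(1 + exp t) ^ (\<Sum>i<n. x i) \<le> (1 + exp t) * \<kappa> ^ n"
proof (induction n)
  case (Suc n)
  have E: "1 < 1 + exp t" by simp
  consider "x n = 0" | "x n = 1" using X_digit[OF assms, of n] by auto
  then show ?case
  proof cases
    case 1
    have "(1 + exp t) * \<kappa> ^ n \<le> (1 + exp t) * \<kappa> ^ Suc n"
      using \<kappa>_gt1 E by (intro mult_left_mono power_increasing) auto
    then show ?thesis using Suc 1 by simp
  next
    case 2
    let ?a = "(shift ^^ n) x"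
    have aX: "?a \<in> X" by (rule X_shift_pow[OF assms])
    have "1 \<le> \<kappa> * G ?a" using G_rec1[OF aX] \<nu>_ind(2)[OF X_shift[OF aX]] 2 by (simp add: shift_pow)
    then have "(1 + exp t) ^ (\<Sum>i<n. x i) * 1 \<le> (1 + exp t) ^ (\<Sum>i<n. x i) * (\<kappa> * G ?a)"
      by (intro mult_left_mono) (auto simp: add_nonneg_nonneg)
    also have "\<dots> = \<kappa> * ((1 + exp t) ^ (\<Sum>i<n. x i) * G ?a)" by simp
    also have "\<dots> \<le> \<kappa> * (\<kappa> ^ n * G x)" using subword_growth[OF assms] \<kappa>_pos by (intro mult_left_mono) auto
    also have "\<dots> \<le> \<kappa> * (\<kappa> ^ n * 1)" using G_le1[OF assms] \<kappa>_pos by (intro mult_left_mono) auto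
    finally have "(1 + exp t) * (1 + exp t) ^ (\<Sum>i<n. x i) \<le> (1 + exp t) * \<kappa> ^ Suc n"
      using E by (intro mult_left_mono) auto
    then show ?thesis using 2 by simp
  qed
qed (simp add: add_increasing2)

text \<open>For \<open>t \<le> 0\<close> all weights are at most 1. For \<open>t > 0\<close> the
  exponent \<open>s < 1\<close> is chosen with \<open>(1 + exp t) powr s = exp t\<close>, which
  turns \<open>ones_growth\<close> into a bound on the weights with rate
  \<open>\<kappa> powr s\<close>.\<close>

lemma r_less_\<kappa>: "r_rad \<beta> t < \<kappa>"
proof (cases "t \<le> 0")
  case True
  have "r_rad \<beta> t \<le> 1"
  proof (rule r_rad_le[of 1])
    show "H n t x \<le> 1 * 1 ^ n" if "x \<in> X" for n x
      using True by (simp add: H_def mult_nonpos_nonneg sum_nonneg)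
  qed auto
  then show ?thesis using \<kappa>_gt1 by simp
next
  case False
  define s where "s = t / ln (1 + exp t)"
  have E: "1 < 1 + exp t" by simp
  have ln: "t < ln (1 + exp t)" using ln_less_cancel_iff[of "exp t" "1 + exp t"] by (simp add: add_pos_pos)
  then have s: "0 < s" "s < 1" using False by (auto simp: s_def)
  have "1 + exp t \<noteq> 0" using E by linarith
  then have pw: "(1 + exp t) powr s = exp t" using ln False by (simp add: powr_def s_def)
  have "r_rad \<beta> t \<le> \<kappa> powr s"
  proof (rule r_rad_le[of "exp t"])
    fix n x assume x: "x \<in> X"
    have "H n t x = exp t ^ (\<Sum>i<n. x i)" by (simp add: H_def exp_of_nat_mult[symmetric] mult.commute)
    also have "\<dots> = ((1 + exp t) ^ (\<Sum>i<n. x i)) powr s"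
      using power_powr[of "1 + exp t" "\<Sum>i<n. x i" s] E pw by simp
    also have "\<dots> \<le> ((1 + exp t) * \<kappa> ^ n) powr s" using ones_growth[OF x] s E by (intro powr_mono2) auto
    also have "\<dots> = exp t * (\<kappa> powr s) ^ n"
      using \<kappa>_gt1 by (simp add: powr_mult pw power_powr)
    finally show "H n t x \<le> exp t * (\<kappa> powr s) ^ n" .
  qed (use \<kappa>_gt1 in auto)
  also have "\<kappa> powr s < \<kappa> powr 1" using \<kappa>_gt1 s by (intro powr_less_mono) auto
  finally show ?thesis using \<kappa>_gt1 by simp
qed

lemma r_less_norm: "r_rad \<beta> t < cmod (of_real \<kappa>)" using r_less_\<kappa> \<kappa>_gt1 by simp

lemma G_sums: assumes "a \<in> X" shows "(\<lambda>n. real (a n) * H n t a / \<kappa> ^ Suc n) sums G a"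
proof -
  have "(\<lambda>n. of_nat (a n) * of_real (H n t a) / of_real \<kappa> ^ Suc n) sums (of_real (G a) :: complex)"
    using psi_sums[OF r_less_norm assms] eigenfunctional_sums[OF eigf \<nu>_one assms r_less_norm] \<nu>_ind(1)[OF assms] by simp
  then have "(\<lambda>n. of_real (real (a n) * H n t a / \<kappa> ^ Suc n)) sums (of_real (G a) :: complex)" by simp
  then show ?thesis by (subst (asm) sums_of_real_iff)
qed

lemma root: "psi (of_real \<kappa>) q = 1"
  using eigenfunctional_sums[OF eigf \<nu>_one q_in r_less_norm] \<nu>_ind(1)[OF q_in] G_q by simp

section \<open>The renewal sequence\<close>

definition pr :: "nat \<Rightarrow> real" where "pr n = real (q n) * H n t q / \<kappa> ^ Suc n"

lemma pr_nonneg: "0 \<le> pr n" using \<kappa>_pos H_pos[of n t q] by (simp add: pr_def)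
lemma pr_sums: "pr sums 1" using G_sums[OF q_in] G_q by (simp add: pr_def[abs_def])
lemma pr0: "pr 0 = 1 / \<kappa>" by (simp add: pr_def q0)

text \<open>The remainder of the series for \<open>G q = 1\<close> after \<open>n\<close> terms.
  Hence the terms of \<open>\<nu>\<close> applied to the eigenfunction are the tails of
  \<open>pr\<close>, and they sum to the mean \<open>L\<close>.\<close>

lemma G_tail: "H n t q / \<kappa> ^ n * G ((shift ^^ n) q) = 1 - (\<Sum>k<n. pr k)"
proof (induction n)
  case (Suc n)
  have g: "G ((shift ^^ n) q) = (real (q n) + exp (t * real (q n)) * G ((shift ^^ Suc n) q)) / \<kappa>"
    using G_rec[OF X_shift_pow[OF q_in, of n]] \<kappa>_pos by (simp add: shift_pow field_simps)
  have "1 - (\<Sum>k<Suc n. pr k) = H n t q / \<kappa> ^ n * G ((shift ^^ n) q) - pr n" using Suc by simp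
  also have "\<dots> = H (Suc n) t q / \<kappa> ^ Suc n * G ((shift ^^ Suc n) q)"
    unfolding g pr_def using \<kappa>_pos by (simp add: H_Suc_right field_simps)
  finally show ?case by simp
qed (simp add: G_q)

lemma growth_pair:
  obtains C \<delta> where "C > 0" "0 < \<delta>" "\<delta> < 1" "\<And>n x. x \<in> X \<Longrightarrow> H n t x / \<kappa> ^ n \<le> C * \<delta> ^ n"
  using growth[OF r_less_\<kappa>] by blast

lemma digit_le1: "a \<in> X \<Longrightarrow> real (a n) \<le> 1" using X_digit[of a n] by auto

lemma coeff_le:
  assumes "a \<in> X" "H n t a / \<kappa> ^ n \<le> C * \<delta> ^ n" shows "real (a n) * H n t a / \<kappa> ^ Suc n \<le> C * \<delta> ^ n"
proof -
  have h: "0 \<le> H n t a / \<kappa> ^ n" using H_pos[of n t a] \<kappa>_pos by simp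
  have "real (a n) * H n t a / \<kappa> ^ Suc n = (real (a n) / \<kappa>) * (H n t a / \<kappa> ^ n)" by simp
  also have "\<dots> \<le> 1 * (H n t a / \<kappa> ^ n)"
    using digit_le1[OF assms(1), of n] \<kappa>_gt1 h by (intro mult_right_mono) auto
  finally show ?thesis using assms(2) by simp
qed

definition L :: real where "L = (\<Sum>n. 1 - (\<Sum>k<n. pr k))"

lemma renewal:
  obtains C K \<delta> \<theta> where "C > 0" "0 < \<delta>" "\<And>n x. x \<in> X \<Longrightarrow> H n t x / \<kappa> ^ n \<le> C * \<delta> ^ n"
    "0 < K" "\<delta> < \<theta>" "\<theta> < 1" "\<And>v w A n. (\<And>n. v n = w n + (\<Sum>k<n. pr k * v (n - 1 - k))) \<Longrightarrow>
      (\<And>n. \<bar>w n\<bar> \<le> A * \<delta> ^ n) \<Longrightarrow> \<bar>v n - suminf w / L\<bar> \<le> K * A * \<theta> ^ n"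
proof -
  obtain C \<delta> where g: "C > 0" "0 < \<delta>" "\<delta> < 1" "\<And>n x. x \<in> X \<Longrightarrow> H n t x / \<kappa> ^ n \<le> C * \<delta> ^ n"
    by (rule growth_pair) blast
  have le: "pr n \<le> C * \<delta> ^ n" for n unfolding pr_def by (rule coeff_le[OF q_in g(4)[OF q_in]])
  have p0: "0 < pr 0" using pr0 \<kappa>_pos by simp
  show thesis
    using renewal_theorem(3)[OF pr_nonneg pr_sums p0 le g(2,3)] that[OF g(1,2,4)] unfolding L_def by blast
qed

lemma tail_sums: "(\<lambda>n. 1 - (\<Sum>k<n. pr k)) sums L" and L_pos: "0 < L"
proof -
  obtain C \<delta> where g: "C > 0" "0 < \<delta>" "\<delta> < 1" "\<And>n x. x \<in> X \<Longrightarrow> H n t x / \<kappa> ^ n \<le> C * \<delta> ^ n"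
    by (rule growth_pair) blast
  have le: "pr n \<le> C * \<delta> ^ n" for n unfolding pr_def by (rule coeff_le[OF q_in g(4)[OF q_in]])
  have p0: "0 < pr 0" using pr0 \<kappa>_pos by simp
  show "(\<lambda>n. 1 - (\<Sum>k<n. pr k)) sums L" "0 < L"
    using renewal_theorem(1,2)[OF pr_nonneg pr_sums p0 le g(2,3)] unfolding L_def by auto
qed

text \<open>Summation by parts: a mean is the sum of the tails. The boundary term vanishes because
  the tails decay exponentially.\<close>

lemma norm_const_eq: "norm_const \<beta> t \<kappa> = L"
proof -
  obtain C \<delta> where g: "C > 0" "0 < \<delta>" "\<delta> < 1" "\<And>n x. x \<in> X \<Longrightarrow> H n t x / \<kappa> ^ n \<le> C * \<delta> ^ n"
    by (rule growth_pair) blast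
  have part: "(\<Sum>n<N. real (Suc n) * pr n) = (\<Sum>n<N. 1 - (\<Sum>k<n. pr k)) - real N * (1 - (\<Sum>k<N. pr k))" for N
    by (induction N) (simp_all add: algebra_simps)
  have "(\<lambda>N. real N * (1 - (\<Sum>k<N. pr k))) \<longlonglongrightarrow> 0"
  proof (rule Lim_null_comparison)
    have "(\<lambda>N. real N * \<delta> ^ N) \<longlonglongrightarrow> 0" using powser_times_n_limit_0[of \<delta>] g by simp
    then have "(\<lambda>N. C * (real N * \<delta> ^ N)) \<longlonglongrightarrow> C * 0" by (rule tendsto_mult_left)
    then show "(\<lambda>N. C * (real N * \<delta> ^ N)) \<longlonglongrightarrow> 0" by simp
    have "norm (real N * (1 - (\<Sum>k<N. pr k))) \<le> C * (real N * \<delta> ^ N)" for N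
    proof -
      have X: "(shift ^^ N) q \<in> X" by (rule X_shift_pow[OF q_in])
      have h: "0 \<le> H N t q / \<kappa> ^ N" using H_pos[of N t q] \<kappa>_pos by simp
      have "H N t q / \<kappa> ^ N * G ((shift ^^ N) q) \<le> C * \<delta> ^ N * 1"
        using g(4)[OF q_in, of N] G_le1[OF X] \<nu>_ind(2)[OF X] h g by (intro mult_mono) auto
      moreover have "0 \<le> H N t q / \<kappa> ^ N * G ((shift ^^ N) q)" using h \<nu>_ind(2)[OF X] by (rule mult_nonneg_nonneg)
      ultimately show ?thesis
        using mult_left_mono[of "1 - (\<Sum>k<N. pr k)" "C * \<delta> ^ N" "real N"] unfolding G_tail by (simp add: abs_mult mult_ac)
    qed
    then show "eventually (\<lambda>N. norm (real N * (1 - (\<Sum>k<N. pr k))) \<le> C * (real N * \<delta> ^ N)) sequentially"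
      by (intro always_eventually allI)
  qed
  then have "(\<lambda>N. \<Sum>n<N. real (Suc n) * pr n) \<longlonglongrightarrow> L - 0"
    unfolding part using tail_sums[unfolded sums_def] by (intro tendsto_diff)
  then have "(\<lambda>n. real (Suc n) * pr n) sums L" by (simp add: sums_def)
  then show ?thesis unfolding norm_const_def pr_def by (simp add: sums_iff mult.assoc)
qed

section \<open>Simplicity and the other eigenvalues\<close>

lemma \<nu>_eigfun: "\<nu> (cls \<beta> (eigfun \<beta> t (of_real \<kappa>))) = of_real L"
proof -
  have "(\<lambda>n. of_real (H n t q) / of_real \<kappa> ^ n * \<nu> (cls \<beta> (ind ((shift ^^ n) q)))) sums \<nu> (cls \<beta> (eigfun \<beta> t (of_real \<kappa>)))"
    by (rule dual_series[OF \<nu>_dual eigfun_coeff_summable[OF r_less_norm] eigfun_series X_shift_pow[OF q_in]])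
  moreover have "of_real (H n t q) / of_real \<kappa> ^ n * \<nu> (cls \<beta> (ind ((shift ^^ n) q))) = of_real (1 - (\<Sum>k<n. pr k))" for n
    unfolding G_tail[symmetric] using \<nu>_ind(1)[OF X_shift_pow[OF q_in, of n]] by simp
  ultimately have "(\<lambda>n. of_real (1 - (\<Sum>k<n. pr k))) sums \<nu> (cls \<beta> (eigfun \<beta> t (of_real \<kappa>)))" by simp
  moreover have "(\<lambda>n. of_real (1 - (\<Sum>k<n. pr k))) sums (of_real L :: complex)"
    using tail_sums by (subst sums_of_real_iff)
  ultimately show ?thesis using sums_unique2 by blast
qed

lemma eigfun_not_null: "eigfun \<beta> t (of_real \<kappa>) \<notin> null"
proof
  assume "eigfun \<beta> t (of_real \<kappa>) \<in> null"
  then have "cls \<beta> (eigfun \<beta> t (of_real \<kappa>)) = cls \<beta> (\<lambda>x. 0 * 0)" by (simp add: cls_eq_iff)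
  then show False using dual_cmult[OF \<nu>_dual FF_zero, of 0] \<nu>_eigfun L_pos by simp
qed

text \<open>If \<open>shifted_op\<close> sends \<open>u\<close> to \<open>c\<close> times the
  eigenfunction, applying \<open>\<nu>\<close> gives \<open>0 = c * L\<close>, hence
  \<open>c = 0\<close>. So there is no Jordan chain of length 2.\<close>

lemma simple: "has_dim \<beta> (gen_eigenspace \<beta> t (of_real \<kappa>)) 1"
proof -
  let ?S = "shifted_op \<beta> t (of_real \<kappa>)"
  have FS: "\<exists>g\<in>FF. ?S (cls \<beta> f) = cls \<beta> g" if "f \<in> FF" for f
    unfolding shifted_op_cls using FF_diff[OF FF_cmult[OF that] T_FF[OF that]] by blast
  have eig: "eigenspace \<beta> t (of_real \<kappa>) = {cls \<beta> (\<lambda>x. c * eigfun \<beta> t (of_real \<kappa>) x) | c. True}"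
    by (rule eigenspace_eq[OF r_less_norm root])
  have step: "u \<in> eigenspace \<beta> t (of_real \<kappa>)" if u: "u \<in> F_space \<beta>" and S: "?S u \<in> eigenspace \<beta> t (of_real \<kappa>)" for u
  proof -
    obtain f where f: "f \<in> FF" "u = cls \<beta> f" using u unfolding F_space_cls by blast
    obtain c where c: "?S u = cls \<beta> (\<lambda>x. c * eigfun \<beta> t (of_real \<kappa>) x)" using S unfolding eig by blast
    have "\<nu> (?S u) = of_real \<kappa> * \<nu> (cls \<beta> f) - \<nu> (cls \<beta> (T f))"
      unfolding f(2) shifted_op_cls using dual_diff[OF \<nu>_dual FF_cmult[OF f(1)] T_FF[OF f(1)]] dual_cmult[OF \<nu>_dual f(1)] by simp
    also have "\<nu> (cls \<beta> (T f)) = of_real \<kappa> * \<nu> (cls \<beta> f)"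
      using eigf u unfolding eigenfunctional_def f(2) transfer_cls[symmetric] by blast
    finally have "c * of_real L = 0"
      using c dual_cmult[OF \<nu>_dual eigfun_FF[OF r_less_norm]] \<nu>_eigfun by simp
    then have "c = 0" using L_pos by simp
    then have "?S u = B_zero \<beta>" using c by (simp add: B_zero_def)
    then show ?thesis using u by (simp add: eigenspace_def)
  qed
  have "u \<in> eigenspace \<beta> t (of_real \<kappa>)" if "u \<in> F_space \<beta>" "(?S ^^ k) u = B_zero \<beta>" for u k
    using that
  proof (induction k arbitrary: u)
    case 0
    show ?case using 0 unfolding eig B_zero_def by (auto intro!: exI[of _ 0])
  next
    case (Suc k)
    have SF: "?S u \<in> F_space \<beta>" using FS Suc.prems(1) unfolding F_space_cls by blast
    have "(?S ^^ k) (?S u) = B_zero \<beta>" using Suc.prems(2) by (simp add: funpow_swap1)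
    then show ?case using Suc.IH[OF SF] step[OF Suc.prems(1)] by blast
  qed
  moreover have "(?S ^^ 1) u = B_zero \<beta>" "u \<in> F_space \<beta>" if "u \<in> eigenspace \<beta> t (of_real \<kappa>)" for u
    using that by (auto simp: eigenspace_def)
  ultimately have "gen_eigenspace \<beta> t (of_real \<kappa>) = eigenspace \<beta> t (of_real \<kappa>)"
    unfolding gen_eigenspace_def by blast
  then show ?thesis using has_dim_line[OF eigfun_not_null eig] by simp
qed

text \<open>Scaling \<open>z\<close> by \<open>\<kappa>\<close> turns the coefficients into the
  probability vector \<open>pr\<close>, to which \<open>renewal_root_unique\<close> applies.\<close>

lemma root_modulus:
  assumes "z \<noteq> inverse (of_real \<kappa>)" "(\<lambda>n. of_nat (q n) * of_real (H n t q) * z ^ Suc n) sums 1"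
  shows "1 / \<kappa> < cmod z"
proof (rule ccontr)
  assume le: "\<not> 1 / \<kappa> < cmod z"
  define w where "w = z * of_real \<kappa>"
  have w: "cmod w \<le> 1" using le \<kappa>_pos by (simp add: w_def norm_mult field_simps)
  have w1: "w \<noteq> 1" using assms(1) \<kappa>_pos by (auto simp: w_def field_simps)
  have p0: "0 < pr 0" using pr0 \<kappa>_pos by simp
  have "of_nat (q n) * of_real (H n t q) * z ^ Suc n = of_real (pr n) * w ^ Suc n" for n
    using \<kappa>_pos by (simp add: pr_def w_def power_mult_distrib)
  then have "(\<lambda>n. of_real (pr n) * w ^ Suc n) sums 1" using assms(2) by (simp only:)
  from renewal_root_unique[OF pr_nonneg pr_sums p0 w w1 this] show False by simp
qed

lemma other_eigenvalue:
  assumes "eigenfunctions \<beta> t l \<noteq> {}" "r_rad \<beta> t < cmod l" "l \<noteq> of_real \<kappa>"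
  shows "cmod l < \<kappa>"
proof -
  have l0: "l \<noteq> 0" using assms(2) r_rad_ge1 by auto
  have "(\<lambda>n. of_nat (q n) * of_real (H n t q) * inverse l ^ Suc n) sums 1"
    using psi_sums[OF assms(2) q_in] eigenvalue_root(1)[OF assms(2,1)] by (simp add: field_simps)
  moreover have "inverse l \<noteq> inverse (of_real \<kappa>)" using assms(3) by simp
  ultimately have "1 / \<kappa> < cmod (inverse l)" by (rule root_modulus[rotated])
  then have "1 / \<kappa> < inverse (cmod l)" by (simp only: norm_inverse)
  then show ?thesis using \<kappa>_pos l0 by (simp add: field_simps)
qed

section \<open>Zeros of 1 - phi and the constant alpha\<close>

lemma phi_sums:
  assumes "ereal (cmod z) < conv_radius (phi_coeff \<beta> t)"
  shows "(\<lambda>n. of_nat (q n) * of_real (H n t q) * z ^ Suc n) sums phi \<beta> t z"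
proof -
  have "(\<lambda>n. phi_coeff \<beta> t n * z ^ n) sums phi \<beta> t z"
    unfolding phi_def by (rule summable_sums[OF summable_in_conv_radius[OF assms]])
  then have "(\<lambda>n. phi_coeff \<beta> t (Suc n) * z ^ Suc n) sums phi \<beta> t z"
    by (subst sums_Suc_iff) (simp add: phi_coeff_def)
  then show ?thesis by (simp add: phi_coeff_def)
qed

lemma other_moduli_less: assumes "r \<in> other_moduli \<beta> t \<kappa>" shows "r < \<kappa>"
proof -
  obtain l where l: "r = cmod l" "ereal (cmod (inverse l)) < conv_radius (phi_coeff \<beta> t)"
    "phi \<beta> t (inverse l) = 1" "l \<noteq> of_real \<kappa>" using assms unfolding other_moduli_def by auto
  show ?thesis
  proof (cases "l = 0")
    case False
    have "inverse l \<noteq> inverse (of_real \<kappa>)" using l(4) by simp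
    then have "1 / \<kappa> < cmod (inverse l)" using root_modulus phi_sums[OF l(2)] l(3) by simp
    then have "1 / \<kappa> < inverse (cmod l)" by (simp only: norm_inverse)
    then show ?thesis using \<kappa>_pos False l(1) by (simp add: field_simps)
  qed (use l \<kappa>_pos in simp)
qed

text \<open>Moduli of at least \<open>r0\<close> come from zeros in a compact disc inside the disc
  of convergence, where a nonconstant holomorphic function has only finitely many. It is nonconstant
  because \<open>phi\<close> is 0 at 0 and 1 at the given root.\<close>

lemma other_moduli_Greatest:
  assumes "other_moduli \<beta> t \<kappa> \<noteq> {}" shows "(GREATEST r. r \<in> other_moduli \<beta> t \<kappa>) \<in> other_moduli \<beta> t \<kappa>"
proof -
  let ?M = "other_moduli \<beta> t \<kappa>" and ?R = "conv_radius (phi_coeff \<beta> t)"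
  obtain r0 where r0: "r0 \<in> ?M" using assms by blast
  then obtain l0 where l0: "r0 = cmod l0" "ereal (cmod (inverse l0)) < ?R" "phi \<beta> t (inverse l0) = 1"
    unfolding other_moduli_def by auto
  have phi0: "phi \<beta> t 0 = 0" unfolding phi_def by (subst powser_zero) (simp add: phi_coeff_def)
  have l0n: "l0 \<noteq> 0" using l0(3) phi0 by auto
  have hol: "(\<lambda>z. phi \<beta> t z - 1) holomorphic_on eball 0 ?R"
  proof -
    have "eval_fps (Abs_fps (phi_coeff \<beta> t)) holomorphic_on eball 0 ?R"
      by (rule holomorphic_on_eval_fps) (simp add: fps_conv_radius_def)
    moreover have "eval_fps (Abs_fps (phi_coeff \<beta> t)) = phi \<beta> t" by (simp add: fun_eq_iff eval_fps_def phi_def)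
    ultimately show ?thesis by (auto intro!: holomorphic_intros)
  qed
  have nc: "\<not> (\<lambda>z. phi \<beta> t z - 1) constant_on eball 0 ?R"
  proof
    assume "(\<lambda>z. phi \<beta> t z - 1) constant_on eball 0 ?R"
    then obtain c where c: "\<And>z. z \<in> eball 0 ?R \<Longrightarrow> phi \<beta> t z - 1 = c" unfolding constant_on_def by blast
    have in0: "0 \<in> eball 0 ?R" "inverse l0 \<in> eball 0 ?R" using l0(2) le_less_trans[of 0 "ereal (cmod (inverse l0))" ?R]
      by (auto simp: in_eball_iff zero_ereal_def)
    show False using c[OF in0(1)] c[OF in0(2)] phi0 l0(3) by simp
  qed
  have fin: "finite {z \<in> cball 0 (cmod (inverse l0)). phi \<beta> t z - 1 = 0}"
  proof (rule holomorphic_compact_finite_zeros[OF hol open_eball])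
    show "connected (eball 0 ?R :: complex set)" by (rule connected_eball)
    show "cball 0 (cmod (inverse l0)) \<subseteq> (eball 0 ?R :: complex set)"
    proof
      fix x :: complex assume "x \<in> cball 0 (cmod (inverse l0))"
      then have "ereal (dist 0 x) \<le> ereal (cmod (inverse l0))" by simp
      then show "x \<in> eball 0 ?R" using le_less_trans[OF _ l0(2)] by simp
    qed
  qed (use nc in auto)
  have "{r \<in> ?M. r0 \<le> r} \<subseteq> (\<lambda>z. cmod (inverse z)) ` {z \<in> cball 0 (cmod (inverse l0)). phi \<beta> t z - 1 = 0}"
  proof
    fix r assume "r \<in> {r \<in> ?M. r0 \<le> r}"
    then obtain l where l: "r = cmod l" "r0 \<le> cmod l" "phi \<beta> t (inverse l) = 1" unfolding other_moduli_def by auto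
    have "0 < cmod l0" using l0n by simp
    then have "cmod (inverse l) \<le> cmod (inverse l0)" using l(2) l0(1) by (simp add: norm_inverse le_imp_inverse_le)
    then show "r \<in> (\<lambda>z. cmod (inverse z)) ` {z \<in> cball 0 (cmod (inverse l0)). phi \<beta> t z - 1 = 0}"
      using l by (intro image_eqI[of _ _ "inverse l"]) auto
  qed
  then have finM: "finite {r \<in> ?M. r0 \<le> r}" using fin finite_surj by blast
  have neM: "{r \<in> ?M. r0 \<le> r} \<noteq> {}" using r0 by auto
  define m where "m = Max {r \<in> ?M. r0 \<le> r}"
  have m: "m \<in> ?M" "r0 \<le> m" using Max_in[OF finM neM] by (auto simp: m_def)
  have "r \<le> m" if "r \<in> ?M" for r
    using Max_ge[OF finM, of r] that m by (cases "r0 \<le> r") (auto simp: m_def)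
  then have "(GREATEST r. r \<in> ?M) = m" using m(1) by (intro Greatest_equality)
  then show ?thesis using m by simp
qed

lemma alpha_bounds: "r_rad \<beta> t \<le> alpha \<beta> t \<kappa>" "alpha \<beta> t \<kappa> < \<kappa>"
  unfolding alpha_def using r_less_\<kappa> other_moduli_less[OF other_moduli_Greatest] by auto

end

context positive_pair begin

section \<open>The eigenmeasure\<close>

text \<open>The range of the right branch ends at
  \<open>(\<kappa> - 1) / exp t = G (shift q) \<le> 1\<close>.\<close>

sublocale pl: piecewise_linear \<kappa> "exp t"
proof
  show "1 < \<kappa>" by (rule \<kappa>_gt1)
  have "exp t * G (shift q) \<le> exp t * 1" by (intro mult_left_mono G_le1 X_shift q_in) auto
  then show "\<kappa> - 1 \<le> exp t" using G_rec1[OF q_in q0] G_q by simp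
qed simp

text \<open>The inverse of \<open>G\<close>, that is the quantile function of the eigenmeasure.
  Rates of decay called \<open>\<theta>\<close> in other statements are unrelated bound
  variables.\<close>

definition \<theta> :: "real \<Rightarrow> digits" where "\<theta> = coding \<kappa> (exp t)"

lemma G_pos: assumes "a \<in> X1" shows "0 < G a"
proof -
  obtain i where i: "a i = 1" using assms by (auto simp: X1_def)
  have "0 < (\<Sum>n. real (a n) * H n t a / \<kappa> ^ Suc n)"
  proof (rule suminf_pos2[OF sums_summable[OF G_sums[OF X1_X[OF assms]]]])
    show "0 \<le> real (a n) * H n t a / \<kappa> ^ Suc n" for n using H_pos[of n t a] \<kappa>_pos by simp
    show "0 < real (a i) * H i t a / \<kappa> ^ Suc i" using H_pos[of i t a] \<kappa>_pos i by simp
  qed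
  then show ?thesis using sums_unique[OF G_sums[OF X1_X[OF assms]]] by simp
qed

text \<open>The recursion of \<open>G\<close> inverts the two branches, and strict positivity of
  \<open>G\<close> on \<open>X1\<close> decides the digit.\<close>

lemma branch_G:
  assumes "a \<in> X1"
  shows "branch \<kappa> (exp t) (G a) = G (shift a)" "G a \<le> 1 / \<kappa> \<longleftrightarrow> a 0 = 0"
proof -
  have s: "0 < G (shift a)" "G (shift a) \<le> 1" using assms G_pos G_le1 X1_X X1_shift by auto
  consider "a 0 = 0" | "a 0 = 1" using X_digit[OF X1_X[OF assms], of 0] by auto
  then have "branch \<kappa> (exp t) (G a) = G (shift a) \<and> (G a \<le> 1 / \<kappa> \<longleftrightarrow> a 0 = 0)"
  proof cases
    case 1
    then have e: "\<kappa> * G a = G (shift a)" using G_rec0 X1_X assms by blast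
    then have "G a \<le> 1 / \<kappa>" using s \<kappa>_pos by (simp add: field_simps)
    then show ?thesis using e 1 by (simp add: branch_left)
  next
    case 2
    then have e: "\<kappa> * G a = 1 + exp t * G (shift a)" using G_rec1 X1_X assms by blast
    moreover have "0 < exp t * G (shift a)" using s by simp
    ultimately have "1 < \<kappa> * G a" by linarith
    then have "\<not> G a \<le> 1 / \<kappa>" using \<kappa>_pos by (simp add: field_simps)
    then show ?thesis using e 2 by (simp add: branch_right)
  qed
  then show "branch \<kappa> (exp t) (G a) = G (shift a)" "G a \<le> 1 / \<kappa> \<longleftrightarrow> a 0 = 0" by auto
qed

lemma \<theta>_G: assumes "a \<in> X1" shows "\<theta> (G a) = a"
proof
  fix i
  have *: "(branch \<kappa> (exp t) ^^ n) (G a) = G ((shift ^^ n) a)" for n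
    by (induction n) (simp_all add: branch_G X1_shift_pow[OF assms])
  have "a i \<in> {0,1}" using X_digit X1_X assms by blast
  then show "\<theta> (G a) i = a i"
    using branch_G(2)[OF X1_shift_pow[OF assms, of i]] by (auto simp: \<theta>_def coding_def * shift_pow)
qed

lemma \<theta>_in: assumes "u \<in> {0<..1}" shows "\<theta> u \<in> X1"
proof -
  have q1: "\<theta> 1 = q" using \<theta>_G[OF q_in1] G_q by simp
  have "(shift ^^ n) (\<theta> u) \<preceq> q" for n
    unfolding q1[symmetric] \<theta>_def shift_coding using pl.branch_pow_in[OF assms, of n]
    by (intro pl.coding_mono) simp
  then show ?thesis using pl.coding_infinite_ones[OF assms] coding_digit
    by (auto simp: X1_def beta_shift_def \<theta>_def simp del: insert_iff)
qed

lemma \<theta>_branch: "shift (\<theta> u) = \<theta> (branch \<kappa> (exp t) u)" and \<theta>_head: "\<theta> u 0 = (if u \<le> 1 / \<kappa> then 0 else 1)"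
  using shift_coding[of 1 \<kappa> "exp t" u] by (simp_all add: \<theta>_def coding_def)

text \<open>\<open>u\<close> and \<open>G (\<theta> u)\<close> obey the same affine recursion, so
  their difference is a weight over \<open>\<kappa> ^ n\<close> times a difference of modulus at
  most 1. The right branch may have slope below 1, hence the uniform growth bound instead of
  expansion at each step.\<close>

lemma G_\<theta>: assumes "u \<in> {0<..1}" shows "G (\<theta> u) = u"
proof -
  define v where "v n = (branch \<kappa> (exp t) ^^ n) u" for n
  have v: "v n \<in> {0<..1}" for n unfolding v_def by (rule pl.branch_pow_in[OF assms])
  have sv: "(shift ^^ n) (\<theta> u) = \<theta> (v n)" for n by (simp add: \<theta>_def shift_coding v_def)
  define d where "d n = v n - G (\<theta> (v n))" for n
  have rec: "d n = exp (t * real (\<theta> u n)) * d (Suc n) / \<kappa>" for n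
  proof -
    have X: "\<theta> (v n) \<in> X" using \<theta>_in[OF v] X1_X by blast
    have dig: "\<theta> (v n) 0 = \<theta> u n" unfolding sv[symmetric] by (simp add: shift_pow)
    have sh: "shift (\<theta> (v n)) = \<theta> (v (Suc n))" unfolding \<theta>_branch by (simp add: v_def)
    have "\<kappa> * v n = real (\<theta> u n) + exp (t * real (\<theta> u n)) * v (Suc n)"
    proof -
      have "real (\<theta> u n) = (if v n \<le> 1 / \<kappa> then 0 else 1)" using \<theta>_head[of "v n"] dig by simp
      then show ?thesis by (cases "v n \<le> 1 / \<kappa>") (simp_all add: v_def branch_left branch_right)
    qed
    moreover have "\<kappa> * G (\<theta> (v n)) = real (\<theta> u n) + exp (t * real (\<theta> u n)) * G (\<theta> (v (Suc n)))"
      using G_rec[OF X] dig sh by simp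
    ultimately have "\<kappa> * d n = exp (t * real (\<theta> u n)) * d (Suc n)" by (simp add: d_def algebra_simps)
    then show ?thesis using \<kappa>_pos by (simp add: field_simps)
  qed
  have d0: "d 0 = H n t (\<theta> u) / \<kappa> ^ n * d n" for n
  proof (induction n)
    case (Suc n) then show ?case unfolding rec[of n] by (simp add: H_Suc_right mult_ac)
  qed simp
  obtain C \<delta> where g: "C > 0" "0 < \<delta>" "\<delta> < 1" "\<And>n x. x \<in> X \<Longrightarrow> H n t x / \<kappa> ^ n \<le> C * \<delta> ^ n"
    by (rule growth_pair) blast
  have le: "norm (d 0) \<le> C * \<delta> ^ n" for n
  proof -
    have X: "\<theta> (v n) \<in> X" "\<theta> u \<in> X" using \<theta>_in[OF v] \<theta>_in[OF assms] X1_X by auto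
    have "\<bar>d n\<bar> \<le> 1" using v[of n] \<nu>_ind(2)[OF X(1)] G_le1[OF X(1)] by (auto simp: d_def abs_le_iff)
    moreover have "0 \<le> H n t (\<theta> u) / \<kappa> ^ n" using H_pos[of n t "\<theta> u"] \<kappa>_pos by simp
    ultimately have "H n t (\<theta> u) / \<kappa> ^ n * \<bar>d n\<bar> \<le> C * \<delta> ^ n * 1" using g(4)[OF X(2), of n] g by (intro mult_mono) auto
    then show ?thesis using d0[of n] H_pos[of n t "\<theta> u"] \<kappa>_pos by (simp add: abs_mult)
  qed
  have "(\<lambda>n. C * \<delta> ^ n) \<longlonglongrightarrow> C * 0" using g by (intro tendsto_mult_left LIMSEQ_power_zero) auto
  then have "norm (d 0) \<le> C * 0" using le by (intro LIMSEQ_le_const) auto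
  then show ?thesis by (simp add: d_def v_def)
qed

lemma G_zero: "G zero_seq = 0"
  using sums_unique[OF G_sums[OF zero_in]] by (simp add: zero_seq_def)

text \<open>A point outside \<open>X1\<close> is replaced by its lower representative, which has the
  same value of \<open>G\<close>; for \<open>zero_seq\<close> this value is 0.\<close>

lemma \<theta>_le_iff:
  assumes "a \<in> X" "u \<in> {0<..1}" shows "\<theta> u \<preceq> a \<longleftrightarrow> u \<le> G a"
proof
  assume "\<theta> u \<preceq> a"
  then show "u \<le> G a" using G_mono[OF X1_X[OF \<theta>_in[OF assms(2)]] assms(1)] G_\<theta>[OF assms(2)] by simp
next
  have *: "\<theta> u \<preceq> b" if "b \<in> X1" "u \<le> G b" for b
    using pl.coding_mono[OF that(2)] \<theta>_G[OF that(1)] by (simp add: \<theta>_def)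
  assume u: "u \<le> G a"
  show "\<theta> u \<preceq> a"
  proof (cases "a \<in> X1")
    case False
    have "a \<noteq> zero_seq" using u assms(2) G_zero by auto
    then obtain a' where a': "a' \<in> X1" "(\<lambda>x. ind a x - ind a' x) \<in> null" "less_fun a' a"
      using ind_lower_representative[OF assms(1) False] by blast
    have "G a = G a'" using cls_eqI[OF a'(2)] by (simp add: G_def)
    then have "\<theta> u \<preceq> a'" using *[OF a'(1)] u by simp
    then show ?thesis using a'(3) lex.order_trans lex.less_imp_le by blast
  qed (use * u in blast)
qed

definition U :: "real measure" where "U = restrict_space lborel {0<..1}"
definition m :: "digits measure" where "m = distr U (restrict_space borel X) \<theta>"

lemma space_U [simp]: "space U = {0<..1}" by (simp add: U_def space_restrict_space)
lemma sets_m: "sets m = sets (restrict_space borel X)" by (simp add: m_def)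
lemma space_m [simp]: "space m = X" by (simp add: m_def space_restrict_space)

lemma \<theta>_measurable: "\<theta> \<in> measurable U (restrict_space borel X)"
proof (rule measurable_restrict_space2)
  show "\<theta> \<in> space U \<rightarrow> X" using \<theta>_in X1_X by auto
  have b: "(branch \<kappa> (exp t) ^^ i) \<in> borel_measurable borel" for i
  proof (induction i)
    case (Suc i)
    have "branch \<kappa> (exp t) \<in> borel_measurable borel" unfolding branch_def[abs_def] by measurable
    from measurable_compose[OF Suc this] show ?case by (simp add: o_def)
  qed simp
  have "(\<lambda>u. \<theta> u i) \<in> borel_measurable borel" for i
    unfolding \<theta>_def coding_def using b[of i] by measurable
  then have "\<theta> \<in> borel_measurable borel" by (rule measurable_coordinatewise_then_product)
  then show "\<theta> \<in> borel_measurable U" unfolding U_def by (intro measurable_restrict_space1) simp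
qed

lemma \<theta>_measurable_m: "\<theta> \<in> measurable U m"
  using \<theta>_measurable by (simp add: m_def cong: measurable_cong_sets)

lemma emeasure_U: "A \<in> sets borel \<Longrightarrow> A \<subseteq> {0<..1} \<Longrightarrow> emeasure U A = emeasure lborel A"
  unfolding U_def by (rule emeasure_restrict_space) auto

lemma prob_m: "prob_space m"
proof -
  have "prob_space U"
    by (rule prob_spaceI) (simp add: emeasure_U)
  then show ?thesis unfolding m_def by (rule prob_space.prob_space_distr[OF _ \<theta>_measurable])
qed

sublocale pm: prob_space m by (rule prob_m)

section \<open>Measurability and null sets\<close>

lemma coord_measurable: "(\<lambda>x. x i) \<in> measurable m (count_space UNIV)"
proof -
  have "(\<lambda>x::digits. x i) \<in> measurable borel borel" by (rule measurable_product_coordinates)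
  then have "(\<lambda>x::digits. x i) \<in> measurable (restrict_space borel X) borel" by (rule measurable_restrict_space1)
  moreover have "measurable m (count_space UNIV) = measurable (restrict_space borel X) (borel :: nat measure)"
    by (rule measurable_cong_sets) (simp_all add: sets_m sets_borel_eq_count_space)
  ultimately show ?thesis by simp
qed

lemma le_measurable: "Measurable.pred m (\<lambda>x. x \<preceq> a)"
proof -
  note [measurable] = coord_measurable
  have "Measurable.pred m (\<lambda>x. \<not> (\<exists>k. a k < x k \<and> (\<forall>j\<in>{..<k}. a j = x j)))" by measurable
  moreover have "(x \<preceq> a) = (\<not> (\<exists>k. a k < x k \<and> (\<forall>j\<in>{..<k}. a j = x j)))" for x
    unfolding lex.not_less[symmetric] less_fun_def by auto
  ultimately show ?thesis by simp
qed

lemma ival_eq: "ival \<beta> zero_seq a = {x \<in> space m. x \<preceq> a}"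
  by (auto simp: ival_def zero_seq_le)

lemma ival_sets: "ival \<beta> zero_seq a \<in> sets m"
  unfolding ival_eq by (rule predE[OF le_measurable])

lemma singleton_sets: assumes "x \<in> X" shows "{x} \<in> sets m"
proof -
  note [measurable] = coord_measurable
  have "{y \<in> space m. \<forall>i. y i = x i} \<in> sets m" by measurable
  moreover have "{y \<in> space m. \<forall>i. y i = x i} = {x}" using assms by (auto simp: fun_eq_iff)
  ultimately show ?thesis by simp
qed

lemma emeasure_m: "A \<in> sets m \<Longrightarrow> emeasure m A = emeasure U (\<theta> -` A \<inter> {0<..1})"
  unfolding m_def using emeasure_distr[OF \<theta>_measurable, of A] by simp

lemma \<theta>_vimage_borel: "A \<in> sets m \<Longrightarrow> \<theta> -` A \<inter> {0<..1} \<in> sets borel"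
proof -
  assume "A \<in> sets m"
  from measurable_sets[OF \<theta>_measurable_m this] have "\<theta> -` A \<inter> {0<..1} \<in> sets U" by simp
  then show ?thesis unfolding U_def by (subst (asm) sets_restrict_space_iff) auto
qed

lemma m_ival: assumes "a \<in> X" shows "emeasure m (ival \<beta> zero_seq a) = ennreal (G a)"
proof -
  have "\<theta> -` ival \<beta> zero_seq a \<inter> {0<..1} = {0<..G a}"
    using \<theta>_le_iff[OF assms] \<theta>_in X1_X G_le1[OF assms] by (fastforce simp: ival_eq)
  moreover have "emeasure U {0<..G a} = emeasure lborel {0<..G a}"
    using G_le1[OF assms] by (intro emeasure_U) auto
  ultimately show ?thesis using \<nu>_ind(2)[OF assms] by (simp add: emeasure_m[OF ival_sets])
qed

text \<open>\<open>G\<close> is a left inverse of \<open>\<theta>\<close>, so a fibre has at most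
  one point. It follows that countable sets are null and that integrals depend on classes
  only.\<close>

lemma singleton_null: assumes "x \<in> X" shows "{x} \<in> null_sets m"
proof -
  have "\<theta> -` {x} \<inter> {0<..1} \<subseteq> {G x}" using G_\<theta> by auto
  then have "emeasure lborel (\<theta> -` {x} \<inter> {0<..1}) \<le> emeasure lborel {G x}" by (intro emeasure_mono) auto
  then have "emeasure m {x} = 0"
    using emeasure_m[OF singleton_sets[OF assms]] emeasure_U[OF \<theta>_vimage_borel[OF singleton_sets[OF assms]]] by simp
  then show ?thesis using singleton_sets[OF assms] by (intro null_setsI)
qed

lemma countable_null: assumes "countable N" "N \<subseteq> X" shows "N \<in> null_sets m"
proof -
  have "(\<Union>x\<in>N. {x}) \<in> null_sets m" using assms singleton_null by (intro null_sets_UN') auto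
  then show ?thesis by simp
qed

lemma ind_measurable: "ind a \<in> borel_measurable m"
  unfolding ind_def using ival_sets by (rule borel_measurable_indicator)

lemma comb_measurable: "comb G' f z \<Longrightarrow> f \<in> borel_measurable m"
  by (induction rule: comb.induct) (auto intro!: borel_measurable_add borel_measurable_times ind_measurable)

lemma FF_measurable:
  assumes f: "f \<in> FF" shows "f \<in> borel_measurable m"
proof -
  have "\<exists>s w. comb (\<lambda>_. 0) s w \<and> Nm (\<lambda>x. f x - s x) < 1 / real (Suc n)" for n
    by (rule FF_approx[OF f, of "1 / real (Suc n)" "\<lambda>_. 0"]) auto
  then obtain s w where s: "\<And>n. comb (\<lambda>_. 0) (s n) (w n)" "\<And>n. Nm (\<lambda>x. f x - s n x) < 1 / real (Suc n)"
    by metis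
  have B: "(\<lambda>x. f x - s n x) \<in> bv" for n using BV_diff FF_BV f comb_BV s(1) by blast
  have "\<exists>g. g \<in> cls \<beta> (\<lambda>x. f x - s n x) \<and> g \<in> bv \<and> BVn g < 1 / real (Suc n)" for n
    by (rule Nm_approx[OF B[of n] s(2)]) blast
  then obtain g where g: "\<And>n. g n \<in> cls \<beta> (\<lambda>x. f x - s n x)" "\<And>n. g n \<in> bv" "\<And>n. BVn (g n) < 1 / real (Suc n)"
    by metis
  define N where "N = (\<Union>n. {x \<in> X. g n x - (f x - s n x) \<noteq> 0})"
  have cN: "countable N" "N \<subseteq> X" unfolding N_def
    using null_countable[OF g(1)[unfolded cls_iff]] by (auto intro!: countable_UN)
  \<comment> \<open>Changing the approximants to \<open>f\<close> on the countable set
    \<open>N\<close> keeps them measurable and makes the convergence hold at every point.\<close>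
  define h where "h n x = (if x \<in> N then f x else s n x)" for n x
  have hm: "h n \<in> borel_measurable m" for n
    by (rule measurable_discrete_difference[OF comb_measurable[OF s(1)[of n]] cN(1)])
      (use cN singleton_sets in \<open>auto simp: h_def\<close>)
  show ?thesis
  proof (rule borel_measurable_LIMSEQ_metric[OF hm])
    fix x assume "x \<in> space m"
    then have x: "x \<in> X" by simp
    show "(\<lambda>n. h n x) \<longlonglongrightarrow> f x"
    proof (cases "x \<in> N")
      case False
      have le: "norm (h n x - f x) \<le> inverse (real (Suc n))" for n
      proof -
        have "f x - s n x = g n x" using x False by (auto simp: N_def)
        then have "norm (h n x - f x) = cmod (g n x)" using False by (simp add: h_def norm_minus_commute)
        then show ?thesis using BVn_sup[OF g(2) x, of n] g(3)[of n] by (simp add: inverse_eq_divide)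
      qed
      have "(\<lambda>n. h n x - f x) \<longlonglongrightarrow> 0"
        by (rule Lim_null_comparison[OF _ LIMSEQ_inverse_real_of_nat]) (rule always_eventually, rule allI, rule le)
      then show ?thesis by (rule LIM_zero_cancel)
    qed (simp add: h_def)
  qed
qed

lemma FF_bounded_ae:
  assumes "f \<in> FF" "Nm f < e" shows "AE x in m. cmod (f x) \<le> e"
proof -
  obtain g where g: "g \<in> cls \<beta> f" "g \<in> bv" "BVn g < e" by (rule Nm_approx[OF FF_BV[OF assms(1)] assms(2)])
  have "{x \<in> X. g x - f x \<noteq> 0} \<in> null_sets m" by (rule countable_null) (use null_countable[OF g(1)[unfolded cls_iff]] in auto)
  then have "AE x in m. x \<notin> {x \<in> X. g x - f x \<noteq> 0}" by (rule AE_not_in)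
  then show ?thesis
  proof (rule AE_mp, intro AE_I2 impI)
    fix x assume "x \<in> space m" "x \<notin> {x \<in> X. g x - f x \<noteq> 0}"
    then show "cmod (f x) \<le> e" using BVn_sup[OF g(2), of x] g(3) by auto
  qed
qed

lemma FF_integrable: assumes "f \<in> FF" shows "integrable m f"
  using FF_measurable[OF assms] FF_bounded_ae[OF assms, of "Nm f + 1"]
  by (intro pm.integrable_const_bound) auto

lemma FF_integral_bound: assumes "f \<in> FF" "Nm f < e" shows "cmod (\<integral>x. f x \<partial>m) \<le> e"
proof -
  have "cmod (\<integral>x. f x \<partial>m) \<le> (\<integral>x. cmod (f x) \<partial>m)" by (rule integral_norm_bound)
  also have "\<dots> \<le> (\<integral>x. e \<partial>m)"
    using FF_integrable[OF assms(1)] FF_bounded_ae[OF assms] by (intro integral_mono_AE) auto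
  finally show ?thesis using pm.prob_space by simp
qed

lemma ind_integral: assumes "a \<in> X" shows "(\<integral>x. ind a x \<partial>m) = of_real (G a)"
proof -
  have "(\<integral>x. indicator (ival \<beta> zero_seq a) x \<partial>m) = G a"
    using m_ival[OF assms] \<nu>_ind(2)[OF assms] sets.sets_into_space[OF ival_sets]
    by (simp add: measure_def Int_absorb2)
  moreover have "ind a x = of_real (indicator (ival \<beta> zero_seq a) x)" for x by (simp add: ind_def indicator_def)
  ultimately show ?thesis by (simp only: integral_complex_of_real)
qed

text \<open>Both sides are bounded on \<open>F\<close> and agree on step functions, by
  \<open>ind_integral\<close>.\<close>

lemma \<nu>_integral: assumes f: "f \<in> FF" shows "\<nu> (cls \<beta> f) = (\<integral>x. f x \<partial>m)"
proof -
  obtain C where C: "C > 0" "\<And>f. f \<in> FF \<Longrightarrow> cmod (\<nu> (cls \<beta> f)) \<le> C * Nm f" by (rule dual_bound[OF \<nu>_dual]) blast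
  have comb_int: "(\<integral>x. s x \<partial>m) = w" if "comb (\<lambda>a. \<nu> (cls \<beta> (ind a))) s w" for s w
    using that
  proof (induction rule: comb.induct)
    case (comb_Suc s w a c)
    then have i: "integrable m s" "integrable m (ind a)" "a \<in> X"
      using FF_integrable comb_FF ind_FF X1_X by auto
    then show ?case using comb_Suc.IH ind_integral[OF i(3)] \<nu>_ind(1)[OF i(3)] by simp
  qed simp
  have "cmod (\<nu> (cls \<beta> f) - (\<integral>x. f x \<partial>m)) \<le> 0 + e" if "e > 0" for e
  proof -
    have "e / (C + 1) > 0" using that C by simp
    then obtain s w where s: "comb (\<lambda>a. \<nu> (cls \<beta> (ind a))) s w" "Nm (\<lambda>x. f x - s x) < e / (C + 1)"
      by (rule FF_approx[OF f])
    have sF: "s \<in> FF" by (rule comb_FF[OF s(1)])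
    have "\<nu> (cls \<beta> s) = (\<integral>x. s x \<partial>m)" using dual_comb[OF \<nu>_dual s(1)] comb_int[OF s(1)] by simp
    then have "\<nu> (cls \<beta> f) - (\<integral>x. f x \<partial>m) = \<nu> (cls \<beta> (\<lambda>x. f x - s x)) - (\<integral>x. f x - s x \<partial>m)"
      using dual_diff[OF \<nu>_dual f sF] FF_integrable[OF f] FF_integrable[OF sF] by simp
    also have "cmod \<dots> \<le> C * Nm (\<lambda>x. f x - s x) + e / (C + 1)"
      by (intro order_trans[OF norm_triangle_ineq4] add_mono C(2) FF_integral_bound FF_diff f sF s(2))
    also have "\<dots> \<le> C * (e / (C + 1)) + e / (C + 1)" using s(2) C by (intro add_mono mult_left_mono) auto
    also have "\<dots> = (C + 1) * (e / (C + 1))" by (simp only: distrib_right mult_1)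
    also have "\<dots> = e" using C by simp
    finally show ?thesis by simp
  qed
  from field_le_epsilon[OF this] show ?thesis by simp
qed

text \<open>The mass of \<open>A\<close> below a point varies continuously with the point, so some
  initial segment carries half of it.\<close>

lemma non_atomic_m: "non_atomic m"
  unfolding non_atomic_def
proof (intro notI, elim bexE conjE)
  fix A assume A: "A \<in> sets m" "emeasure m A > 0"
    and atom: "\<forall>B\<in>sets m. B \<subseteq> A \<longrightarrow> emeasure m B = 0 \<or> emeasure m B = emeasure m A"
  define S where "S = \<theta> -` A \<inter> {0<..1}"
  have S: "S \<in> sets borel" "S \<subseteq> {0<..1}" unfolding S_def using \<theta>_vimage_borel[OF A(1)] by auto
  have fin: "emeasure lborel B < \<infinity>" if "B \<subseteq> {0<..1}" "B \<in> sets borel" for B :: "real set"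
  proof -
    have "emeasure lborel B \<le> emeasure lborel {0<..1::real}" using that by (intro emeasure_mono) auto
    then show ?thesis by (simp add: le_less_trans)
  qed
  \<comment> \<open>Transported to \<open>(0, 1]\<close> the measure is Lebesgue measure, and the
    mass up to \<open>x\<close> is 1-Lipschitz in \<open>x\<close>.\<close>
  define F where "F x = measure lborel (S \<inter> {0<..x})" for x
  have mono: "F x \<le> F y" "F y - F x \<le> y - x" if "x \<le> y" for x y
  proof -
    have "S \<inter> {0<..z} \<subseteq> {0<..1}" "S \<inter> {0<..z} \<in> sets borel" for z using S by auto
    note fin' = fin[OF this]
    have fm: "S \<inter> {0<..x} \<in> fmeasurable lborel" "S \<inter> {0<..y} \<in> fmeasurable lborel" "{x<..y} \<in> fmeasurable lborel"
      using S fin'[of x] fin'[of y] that by (auto intro!: fmeasurableI)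
    show "F x \<le> F y" unfolding F_def using fm that by (intro measure_mono_fmeasurable) auto
    have "F y \<le> measure lborel ((S \<inter> {0<..x}) \<union> {x<..y})"
      unfolding F_def using fm by (intro measure_mono_fmeasurable) auto
    also have "\<dots> \<le> F x + measure lborel {x<..y}" unfolding F_def using fm by (intro measure_Un_le) auto
    finally show "F y - F x \<le> y - x" using that by simp
  qed
  have cont: "continuous_on {0..1} F"
  proof (rule continuous_onI)
    fix x e :: real assume "e > 0"
    show "\<exists>d>0. \<forall>y\<in>{0..1}. dist y x < d \<longrightarrow> dist (F y) (F x) \<le> e"
      using \<open>e > 0\<close>
    proof (intro exI conjI ballI impI)
      fix y assume "dist y x < e"
      then show "dist (F y) (F x) \<le> e" using mono[of x y] mono[of y x]
        by (cases "x \<le> y") (auto simp: dist_real_def)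
    qed
  qed
  have F0: "F 0 = 0" by (simp add: F_def)
  have "S \<inter> {0<..1} = S" using S by auto
  then have F1: "F 1 = measure m A" unfolding F_def
    using emeasure_m[OF A(1)] emeasure_U[OF S] by (simp add: measure_def S_def)
  have pos: "measure m A > 0" using A(2) by (simp add: pm.emeasure_eq_measure)
  obtain x where x: "0 \<le> x" "x \<le> 1" "F x = measure m A / 2"
    using IVT'[of F 0 "measure m A / 2" 1] cont F0 F1 pos by auto
  have "x \<noteq> 0" using x F0 pos by auto
  then have x1: "x \<in> {0<..1}" using x by auto
  have \<theta>X: "\<theta> x \<in> X" using \<theta>_in[OF x1] X1_X by blast
  define B where "B = A \<inter> ival \<beta> zero_seq (\<theta> x)"
  have B: "B \<in> sets m" "B \<subseteq> A" using A(1) ival_sets by (auto simp: B_def)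
  have "\<theta> -` B \<inter> {0<..1} = S \<inter> {0<..x}"
    using \<theta>_le_iff[OF \<theta>X] G_\<theta>[OF x1] \<theta>_in X1_X x(2) by (fastforce simp: B_def S_def ival_eq)
  moreover have "S \<inter> {0<..x} \<subseteq> {0<..1}" using S by auto
  ultimately have "measure m B = measure m A / 2"
    using emeasure_m[OF B(1)] emeasure_U[OF \<theta>_vimage_borel[OF B(1)]] x(3) by (simp add: measure_def F_def)
  then show False using atom B pos by (auto simp: pm.emeasure_eq_measure)
qed

section \<open>The transfer operator and the eigenmeasure\<close>

lemma m_measurableI:
  assumes "\<And>i. (\<lambda>x. f x i) \<in> measurable m (count_space UNIV)" "\<And>x. x \<in> X \<Longrightarrow> f x \<in> X"
  shows "f \<in> measurable m m"
proof -
  have "f \<in> borel_measurable m"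
  proof (rule measurable_coordinatewise_then_product)
    have "measurable m (borel :: nat measure) = measurable m (count_space UNIV)"
      by (rule measurable_cong_sets) (simp_all add: sets_borel_eq_count_space)
    then show "(\<lambda>x. f x i) \<in> borel_measurable m" for i using assms(1) by simp
  qed
  then have "f \<in> measurable m (restrict_space borel X)" using assms(2) by (intro measurable_restrict_space2) auto
  then show ?thesis by (simp add: sets_m cong: measurable_cong_sets)
qed

lemma shift_measurable: "shift \<in> measurable m m"
  by (rule m_measurableI) (auto simp: shift_def coord_measurable intro: X_shift[unfolded shift_def])

lemma shift_pow_measurable: "(shift ^^ n) \<in> measurable m m"
  by (rule m_measurableI) (auto simp: shift_pow coord_measurable X_shift_pow)

text \<open>A measurable map of \<open>X\<close> into itself that agrees with
  \<open>prepend 1\<close> wherever the latter is admissible.\<close>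

definition prep1 :: "digits \<Rightarrow> digits" where "prep1 x = (if x \<preceq> shift q then prepend 1 x else q)"

lemma prep0_measurable: "prepend 0 \<in> measurable m m"
proof (rule m_measurableI)
  show "(\<lambda>x. prepend 0 x i) \<in> measurable m (count_space UNIV)" for i
    by (cases i) (auto simp: coord_measurable)
qed (rule prepend0_in)

lemma prep1_measurable: "prep1 \<in> measurable m m"
proof (rule m_measurableI)
  note [measurable] = coord_measurable le_measurable
  show "(\<lambda>x. prep1 x i) \<in> measurable m (count_space UNIV)" for i
  proof (cases i)
    case 0
    have "(\<lambda>x. if x \<preceq> shift q then 1 else q 0) \<in> measurable m (count_space UNIV)" by measurable
    then show ?thesis using 0 by (simp add: prep1_def if_distrib[of "\<lambda>y. y 0"] cong: if_cong)
  next
    case (Suc j)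
    have "(\<lambda>x. if x \<preceq> shift q then x j else q i) \<in> measurable m (count_space UNIV)" by measurable
    then show ?thesis using Suc by (simp add: prep1_def if_distrib[of "\<lambda>y. y (Suc j)"] cong: if_cong)
  qed
qed (use prepend1_in_iff q_in in \<open>auto simp: prep1_def\<close>)

lemma nn_m: "f \<in> borel_measurable m \<Longrightarrow> (\<integral>\<^sup>+x. f x \<partial>m) = (\<integral>\<^sup>+u. f (\<theta> u) * indicator {0<..1} u \<partial>lborel)"
proof -
  assume f: "f \<in> borel_measurable m"
  have "(\<integral>\<^sup>+x. f x \<partial>m) = (\<integral>\<^sup>+u. f (\<theta> u) \<partial>U)"
    unfolding m_def by (rule nn_integral_distr[OF \<theta>_measurable]) (use f in \<open>simp add: sets_m cong: measurable_cong_sets\<close>)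
  then show ?thesis unfolding U_def by (simp add: nn_integral_restrict_space)
qed

lemma comp_\<theta>_measurable:
  assumes "f \<in> borel_measurable m" shows "(\<lambda>u. f (\<theta> u) * indicator {0<..1} u :: ennreal) \<in> borel_measurable borel"
proof -
  have "(\<lambda>u. f (\<theta> u)) \<in> borel_measurable U" by (rule measurable_compose[OF \<theta>_measurable_m assms])
  then show ?thesis unfolding U_def by (subst (asm) borel_measurable_restrict_space_iff_ennreal) auto
qed

text \<open>Change of variables under the piecewise linear map, one affine substitution per branch.
  It extends the eigenvalue equation of \<open>\<nu>\<close> from \<open>F\<close> to nonnegative
  measurable functions, as correlations with an integrable \<open>g\<close> require.\<close>

lemma nn_transfer:
  assumes F: "F \<in> borel_measurable m" and w: "w \<in> borel_measurable m"
  shows "(\<integral>\<^sup>+x. F (shift x) * w x \<partial>m) =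
    (\<integral>\<^sup>+x. F x * (ennreal (1 / \<kappa>) * (w (prepend 0 x) + (if x \<preceq> shift q then ennreal (exp t) * w (prepend 1 x) else 0))) \<partial>m)"
proof -
  note [measurable] = F w shift_measurable prep0_measurable prep1_measurable le_measurable
  \<comment> \<open>The integrand splits into functions of the two images
    \<open>\<kappa> * u\<close> and \<open>(\<kappa> * u - 1) / exp t\<close>, each vanishing when
    \<open>u\<close> is not in the domain of its branch.\<close>
  define k0 :: "real \<Rightarrow> ennreal" where "k0 v = F (\<theta> v) * w (prepend 0 (\<theta> v)) * indicator {0<..1} v" for v
  define k1 :: "real \<Rightarrow> ennreal" where "k1 v = (F (\<theta> v) * (if \<theta> v \<preceq> shift q then w (prep1 (\<theta> v)) else 0)) * indicator {0<..1} v" for v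
  have k0m: "k0 \<in> borel_measurable borel" unfolding k0_def[abs_def]
    by (rule comp_\<theta>_measurable[of "\<lambda>x. F x * w (prepend 0 x)"]) measurable
  have k1m: "k1 \<in> borel_measurable borel" unfolding k1_def[abs_def]
    by (rule comp_\<theta>_measurable[of "\<lambda>x. F x * (if x \<preceq> shift q then w (prep1 x) else 0)"]) measurable
  have Gs: "G (shift q) = (\<kappa> - 1) / exp t" using G_rec1[OF q_in q0] G_q by (simp add: field_simps)
  have pt: "F (shift (\<theta> u)) * w (\<theta> u) * indicator {0<..1} u = k0 (\<kappa> * u) + k1 (- 1 / exp t + \<kappa> / exp t * u)" for u
  proof -
    have a: "- 1 / exp t + \<kappa> / exp t * u = (\<kappa> * u - 1) / exp t" by (simp add: diff_divide_distrib)
    consider "u \<le> 0" | "0 < u" "u \<le> 1 / \<kappa>" | "1 / \<kappa> < u" "u \<le> 1" | "1 < u" by linarith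
    then show ?thesis
    proof cases
      case 1
      then have "\<kappa> * u \<le> 0" using \<kappa>_pos by (simp add: mult_nonneg_nonpos)
      moreover from this have "\<not> 0 < (\<kappa> * u - 1) / exp t" by (simp add: zero_less_divide_iff)
      ultimately show ?thesis using 1 unfolding a by (simp add: k0_def k1_def indicator_def)
    next
      case 2
      have "\<kappa> * u \<le> 1" "0 < \<kappa> * u" using 2 \<kappa>_pos by (auto simp: field_simps)
      moreover from this have "\<not> 0 < (\<kappa> * u - 1) / exp t" by (simp add: zero_less_divide_iff)
      moreover have "1 / \<kappa> \<le> 1" using \<kappa>_gt1 by simp
      moreover have "shift (\<theta> u) = \<theta> (\<kappa> * u)" using 2 by (simp add: \<theta>_branch branch_left)
      moreover have "\<theta> u = prepend 0 (\<theta> (\<kappa> * u))"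
        using prepend_shift[of "\<theta> u"] 2 by (simp add: \<theta>_head \<theta>_branch branch_left)
      ultimately show ?thesis using 2 unfolding a by (simp add: k0_def k1_def indicator_def)
    next
      case 3
      define v where "v = (\<kappa> * u - 1) / exp t"
      have ku: "1 < \<kappa> * u" using 3 \<kappa>_pos by (simp add: field_simps)
      have u: "u \<in> {0<..1}" using 3 \<kappa>_pos by (auto intro: less_trans[of 0 "1 / \<kappa>"])
      have b: "branch \<kappa> (exp t) u = v" using 3 by (simp add: branch_right v_def)
      have v: "v \<in> {0<..1}" using pl.branch_in[OF u] b by simp
      have sh: "shift (\<theta> u) = \<theta> v" using b by (simp add: \<theta>_branch)
      have pr: "\<theta> u = prepend 1 (\<theta> v)"
        using prepend_shift[of "\<theta> u"] 3 b by (simp add: \<theta>_head \<theta>_branch)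
      have "\<kappa> * u \<le> \<kappa> * 1" using 3 \<kappa>_pos by (intro mult_left_mono) auto
      then have "v \<le> G (shift q)" unfolding Gs v_def by (intro divide_right_mono) auto
      then have "\<theta> v \<preceq> shift q" using \<theta>_le_iff[OF X_shift[OF q_in] v] by simp
      then have "k1 v = F (shift (\<theta> u)) * w (\<theta> u)" using v sh pr by (simp add: k1_def prep1_def)
      moreover have "k0 (\<kappa> * u) = 0" using ku by (simp add: k0_def)
      ultimately show ?thesis unfolding a v_def[symmetric] using u by simp
    next
      \<comment> \<open>Beyond 1 the right branch exceeds \<open>G (shift q)\<close>, the end of its
        range, so \<open>k1\<close> vanishes.\<close>
      case 4
      define v where "v = (\<kappa> * u - 1) / exp t"
      have ku: "\<kappa> < \<kappa> * u" using 4 \<kappa>_pos by simp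
      then have "G (shift q) < v" unfolding Gs v_def by (intro divide_strict_right_mono) auto
      then have "k1 v = 0" using \<theta>_le_iff[OF X_shift[OF q_in], of v] by (auto simp: k1_def indicator_def)
      moreover have "\<not> \<kappa> * u \<le> 1" using ku \<kappa>_gt1 by linarith
      then have "k0 (\<kappa> * u) = 0" by (simp add: k0_def)
      ultimately show ?thesis unfolding a v_def[symmetric] using 4 by simp
    qed
  qed
  have i0: "(\<integral>\<^sup>+u. k0 (\<kappa> * u) \<partial>lborel) = ennreal (1 / \<kappa>) * (\<integral>\<^sup>+v. k0 v \<partial>lborel)"
  proof -
    have "ennreal (1 / \<kappa>) * (\<integral>\<^sup>+v. k0 v \<partial>lborel) = ennreal (1 / \<kappa>) * (ennreal \<kappa> * (\<integral>\<^sup>+u. k0 (\<kappa> * u) \<partial>lborel))"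
      using nn_integral_real_affine[OF k0m, of \<kappa> 0] \<kappa>_pos by simp
    also have "\<dots> = (ennreal (1 / \<kappa>) * ennreal \<kappa>) * (\<integral>\<^sup>+u. k0 (\<kappa> * u) \<partial>lborel)" by (simp add: mult.assoc)
    also have "ennreal (1 / \<kappa>) * ennreal \<kappa> = 1" using \<kappa>_pos by (simp flip: ennreal_mult)
    finally show ?thesis by simp
  qed
  have i1: "(\<integral>\<^sup>+u. k1 (- 1 / exp t + \<kappa> / exp t * u) \<partial>lborel) = ennreal (exp t / \<kappa>) * (\<integral>\<^sup>+v. k1 v \<partial>lborel)"
  proof -
    have "ennreal (exp t / \<kappa>) * (\<integral>\<^sup>+v. k1 v \<partial>lborel) =
        ennreal (exp t / \<kappa>) * (ennreal (\<kappa> / exp t) * (\<integral>\<^sup>+u. k1 (- 1 / exp t + \<kappa> / exp t * u) \<partial>lborel))"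
      using nn_integral_real_affine[OF k1m, of "\<kappa> / exp t" "- 1 / exp t"] \<kappa>_pos by simp
    also have "\<dots> = (ennreal (exp t / \<kappa>) * ennreal (\<kappa> / exp t)) * (\<integral>\<^sup>+u. k1 (- 1 / exp t + \<kappa> / exp t * u) \<partial>lborel)"
      by (simp add: mult.assoc)
    also have "ennreal (exp t / \<kappa>) * ennreal (\<kappa> / exp t) = 1" using \<kappa>_pos by (simp flip: ennreal_mult)
    finally show ?thesis by simp
  qed
  have k0m': "(\<lambda>u. k0 (\<kappa> * u)) \<in> borel_measurable lborel" using k0m by measurable
  have k1m': "(\<lambda>u. k1 (- 1 / exp t + \<kappa> / exp t * u)) \<in> borel_measurable lborel" using k1m by measurable
  have "(\<integral>\<^sup>+x. F (shift x) * w x \<partial>m) = (\<integral>\<^sup>+u. k0 (\<kappa> * u) + k1 (- 1 / exp t + \<kappa> / exp t * u) \<partial>lborel)"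
    unfolding pt[symmetric] by (rule nn_m) measurable
  also have "\<dots> = ennreal (1 / \<kappa>) * (\<integral>\<^sup>+v. k0 v \<partial>lborel) + ennreal (exp t / \<kappa>) * (\<integral>\<^sup>+v. k1 v \<partial>lborel)"
    unfolding i0[symmetric] i1[symmetric] by (rule nn_integral_add[OF k0m' k1m'])
  also have "\<dots> = (\<integral>\<^sup>+v. ennreal (1 / \<kappa>) * k0 v + ennreal (exp t / \<kappa>) * k1 v \<partial>lborel)"
    using k0m k1m by (simp add: nn_integral_add nn_integral_cmult)
  also have "\<dots> = (\<integral>\<^sup>+v. (F (\<theta> v) * (ennreal (1 / \<kappa>) * (w (prepend 0 (\<theta> v)) +
      (if \<theta> v \<preceq> shift q then ennreal (exp t) * w (prep1 (\<theta> v)) else 0)))) * indicator {0<..1} v \<partial>lborel)"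
  proof (rule nn_integral_cong)
    fix v :: real
    have "ennreal (exp t / \<kappa>) = ennreal (1 / \<kappa>) * ennreal (exp t)" using \<kappa>_pos by (simp flip: ennreal_mult)
    then show "ennreal (1 / \<kappa>) * k0 v + ennreal (exp t / \<kappa>) * k1 v = (F (\<theta> v) * (ennreal (1 / \<kappa>) * (w (prepend 0 (\<theta> v)) +
      (if \<theta> v \<preceq> shift q then ennreal (exp t) * w (prep1 (\<theta> v)) else 0)))) * indicator {0<..1} v"
      by (simp add: k0_def k1_def distrib_left distrib_right mult_ac)
  qed
  also have "\<dots> = (\<integral>\<^sup>+x. F x * (ennreal (1 / \<kappa>) * (w (prepend 0 x) + (if x \<preceq> shift q then ennreal (exp t) * w (prep1 x) else 0))) \<partial>m)"
    by (rule nn_m[symmetric]) measurable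
  also have "\<dots> = (\<integral>\<^sup>+x. F x * (ennreal (1 / \<kappa>) * (w (prepend 0 x) + (if x \<preceq> shift q then ennreal (exp t) * w (prepend 1 x) else 0))) \<partial>m)"
    by (rule nn_integral_cong) (simp add: prep1_def)
  finally show ?thesis .
qed

text \<open>The transfer operator divided by \<open>\<kappa>\<close>, taken pointwise on real
  functions so that it applies beyond \<open>F\<close>.\<close>

definition N :: "(digits \<Rightarrow> real) \<Rightarrow> digits \<Rightarrow> real" where
  "N f x = (f (prepend 0 x) + (if x \<preceq> shift q then exp t * f (prepend 1 x) else 0)) / \<kappa>"

lemma N_nonneg: "(\<And>x. x \<in> X \<Longrightarrow> 0 \<le> f x) \<Longrightarrow> x \<in> X \<Longrightarrow> 0 \<le> N f x"
  using prepend0_in prepend1_in_iff \<kappa>_pos by (auto simp: N_def)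

lemma N_measurable: assumes "f \<in> borel_measurable m" shows "N f \<in> borel_measurable m"
proof -
  note [measurable] = assms prep0_measurable prep1_measurable le_measurable
  have "(\<lambda>x. (f (prepend 0 x) + (if x \<preceq> shift q then exp t * f (prep1 x) else 0)) / \<kappa>) \<in> borel_measurable m"
    by measurable
  moreover have "N f = (\<lambda>x. (f (prepend 0 x) + (if x \<preceq> shift q then exp t * f (prep1 x) else 0)) / \<kappa>)"
    by (auto simp: fun_eq_iff N_def prep1_def)
  ultimately show ?thesis by simp
qed

lemma N_pow_nonneg: "(\<And>x. x \<in> X \<Longrightarrow> 0 \<le> f x) \<Longrightarrow> x \<in> X \<Longrightarrow> 0 \<le> (N ^^ n) f x"
  by (induction n arbitrary: x) (auto intro: N_nonneg)

lemma N_pow_measurable: "f \<in> borel_measurable m \<Longrightarrow> (N ^^ n) f \<in> borel_measurable m"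
  by (induction n) (auto intro: N_measurable)

text \<open>\<open>nn_transfer\<close> with an indicator for \<open>F\<close>: pushing forward by
  the shift is the normalised operator on densities.\<close>

lemma distr_shift:
  assumes f: "f \<in> borel_measurable m" "\<And>x. x \<in> X \<Longrightarrow> 0 \<le> f x"
  shows "distr (density m (\<lambda>x. ennreal (f x))) m shift = density m (\<lambda>x. ennreal (N f x))"
proof (rule measure_eqI)
  fix A assume "A \<in> sets (distr (density m (\<lambda>x. ennreal (f x))) m shift)"
  then have A: "A \<in> sets m" by simp
  note [measurable] = f(1) A shift_measurable N_measurable[OF f(1)]
  have "emeasure (distr (density m (\<lambda>x. ennreal (f x))) m shift) A = (\<integral>\<^sup>+x. ennreal (f x) * indicator (shift -` A \<inter> space m) x \<partial>m)"
    using measurable_sets[OF shift_measurable A] by (subst emeasure_distr) (auto simp: emeasure_density)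
  also have "\<dots> = (\<integral>\<^sup>+x. indicator A (shift x) * ennreal (f x) \<partial>m)"
    by (rule nn_integral_cong) (auto simp: indicator_def)
  also have "\<dots> = (\<integral>\<^sup>+x. indicator A x * (ennreal (1 / \<kappa>) * (ennreal (f (prepend 0 x)) + (if x \<preceq> shift q then ennreal (exp t) * ennreal (f (prepend 1 x)) else 0))) \<partial>m)"
    by (rule nn_transfer) measurable
  also have "\<dots> = (\<integral>\<^sup>+x. ennreal (N f x) * indicator A x \<partial>m)"
  proof (rule nn_integral_cong)
    fix x assume "x \<in> space m"
    then have x: "x \<in> X" by simp
    have "ennreal (1 / \<kappa>) * (ennreal (f (prepend 0 x)) + (if x \<preceq> shift q then ennreal (exp t) * ennreal (f (prepend 1 x)) else 0)) = ennreal (N f x)"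
      using f(2)[OF prepend0_in[OF x]] f(2)[of "prepend 1 x"] prepend1_in_iff[OF x] \<kappa>_pos
      by (auto simp: N_def ennreal_mult[symmetric] ennreal_plus[symmetric] simp del: ennreal_plus)
    then show "indicator A x * (ennreal (1 / \<kappa>) * (ennreal (f (prepend 0 x)) + (if x \<preceq> shift q then ennreal (exp t) * ennreal (f (prepend 1 x)) else 0))) = ennreal (N f x) * indicator A x"
      by (simp add: mult.commute)
  qed
  also have "\<dots> = emeasure (density m (\<lambda>x. ennreal (N f x))) A" by (simp add: emeasure_density)
  finally show "emeasure (distr (density m (\<lambda>x. ennreal (f x))) m shift) A = emeasure (density m (\<lambda>x. ennreal (N f x))) A" .
qed simp

lemma distr_shift_pow:
  assumes f: "f \<in> borel_measurable m" "\<And>x. x \<in> X \<Longrightarrow> 0 \<le> f x"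
  shows "distr (density m (\<lambda>x. ennreal (f x))) m (shift ^^ n) = density m (\<lambda>x. ennreal ((N ^^ n) f x))"
proof (induction n)
  case 0
  show ?case using distr_id2[of m "density m (\<lambda>x. ennreal (f x))"] by (simp add: id_def)
next
  case (Suc n)
  have s: "shift \<in> measurable m m" "(shift ^^ n) \<in> measurable (density m (\<lambda>x. ennreal (f x))) m"
    using shift_measurable shift_pow_measurable[of n] by (auto cong: measurable_cong_sets)
  have "distr (density m (\<lambda>x. ennreal (f x))) m (shift ^^ Suc n) = distr (distr (density m (\<lambda>x. ennreal (f x))) m (shift ^^ n)) m shift"
    using distr_distr[OF s] by (simp add: o_def)
  also have "\<dots> = density m (\<lambda>x. ennreal ((N ^^ Suc n) f x))"
    unfolding Suc using distr_shift[OF N_pow_measurable[OF f(1)] N_pow_nonneg[OF f(2)], of n] by simp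
  finally show ?case .
qed

end

lemma le_of_all_epsilon:
  fixes x A B :: real
  assumes "\<And>e. e > 0 \<Longrightarrow> x \<le> A + e * B" "0 \<le> B" shows "x \<le> A"
proof (rule field_le_epsilon)
  fix e :: real assume e: "e > 0"
  have "x \<le> A + e / (B + 1) * B" using assms(1)[of "e / (B + 1)"] e assms(2) by simp
  also have "e / (B + 1) * B \<le> e / (B + 1) * (B + 1)" using e assms(2) by (intro mult_left_mono) auto
  also have "e / (B + 1) * (B + 1) = e" using assms(2) by simp
  finally show "x \<le> A + e" by simp
qed

section \<open>The invariant measure\<close>

context positive_pair begin

definition er :: "digits \<Rightarrow> digits \<Rightarrow> real" where "er a = indicator (ival \<beta> zero_seq a)"
definition cq :: "nat \<Rightarrow> real" where "cq n = H n t q / \<kappa> ^ n"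
abbreviation "dens \<equiv> h_density \<beta> t \<kappa>"

lemma er_eq: "x \<in> X \<Longrightarrow> er a x = (if x \<preceq> a then 1 else 0)"
  by (simp add: er_def ival_def zero_seq_le indicator_def)

lemma ind_er: "ind a x = of_real (er a x)"
  by (simp add: ind_def er_def indicator_def)

lemma cq_nonneg: "0 \<le> cq n" using H_pos[of n t q] \<kappa>_pos by (simp add: cq_def)

lemma cq_summable: "summable cq"
  using eigfun_coeff_summable[OF r_less_norm] H_pos[of _ t q] \<kappa>_pos
  by (simp add: cq_def[abs_def] norm_divide norm_power abs_of_pos)

lemma eig_sums: "(\<lambda>n. cq n * er ((shift ^^ n) q) x) sums eigfun \<beta> t \<kappa> x"
proof -
  have "summable (\<lambda>n. cq n * er ((shift ^^ n) q) x)"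
    by (rule summable_comparison_test'[OF cq_summable, of 0])
      (auto simp: er_def indicator_def cq_nonneg)
  then show ?thesis by (simp add: eigfun_def cq_def[symmetric] er_def[symmetric] summable_sums)
qed

lemma eigfun_of_real: "eigfun \<beta> t (of_real \<kappa>) x = (of_real (eigfun \<beta> t \<kappa> x) :: complex)"
proof -
  have "(\<lambda>n. of_real (cq n * er ((shift ^^ n) q) x)) sums (of_real (eigfun \<beta> t \<kappa> x) :: complex)"
    using eig_sums by (subst sums_of_real_iff)
  moreover have "of_real (cq n * er ((shift ^^ n) q) x) = (of_real (H n t q) / of_real \<kappa> ^ n * ind ((shift ^^ n) q) x :: complex)" for n
    by (simp add: cq_def ind_er)
  ultimately show ?thesis unfolding eigfun_series by (simp add: sums_iff)
qed

lemma dens_eq: "dens x = eigfun \<beta> t \<kappa> x / L" by (simp add: h_density_def norm_const_eq)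

lemma dens_sums: "(\<lambda>n. cq n / L * er ((shift ^^ n) q) x) sums dens x"
  using sums_divide[OF eig_sums[of x], of L] by (simp add: dens_eq)

text \<open>The term for \<open>n = 0\<close> alone is \<open>1 / L\<close>, as every point of
  \<open>X\<close> is below \<open>q\<close>. The bound lets integrals of moduli pass between
  \<open>m\<close> and the invariant measure.\<close>

lemma dens_lower: assumes "x \<in> X" shows "1 / L \<le> dens x"
proof -
  have "cq 0 / L * er ((shift ^^ 0) q) x \<le> (\<Sum>n. cq n / L * er ((shift ^^ n) q) x)"
    using sum_le_suminf[OF sums_summable[OF dens_sums[of x]], of "{0}"] cq_nonneg L_pos by (simp add: er_def)
  then show ?thesis using sums_unique[OF dens_sums[of x]] X_le[OF assms] by (simp add: cq_def er_eq[OF assms])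
qed

lemma dens_pos: "x \<in> X \<Longrightarrow> 0 < dens x"
  using dens_lower[of x] L_pos by (meson less_le_trans zero_less_divide_1_iff)

definition hmax :: real where "hmax = (\<Sum>n. cq n / L)"

lemma cqL_summable: "summable (\<lambda>n. cq n / L)" by (rule summable_divide[OF cq_summable])

lemma dens_upper: "dens x \<le> hmax"
proof -
  have "(\<Sum>n. cq n / L * er ((shift ^^ n) q) x) \<le> hmax" unfolding hmax_def
    using cq_nonneg L_pos by (intro suminf_le[OF _ sums_summable[OF dens_sums] cqL_summable]) (auto simp: er_def indicator_def)
  then show ?thesis using sums_unique[OF dens_sums[of x]] by simp
qed

lemma hmax_nonneg: "0 \<le> hmax" unfolding hmax_def using cq_nonneg L_pos by (intro suminf_nonneg cqL_summable) auto

lemma er_measurable: "er a \<in> borel_measurable m"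
  unfolding er_def using ival_sets by (rule borel_measurable_indicator)

lemma dens_measurable: "dens \<in> borel_measurable m"
proof -
  have "(\<lambda>x. Re (eigfun \<beta> t (of_real \<kappa>) x) / L) \<in> borel_measurable m"
    using FF_measurable[OF eigfun_FF[OF r_less_norm]] by measurable
  moreover have "dens = (\<lambda>x. Re (eigfun \<beta> t (of_real \<kappa>) x) / L)" by (simp add: fun_eq_iff dens_eq eigfun_of_real)
  ultimately show ?thesis by simp
qed

lemma dens_integrable: "integrable m dens"
  using dens_measurable dens_upper less_imp_le[OF dens_pos] by (intro pm.integrable_const_bound[of _ hmax]) (auto intro!: AE_I2)

lemma dens_integral: "(\<integral>x. dens x \<partial>m) = 1"
proof -
  have "(\<integral>x. eigfun \<beta> t (of_real \<kappa>) x \<partial>m) = (of_real L :: complex)"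
    using \<nu>_integral[OF eigfun_FF[OF r_less_norm]] \<nu>_eigfun by simp
  then have "of_real (\<integral>x. eigfun \<beta> t \<kappa> x \<partial>m) = (of_real L :: complex)"
    by (simp only: eigfun_of_real integral_complex_of_real)
  then have "(\<integral>x. eigfun \<beta> t \<kappa> x \<partial>m) = L" by (simp only: of_real_eq_iff)
  then show ?thesis using L_pos by (simp add: dens_eq)
qed

section \<open>Iterates of the normalised operator\<close>

lemma N_of_real: assumes "x \<in> X" shows "T (\<lambda>y. of_real (f y)) x = of_real (\<kappa> * N f x)"
  using T_eq[OF assms, of "\<lambda>y. of_real (f y)"] \<kappa>_pos by (simp add: N_def)

lemma N_dens: assumes "x \<in> X" shows "N dens x = dens x"
proof -
  have "eigfun \<beta> t (of_real \<kappa>) = (\<lambda>y. of_real (eigfun \<beta> t \<kappa> y) :: complex)" using eigfun_of_real by blast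
  then have "of_real (\<kappa> * N (eigfun \<beta> t \<kappa>) x) = (of_real (\<kappa> * eigfun \<beta> t \<kappa> x) :: complex)"
    using T_eigfun[OF r_less_norm root assms] N_of_real[OF assms, of "eigfun \<beta> t \<kappa>"] by simp
  then have "N (eigfun \<beta> t \<kappa>) x = eigfun \<beta> t \<kappa> x" unfolding of_real_eq_iff using \<kappa>_pos by simp
  moreover have "N dens x = N (eigfun \<beta> t \<kappa>) x / L" by (simp add: N_def dens_eq[abs_def] add_divide_distrib mult.commute[of L])
  ultimately show ?thesis by (simp add: dens_eq)
qed

lemma N_er:
  assumes "a \<in> X" "x \<in> X"
  shows "N (er a) x = real (a 0) / \<kappa> * er q x + exp (t * real (a 0)) / \<kappa> * er (shift a) x"
proof -
  have "ind a = (\<lambda>y. of_real (er a y))" using ind_er by blast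
  then have "of_real (\<kappa> * N (er a) x) = (of_real (real (a 0) + exp (t * real (a 0)) * er (shift a) x) :: complex)"
    using T_ind[OF assms] N_of_real[OF assms(2), of "er a"] by (simp add: ind_er)
  then have "\<kappa> * N (er a) x = real (a 0) + exp (t * real (a 0)) * er (shift a) x" unfolding of_real_eq_iff .
  then show ?thesis using \<kappa>_pos X_le[OF assms(2)] by (simp add: er_eq[OF assms(2), of q] field_simps)
qed

lemma N_pow_cong: "(\<And>y. y \<in> X \<Longrightarrow> f y = g y) \<Longrightarrow> x \<in> X \<Longrightarrow> (N ^^ n) f x = (N ^^ n) g x"
proof (induction n arbitrary: x)
  case (Suc n)
  then show ?case using prepend0_in[of x] prepend1_in_iff[of x] by (simp add: N_def)
qed simp

lemma N_pow_linear: "(N ^^ n) (\<lambda>y. c * f y + d * g y) x = c * (N ^^ n) f x + d * (N ^^ n) g x"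
proof (induction n arbitrary: x)
  case (Suc n)
  then show ?case by (simp add: N_def add_divide_distrib algebra_simps)
qed simp

text \<open>After \<open>k\<close> steps the indicator has become a multiple of
  \<open>er ((shift ^^ k) b)\<close>; the next step releases a multiple of \<open>er q\<close>,
  which then evolves on its own. For \<open>b = q\<close> and fixed \<open>x\<close> this is a
  renewal equation.\<close>

lemma N_pow_er:
  assumes "b \<in> X" "x \<in> X"
  shows "(N ^^ n) (er b) x = H n t b / \<kappa> ^ n * er ((shift ^^ n) b) x +
    (\<Sum>k<n. real (b k) * H k t b / \<kappa> ^ Suc k * (N ^^ (n - 1 - k)) (er q) x)"
  using assms(1)
proof (induction n arbitrary: b)
  case (Suc n)
  define e where "e = exp (t * real (b 0)) / \<kappa>"
  have sb: "shift b \<in> X" using Suc.prems by (rule X_shift)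
  have "(N ^^ Suc n) (er b) x = (N ^^ n) (N (er b)) x" by (simp add: funpow_swap1)
  also have "\<dots> = (N ^^ n) (\<lambda>y. real (b 0) / \<kappa> * er q y + e * er (shift b) y) x"
    unfolding e_def by (rule N_pow_cong[OF N_er[OF Suc.prems] assms(2)])
  also have "\<dots> = real (b 0) / \<kappa> * (N ^^ n) (er q) x + e * (N ^^ n) (er (shift b)) x" by (rule N_pow_linear)
  also have "e * (N ^^ n) (er (shift b)) x = e * (H n t (shift b) / \<kappa> ^ n * er ((shift ^^ n) (shift b)) x) +
      (\<Sum>k<n. e * (real (shift b k) * H k t (shift b) / \<kappa> ^ Suc k * (N ^^ (n - 1 - k)) (er q) x))"
    unfolding Suc.IH[OF sb] by (simp add: distrib_left sum_distrib_left)
  also have "e * (H n t (shift b) / \<kappa> ^ n * er ((shift ^^ n) (shift b)) x) = H (Suc n) t b / \<kappa> ^ Suc n * er ((shift ^^ Suc n) b) x"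
    by (simp add: H_Suc e_def shift_funpow_Suc del: funpow.simps)
  also have "(\<Sum>k<n. e * (real (shift b k) * H k t (shift b) / \<kappa> ^ Suc k * (N ^^ (n - 1 - k)) (er q) x)) =
      (\<Sum>k<n. real (b (Suc k)) * H (Suc k) t b / \<kappa> ^ Suc (Suc k) * (N ^^ (Suc n - 1 - Suc k)) (er q) x)"
    by (intro sum.cong) (auto simp: H_Suc e_def shift_def)
  finally show ?case
    by (simp add: sum.lessThan_Suc_shift del: sum.lessThan_Suc power_Suc)
qed simp

lemma geometric_convolution_le:
  fixes \<delta> \<theta> :: real assumes "0 < \<delta>" "\<delta> < \<theta>"
  shows "(\<Sum>k<n. \<delta> ^ k * \<theta> ^ (n - 1 - k)) \<le> \<theta> ^ n / (\<theta> - \<delta>)"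
proof -
  have "(\<theta> - \<delta>) * (\<Sum>k<n. \<delta> ^ k * \<theta> ^ (n - 1 - k)) = \<theta> ^ n - \<delta> ^ n"
    using power_diff_sumr2[of \<delta> n \<theta>] by (simp add: mult.commute algebra_simps)
  also have "\<dots> \<le> \<theta> ^ n" using assms by simp
  finally show ?thesis using assms by (simp add: pos_le_divide_eq mult.commute)
qed

text \<open>For \<open>b = q\<close> the renewal theorem applies, with inhomogeneous terms that sum
  to \<open>L * dens x\<close>. A general \<open>b\<close> releases copies of \<open>er q\<close>,
  and the error is a convolution of two exponential sequences.\<close>

lemma er_convergence:
  "\<exists>K \<theta>. 0 < K \<and> 0 < \<theta> \<and> \<theta> < 1 \<and> (\<forall>b\<in>X. \<forall>x\<in>X. \<forall>n. \<bar>(N ^^ n) (er b) x - G b * dens x\<bar> \<le> K * \<theta> ^ n)"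
proof -
  obtain C K \<delta> \<theta> where r: "C > 0" "0 < \<delta>" "\<And>n x. x \<in> X \<Longrightarrow> H n t x / \<kappa> ^ n \<le> C * \<delta> ^ n"
    "0 < K" "\<delta> < \<theta>" "\<theta> < 1" "\<And>v w A n. (\<And>n. v n = w n + (\<Sum>k<n. pr k * v (n - 1 - k))) \<Longrightarrow>
      (\<And>n. \<bar>w n\<bar> \<le> A * \<delta> ^ n) \<Longrightarrow> \<bar>v n - suminf w / L\<bar> \<le> K * A * \<theta> ^ n"
    by (rule renewal) blast
  have vq: "\<bar>(N ^^ n) (er q) x - dens x\<bar> \<le> K * C * \<theta> ^ n" if x: "x \<in> X" for x n
  proof -
    have "\<bar>(N ^^ n) (er q) x - (\<Sum>n. cq n * er ((shift ^^ n) q) x) / L\<bar> \<le> K * C * \<theta> ^ n"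
    proof (rule r(7))
      show "(N ^^ n) (er q) x = cq n * er ((shift ^^ n) q) x + (\<Sum>k<n. pr k * (N ^^ (n - 1 - k)) (er q) x)" for n
        using N_pow_er[OF q_in x, of n] by (simp add: cq_def pr_def)
      show "\<bar>cq n * er ((shift ^^ n) q) x\<bar> \<le> C * \<delta> ^ n" for n
        using r(1,2) r(3)[OF q_in, of n] cq_nonneg[of n] by (auto simp: er_def indicator_def cq_def)
    qed
    then show ?thesis using sums_unique[OF eig_sums[of x]] by (simp add: dens_eq)
  qed
  \<comment> \<open>The first summand bounds the part of \<open>b\<close> not yet released, the
    second the convolution.\<close>
  define K' where "K' = C * (1 + hmax) + K * C * C / (\<theta> - \<delta>)"
  have \<theta>0: "0 < \<theta>" using r by linarith
  have "0 < C * (1 + hmax)" using r(1) hmax_nonneg by (intro mult_pos_pos) auto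
  moreover have "0 < K * C * C / (\<theta> - \<delta>)" using r(1,4,5) by simp
  ultimately have K': "0 < K'" unfolding K'_def by linarith
  have "\<bar>(N ^^ n) (er b) x - G b * dens x\<bar> \<le> K' * \<theta> ^ n" if b: "b \<in> X" and x: "x \<in> X" for b x n
  proof -
    define p where "p k = real (b k) * H k t b / \<kappa> ^ Suc k" for k
    define R where "R = H n t b / \<kappa> ^ n"
    have p: "0 \<le> p k" "p k \<le> C * \<delta> ^ k" for k
      using H_pos[of k t b] \<kappa>_pos coeff_le[OF b r(3)[OF b]] by (auto simp: p_def)
    have R: "0 \<le> R" "R \<le> C * \<delta> ^ n" using H_pos[of n t b] \<kappa>_pos r(3)[OF b, of n] by (auto simp: R_def)
    \<comment> \<open>\<open>G b\<close> is expanded to the same depth \<open>n\<close>, so that the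
      two expansions can be subtracted term by term.\<close>
    have Gb: "G b = (\<Sum>k<n. p k) + R * G ((shift ^^ n) b)"
    proof -
      have "complex_of_real (G b) = of_real ((\<Sum>k<n. p k) + R * G ((shift ^^ n) b))"
        using eigenfunctional_iterate[OF eigf \<nu>_one b, of n] \<kappa>_pos \<nu>_ind(1)[OF b] \<nu>_ind(1)[OF X_shift_pow[OF b, of n]]
        by (simp add: p_def R_def)
      then show ?thesis unfolding of_real_eq_iff .
    qed
    have "(N ^^ n) (er b) x - G b * dens x = R * (er ((shift ^^ n) b) x - G ((shift ^^ n) b) * dens x) +
        (\<Sum>k<n. p k * ((N ^^ (n - 1 - k)) (er q) x - dens x))"
      unfolding N_pow_er[OF b x] Gb R_def[symmetric] p_def[symmetric]
      by (simp add: algebra_simps sum_subtractf sum_distrib_left sum_distrib_right)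
    also have "\<bar>\<dots>\<bar> \<le> C * (1 + hmax) * \<theta> ^ n + K * C * C / (\<theta> - \<delta>) * \<theta> ^ n"
    proof (intro order_trans[OF abs_triangle_ineq] add_mono)
      have Y: "(shift ^^ n) b \<in> X" by (rule X_shift_pow[OF b])
      have h: "0 \<le> dens x" "dens x \<le> hmax" using dens_pos[OF x] dens_upper by auto
      have g: "0 \<le> G ((shift ^^ n) b)" "G ((shift ^^ n) b) \<le> 1" using \<nu>_ind(2)[OF Y] G_le1[OF Y] by auto
      have gh: "0 \<le> G ((shift ^^ n) b) * dens x" "G ((shift ^^ n) b) * dens x \<le> 1 * hmax"
        using g h mult_mono[OF g(2) h(2)] by auto
      have "0 \<le> er ((shift ^^ n) b) x" "er ((shift ^^ n) b) x \<le> 1" by (auto simp: er_def)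
      then have "\<bar>er ((shift ^^ n) b) x - G ((shift ^^ n) b) * dens x\<bar> \<le> 1 + hmax" using gh by linarith
      moreover have "R \<le> C * \<theta> ^ n" using R(2) r(1,2,5) by (meson less_imp_le mult_left_mono order_trans power_mono)
      ultimately have "R * \<bar>er ((shift ^^ n) b) x - G ((shift ^^ n) b) * dens x\<bar> \<le> (C * \<theta> ^ n) * (1 + hmax)"
        using R hmax_nonneg r(1) \<theta>0 by (intro mult_mono) auto
      then show "\<bar>R * (er ((shift ^^ n) b) x - G ((shift ^^ n) b) * dens x)\<bar> \<le> C * (1 + hmax) * \<theta> ^ n"
        using R(1) by (simp add: abs_mult mult_ac)
      have "\<bar>\<Sum>k<n. p k * ((N ^^ (n - 1 - k)) (er q) x - dens x)\<bar> \<le> (\<Sum>k<n. (C * \<delta> ^ k) * (K * C * \<theta> ^ (n - 1 - k)))"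
      proof (rule order_trans[OF sum_abs], rule sum_mono)
        fix k
        show "\<bar>p k * ((N ^^ (n - 1 - k)) (er q) x - dens x)\<bar> \<le> (C * \<delta> ^ k) * (K * C * \<theta> ^ (n - 1 - k))"
          unfolding abs_mult using p[of k] vq[OF x, of "n - 1 - k"] r(1,2) by (intro mult_mono) auto
      qed
      also have "\<dots> = (K * C * C) * (\<Sum>k<n. \<delta> ^ k * \<theta> ^ (n - 1 - k))"
        by (simp add: sum_distrib_left mult_ac)
      also have "\<dots> \<le> (K * C * C) * (\<theta> ^ n / (\<theta> - \<delta>))"
        using geometric_convolution_le[OF r(2,5)] r(1,4) by (intro mult_left_mono) auto
      finally show "\<bar>\<Sum>k<n. p k * ((N ^^ (n - 1 - k)) (er q) x - dens x)\<bar> \<le> K * C * C / (\<theta> - \<delta>) * \<theta> ^ n" by simp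
    qed
    also have "\<dots> = K' * \<theta> ^ n" by (simp add: K'_def distrib_right)
    finally show ?thesis .
  qed
  then show ?thesis using K' \<theta>0 r(6) by blast
qed

lemma N_pow_series:
  assumes "\<And>y. y \<in> X \<Longrightarrow> (\<lambda>j. c j * er (a j) y) sums f y" "x \<in> X"
  shows "(\<lambda>j. c j * (N ^^ n) (er (a j)) x) sums (N ^^ n) f x"
  using assms(2)
proof (induction n arbitrary: x)
  case (Suc n)
  have P: "prepend 0 x \<in> X" using prepend0_in Suc.prems by blast
  show ?case
  proof (cases "x \<preceq> shift q")
    case True
    then have P1: "prepend 1 x \<in> X" using prepend1_in_iff Suc.prems by blast
    have "(\<lambda>j. (c j * (N ^^ n) (er (a j)) (prepend 0 x) + exp t * (c j * (N ^^ n) (er (a j)) (prepend 1 x))) / \<kappa>) sums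
        (((N ^^ n) f (prepend 0 x) + exp t * (N ^^ n) f (prepend 1 x)) / \<kappa>)"
      by (intro sums_divide sums_add sums_mult Suc.IH P P1)
    moreover have "(N ^^ Suc n) h x = ((N ^^ n) h (prepend 0 x) + exp t * (N ^^ n) h (prepend 1 x)) / \<kappa>" for h
      unfolding funpow.simps(2) o_apply by (subst N_def) (simp add: True)
    ultimately show ?thesis by (simp add: algebra_simps del: funpow.simps One_nat_def)
  next
    case False
    have "(N ^^ Suc n) h x = (N ^^ n) h (prepend 0 x) / \<kappa>" for h
      unfolding funpow.simps(2) o_apply by (subst N_def) (simp add: False)
    then show ?thesis using sums_divide[OF Suc.IH[OF P], of \<kappa>] by (simp del: funpow.simps)
  qed
qed (use assms in simp)

text \<open>Intervals starting at 0 intersect in the smaller one, so \<open>er b * dens\<close> is a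
  series of indicators with the coefficients of \<open>dens\<close>. Adding up the errors of
  \<open>er_convergence\<close> costs the factor \<open>hmax\<close>.\<close>

lemma weighted_convergence:
  "\<exists>K \<theta>. 0 < K \<and> 0 < \<theta> \<and> \<theta> < 1 \<and> (\<forall>b\<in>X. \<forall>x\<in>X. \<forall>n.
    \<bar>(N ^^ n) (\<lambda>y. er b y * dens y) x - (\<integral>y. er b y * dens y \<partial>m) * dens x\<bar> \<le> K * \<theta> ^ n)"
proof -
  obtain K \<theta> where K: "0 < K" "0 < \<theta>" "\<theta> < 1" "\<And>b x n. b \<in> X \<Longrightarrow> x \<in> X \<Longrightarrow> \<bar>(N ^^ n) (er b) x - G b * dens x\<bar> \<le> K * \<theta> ^ n"
    using er_convergence by blast
  have "\<bar>(N ^^ n) (\<lambda>y. er b y * dens y) x - (\<integral>y. er b y * dens y \<partial>m) * dens x\<bar> \<le> ((hmax + 1) * K) * \<theta> ^ n"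
    if b: "b \<in> X" and x: "x \<in> X" for b x n
  proof -
    define a where "a j = (if b \<preceq> (shift ^^ j) q then b else (shift ^^ j) q)" for j
    have aX: "a j \<in> X" for j using b X_shift_pow[OF q_in] by (simp add: a_def)
    have s: "(\<lambda>j. cq j / L * er (a j) y) sums (er b y * dens y)" if y: "y \<in> X" for y
    proof -
      have "er b y * er ((shift ^^ j) q) y = er (a j) y" for j
        using y lex.order_trans[of y b "(shift ^^ j) q"] lex.order_trans[of y "(shift ^^ j) q" b] lex.linear[of b "(shift ^^ j) q"]
        by (auto simp: er_eq a_def)
      then have "er b y * (cq j / L * er ((shift ^^ j) q) y) = cq j / L * er (a j) y" for j by (metis mult.left_commute)
      then show ?thesis using sums_mult[OF dens_sums[of y], of "er b y"] by (simp only:)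
    qed
    have I: "(\<lambda>j. cq j / L * G (a j)) sums (\<integral>y. er b y * dens y \<partial>m)"
    proof -
      have sm: "summable (\<lambda>j. cmod (of_real (cq j / L)))" using cqL_summable cq_nonneg L_pos by (simp add: norm_divide)
      have f: "complex_of_real (er b y * dens y) = (\<Sum>j. of_real (cq j / L) * ind (a j) y)" if "y \<in> X" for y
      proof -
        have "(\<lambda>j. of_real (cq j / L * er (a j) y)) sums complex_of_real (er b y * dens y)"
          using s[OF that] by (subst sums_of_real_iff)
        then show ?thesis by (simp add: sums_iff ind_er)
      qed
      have "(\<lambda>j. of_real (cq j / L) * \<nu> (cls \<beta> (ind (a j)))) sums \<nu> (cls \<beta> (\<lambda>y. of_real (er b y * dens y)))"
        by (rule dual_series[OF \<nu>_dual sm f aX])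
      also have "\<nu> (cls \<beta> (\<lambda>y. of_real (er b y * dens y))) = (\<integral>y. of_real (er b y * dens y) \<partial>m)"
        by (rule \<nu>_integral[OF series_FF(1)[OF sm f aX]])
      also have "\<dots> = of_real (\<integral>y. er b y * dens y \<partial>m)" by (rule integral_complex_of_real)
      finally have "(\<lambda>j. of_real (cq j / L * G (a j))) sums complex_of_real (\<integral>y. er b y * dens y \<partial>m)"
        using \<nu>_ind(1)[OF aX] by simp
      then show ?thesis by (subst (asm) sums_of_real_iff)
    qed
    define D where "D j = cq j / L * ((N ^^ n) (er (a j)) x - G (a j) * dens x)" for j
    have "(\<lambda>j. cq j / L * (N ^^ n) (er (a j)) x - cq j / L * G (a j) * dens x) sums
        ((N ^^ n) (\<lambda>y. er b y * dens y) x - (\<integral>y. er b y * dens y \<partial>m) * dens x)"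
      by (intro sums_diff N_pow_series[OF s x] sums_mult2 I)
    then have D: "D sums ((N ^^ n) (\<lambda>y. er b y * dens y) x - (\<integral>y. er b y * dens y \<partial>m) * dens x)"
      unfolding D_def[abs_def] by (simp add: right_diff_distrib mult.assoc)
    have sm: "summable (\<lambda>j. cq j / L * (K * \<theta> ^ n))" by (rule summable_mult2[OF cqL_summable])
    have "norm (suminf D) \<le> (\<Sum>j. cq j / L * (K * \<theta> ^ n))"
    proof (rule norm_suminf_le[OF _ sm])
      show "norm (D j) \<le> cq j / L * (K * \<theta> ^ n)" for j
        using K(4)[OF aX x, of n j] cq_nonneg[of j] L_pos by (auto simp: D_def abs_mult intro!: divide_right_mono mult_left_mono)
    qed
    also have "\<dots> = hmax * (K * \<theta> ^ n)" unfolding hmax_def by (rule suminf_mult2[OF cqL_summable, symmetric])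
    \<comment> \<open>The added 1 keeps the constant positive.\<close>
    also have "\<dots> \<le> (hmax + 1) * (K * \<theta> ^ n)" using K by (intro mult_right_mono) auto
    finally show ?thesis using sums_unique[OF D] by (simp add: mult.assoc)
  qed
  moreover have "0 < (hmax + 1) * K" using hmax_nonneg K by simp
  ultimately show ?thesis using K(2,3) by blast
qed

section \<open>The measure mu and its invariance\<close>

definition \<mu> :: "digits measure" where "\<mu> = density m (\<lambda>x. ennreal (dens x))"

lemma sets_\<mu> [simp]: "sets \<mu> = sets m" and space_\<mu> [simp]: "space \<mu> = X" by (simp_all add: \<mu>_def)

lemma prob_\<mu>: "prob_space \<mu>"
proof (rule prob_spaceI)
  have "emeasure \<mu> (space \<mu>) = (\<integral>\<^sup>+x. ennreal (dens x) * indicator (space m) x \<partial>m)"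
    unfolding \<mu>_def using dens_measurable by (simp add: emeasure_density del: space_m)
  also have "\<dots> = (\<integral>\<^sup>+x. ennreal (dens x) \<partial>m)" by (rule nn_integral_cong) simp
  also have "\<dots> = ennreal (\<integral>x. dens x \<partial>m)"
    using dens_integrable less_imp_le[OF dens_pos] by (intro nn_integral_eq_integral AE_I2) auto
  finally show "emeasure \<mu> (space \<mu>) = 1" by (simp add: dens_integral)
qed

sublocale pmu: prob_space \<mu> by (rule prob_\<mu>)

lemma invariant: "distr \<mu> \<mu> shift = \<mu>"
proof -
  have "distr \<mu> \<mu> shift = distr (density m (\<lambda>x. ennreal (dens x))) m shift"
    unfolding \<mu>_def by (rule distr_cong) auto
  also have "\<dots> = density m (\<lambda>x. ennreal (N dens x))"
    using dens_pos by (intro distr_shift dens_measurable) (simp add: less_imp_le)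
  also have "\<dots> = \<mu>" unfolding \<mu>_def
    using dens_measurable N_measurable[OF dens_measurable] N_dens by (intro density_cong AE_I2) auto
  finally show ?thesis .
qed

lemma shift_\<mu>: "shift \<in> measurable \<mu> \<mu>" "(shift ^^ n) \<in> measurable \<mu> \<mu>"
  using shift_measurable shift_pow_measurable[of n] by (auto simp: \<mu>_def)

lemma invariant_pow: "distr \<mu> \<mu> (shift ^^ n) = \<mu>"
proof (induction n)
  case 0 show ?case using distr_id[of \<mu>] by (simp add: id_def)
next
  case (Suc n)
  have "distr \<mu> \<mu> (shift ^^ Suc n) = distr (distr \<mu> \<mu> (shift ^^ n)) \<mu> shift"
    unfolding funpow.simps(2) by (rule distr_distr[OF shift_\<mu>(1) shift_\<mu>(2)[of n], symmetric])
  then show ?case by (simp only: Suc invariant)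
qed

section \<open>Decay of correlations\<close>

lemma integrable_m:
  fixes g :: "digits \<Rightarrow> complex"
  assumes "integrable \<mu> g"
  shows "integrable m (\<lambda>x. dens x *\<^sub>R g x)" "integrable m g" "g \<in> borel_measurable m"
proof -
  show g: "g \<in> borel_measurable m"
    using borel_measurable_integrable[OF assms] by (simp cong: measurable_cong_sets)
  have nn: "AE x in m. 0 \<le> dens x" using dens_pos by (intro AE_I2) (simp add: less_imp_le)
  show i: "integrable m (\<lambda>x. dens x *\<^sub>R g x)"
    using assms integrable_density[OF g dens_measurable nn] by (simp add: \<mu>_def)
  show "integrable m g"
  proof (rule Bochner_Integration.integrable_bound[OF integrable_scaleR_right[OF i, of L] g], intro AE_I2)
    fix x assume "x \<in> space m"
    then have "1 \<le> L * dens x" using dens_lower[of x] L_pos by (simp add: field_simps)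
    then have "1 * norm (g x) \<le> (L * dens x) * norm (g x)" by (intro mult_right_mono) auto
    then show "norm (g x) \<le> norm (L *\<^sub>R dens x *\<^sub>R g x)" using L_pos dens_pos[of x] \<open>x \<in> space m\<close> by (simp add: abs_mult)
  qed
qed

lemma \<mu>_integral: "g \<in> borel_measurable m \<Longrightarrow> (\<integral>x. g x \<partial>\<mu>) = (\<integral>x. dens x *\<^sub>R g x \<partial>m)" for g :: "digits \<Rightarrow> 'a::{banach, second_countable_topology}"
  unfolding \<mu>_def using dens_pos by (intro integral_density dens_measurable AE_I2) (auto simp: less_imp_le)

text \<open>The iterated shift is moved from \<open>g\<close> to the density, where
  \<open>(N ^^ n) w\<close> is uniformly close to \<open>I * dens\<close>. So only the
  \<open>L1\<close> norm of \<open>g\<close> enters, and \<open>1 \<le> L * dens\<close> converts it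
  from \<open>m\<close> to \<open>\<mu>\<close>.\<close>

lemma correlation_ind:
  fixes K \<theta> :: real
  assumes K: "\<And>b x n. b \<in> X \<Longrightarrow> x \<in> X \<Longrightarrow>
      \<bar>(N ^^ n) (\<lambda>y. er b y * dens y) x - (\<integral>y. er b y * dens y \<partial>m) * dens x\<bar> \<le> K * \<theta> ^ n"
    and "0 \<le> K" "0 \<le> \<theta>" and b: "b \<in> X" and g: "integrable \<mu> g"
  shows "cmod (correlation \<mu> n (ind b) g) \<le> K * L * \<theta> ^ n * (\<integral>x. cmod (g x) \<partial>\<mu>)"
proof -
  note gm = integrable_m[OF g]
  define w where "w y = er b y * dens y" for y
  define I where "I = (\<integral>y. w y \<partial>m)"
  have w0: "0 \<le> w y" if "y \<in> X" for y using dens_pos[OF that] by (simp add: w_def er_def)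
  have wm: "w \<in> borel_measurable m" unfolding w_def[abs_def] using er_measurable[of b] dens_measurable by measurable
  have wn: "(N ^^ n) w \<in> borel_measurable m" by (rule N_pow_measurable[OF wm])
  have wn0: "AE x in m. 0 \<le> (N ^^ n) w x" using N_pow_nonneg[OF w0] by (intro AE_I2) simp
  have ww0: "AE x in m. 0 \<le> w x" using w0 by (intro AE_I2) simp
  have gsm: "(\<lambda>x. g ((shift ^^ n) x)) \<in> borel_measurable m" by (rule measurable_compose[OF shift_pow_measurable gm(3)])
  have spm: "(shift ^^ n) \<in> measurable (density m (\<lambda>x. ennreal (w x))) m" using shift_pow_measurable[of n] by simp
  have 1: "(\<integral>x. ind b x * g ((shift ^^ n) x) \<partial>\<mu>) = (\<integral>x. (N ^^ n) w x *\<^sub>R g x \<partial>m)"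
  proof -
    have "(\<integral>x. ind b x * g ((shift ^^ n) x) \<partial>\<mu>) = (\<integral>x. dens x *\<^sub>R (ind b x * g ((shift ^^ n) x)) \<partial>m)"
      using ind_measurable[of b] gsm by (intro \<mu>_integral) measurable
    also have "\<dots> = (\<integral>x. w x *\<^sub>R g ((shift ^^ n) x) \<partial>m)"
      by (rule Bochner_Integration.integral_cong) (auto simp: w_def ind_er scaleR_conv_of_real)
    also have "\<dots> = (\<integral>x. g ((shift ^^ n) x) \<partial>density m (\<lambda>x. ennreal (w x)))"
      by (rule integral_density[OF gsm wm ww0, symmetric])
    also have "\<dots> = (\<integral>x. g x \<partial>distr (density m (\<lambda>x. ennreal (w x))) m (shift ^^ n))"
      by (rule integral_distr[OF spm gm(3), symmetric])
    also have "\<dots> = (\<integral>x. (N ^^ n) w x *\<^sub>R g x \<partial>m)"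
    proof -
      have "distr (density m (\<lambda>x. ennreal (w x))) m (shift ^^ n) = density m (\<lambda>x. ennreal ((N ^^ n) w x))"
        by (rule distr_shift_pow[OF wm]) (rule w0)
      then show ?thesis using integral_density[OF gm(3) wn wn0] by (simp only:)
    qed
    finally show ?thesis .
  qed
  have 2: "(\<integral>x. ind b x \<partial>\<mu>) = of_real I"
  proof -
    have "(\<integral>x. ind b x \<partial>\<mu>) = (\<integral>x. dens x *\<^sub>R ind b x \<partial>m)" by (rule \<mu>_integral[OF ind_measurable])
    also have "\<dots> = (\<integral>x. of_real (w x) \<partial>m)"
      by (rule Bochner_Integration.integral_cong) (auto simp: w_def ind_er scaleR_conv_of_real)
    finally show ?thesis by (simp add: I_def)
  qed
  have bd: "\<bar>(N ^^ n) w x - I * dens x\<bar> \<le> K * \<theta> ^ n" if "x \<in> X" for x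
    using K[OF b that] unfolding I_def w_def[abs_def] .
  have i1: "integrable m (\<lambda>x. ((N ^^ n) w x - I * dens x) *\<^sub>R g x)"
  proof (rule Bochner_Integration.integrable_bound[OF integrable_scaleR_right[OF gm(2), of "K * \<theta> ^ n"]])
    show "(\<lambda>x. ((N ^^ n) w x - I * dens x) *\<^sub>R g x) \<in> borel_measurable m" using wn dens_measurable gm(3) by measurable
    show "AE x in m. norm (((N ^^ n) w x - I * dens x) *\<^sub>R g x) \<le> norm ((K * \<theta> ^ n) *\<^sub>R g x)"
      using bd assms(2,3) by (intro AE_I2) (auto intro!: mult_right_mono)
  qed
  have i2: "integrable m (\<lambda>x. I *\<^sub>R dens x *\<^sub>R g x)" by (intro integrable_scaleR_right gm)
  have "(\<lambda>x. ((N ^^ n) w x - I * dens x) *\<^sub>R g x + I *\<^sub>R dens x *\<^sub>R g x) = (\<lambda>x. (N ^^ n) w x *\<^sub>R g x)"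
    by (simp add: fun_eq_iff scaleR_left_diff_distrib)
  then have "(\<integral>x. (N ^^ n) w x *\<^sub>R g x \<partial>m) = (\<integral>x. ((N ^^ n) w x - I * dens x) *\<^sub>R g x \<partial>m) + (\<integral>x. I *\<^sub>R dens x *\<^sub>R g x \<partial>m)"
    using Bochner_Integration.integral_add[OF i1 i2] by simp
  moreover have "(\<integral>x. I *\<^sub>R dens x *\<^sub>R g x \<partial>m) = of_real I * (\<integral>x. g x \<partial>\<mu>)"
    using \<mu>_integral[OF gm(3)] by (simp add: scaleR_conv_of_real)
  ultimately have "correlation \<mu> n (ind b) g = (\<integral>x. ((N ^^ n) w x - I * dens x) *\<^sub>R g x \<partial>m)"
    unfolding correlation_def 1 2 by simp
  also have "cmod \<dots> \<le> (\<integral>x. norm (((N ^^ n) w x - I * dens x) *\<^sub>R g x) \<partial>m)" by (rule integral_norm_bound)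
  also have "\<dots> \<le> (\<integral>x. K * \<theta> ^ n * L * (dens x *\<^sub>R cmod (g x)) \<partial>m)"
  proof (rule integral_mono)
    show "integrable m (\<lambda>x. norm (((N ^^ n) w x - I * dens x) *\<^sub>R g x))" using i1 by (rule integrable_norm)
    have "integrable m (\<lambda>x. norm (dens x *\<^sub>R g x))" using gm(1) by (rule integrable_norm)
    then have "integrable m (\<lambda>x. dens x *\<^sub>R cmod (g x))"
      by (rule Bochner_Integration.integrable_cong[THEN iffD1, rotated 2]) (use dens_pos in \<open>auto simp: less_imp_le abs_of_pos\<close>)
    then show "integrable m (\<lambda>x. K * \<theta> ^ n * L * (dens x *\<^sub>R cmod (g x)))" by (rule integrable_mult_right)
    fix x assume "x \<in> space m"
    then have x: "x \<in> X" by simp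
    have "1 \<le> L * dens x" using dens_lower[OF x] L_pos by (simp add: field_simps)
    then have "K * \<theta> ^ n * 1 \<le> K * \<theta> ^ n * (L * dens x)" using assms(2,3) by (intro mult_left_mono) auto
    then have "\<bar>(N ^^ n) w x - I * dens x\<bar> \<le> K * \<theta> ^ n * (L * dens x)" using bd[OF x] by linarith
    then have "\<bar>(N ^^ n) w x - I * dens x\<bar> * cmod (g x) \<le> K * \<theta> ^ n * (L * dens x) * cmod (g x)" by (intro mult_right_mono) auto
    then show "norm (((N ^^ n) w x - I * dens x) *\<^sub>R g x) \<le> K * \<theta> ^ n * L * (dens x *\<^sub>R cmod (g x))" by (simp add: mult_ac)
  qed
  also have "\<dots> = K * L * \<theta> ^ n * (\<integral>x. cmod (g x) \<partial>\<mu>)"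
  proof -
    have "(\<integral>x. cmod (g x) \<partial>\<mu>) = (\<integral>x. dens x *\<^sub>R cmod (g x) \<partial>m)" using gm(3) by (intro \<mu>_integral) measurable
    then show ?thesis by (simp only: integral_mult_right_zero) simp
  qed
  finally show ?thesis .
qed

lemma FF_bounded_ae_\<mu>: assumes "f \<in> FF" "Nm f < e" shows "AE x in \<mu>. cmod (f x) \<le> e"
  unfolding \<mu>_def using FF_bounded_ae[OF assms] dens_measurable by (subst AE_density) auto

lemma composed_integrable:
  fixes g :: "digits \<Rightarrow> complex"
  assumes "integrable \<mu> g"
  shows "integrable \<mu> (\<lambda>x. g ((shift ^^ n) x))"
    "(\<integral>x. cmod (g ((shift ^^ n) x)) \<partial>\<mu>) = (\<integral>x. cmod (g x) \<partial>\<mu>)"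
proof -
  have g: "g \<in> borel_measurable \<mu>" using assms by simp
  show "integrable \<mu> (\<lambda>x. g ((shift ^^ n) x))"
    using assms integrable_distr_eq[OF shift_\<mu>(2)[of n] g] invariant_pow[of n] by simp
  show "(\<integral>x. cmod (g ((shift ^^ n) x)) \<partial>\<mu>) = (\<integral>x. cmod (g x) \<partial>\<mu>)"
    using integral_distr[OF shift_\<mu>(2)[of n], of "\<lambda>x. cmod (g x)"] g invariant_pow[of n] by simp
qed

lemma product_integrable:
  assumes "f \<in> FF" "integrable \<mu> g" shows "integrable \<mu> (\<lambda>x. f x * g ((shift ^^ n) x))" "integrable \<mu> f"
proof -
  have fm: "f \<in> borel_measurable \<mu>" using FF_measurable[OF assms(1)] by (simp cong: measurable_cong_sets)
  have b: "AE x in \<mu>. cmod (f x) \<le> Nm f + 1" by (rule FF_bounded_ae_\<mu>[OF assms(1)]) simp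
  have n0: "0 \<le> Nm f" using Nm_nonneg FF_BV assms(1) by blast
  show "integrable \<mu> f" using fm b by (rule pmu.integrable_const_bound[rotated])
  show "integrable \<mu> (\<lambda>x. f x * g ((shift ^^ n) x))"
  proof (rule Bochner_Integration.integrable_bound[OF integrable_scaleR_right[OF composed_integrable(1)[OF assms(2)], of "Nm f + 1" n]])
    show "(\<lambda>x. f x * g ((shift ^^ n) x)) \<in> borel_measurable \<mu>"
      using fm composed_integrable(1)[OF assms(2), of n] by simp
    show "AE x in \<mu>. norm (f x * g ((shift ^^ n) x)) \<le> norm ((Nm f + 1) *\<^sub>R g ((shift ^^ n) x))"
      using b
    proof eventually_elim
      case (elim x)
      then have "cmod (f x) * cmod (g ((shift ^^ n) x)) \<le> (Nm f + 1) * cmod (g ((shift ^^ n) x))"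
        by (intro mult_right_mono) auto
      then show ?case using n0 by (simp add: norm_mult)
    qed
  qed
qed

lemma correlation_add:
  assumes "f \<in> FF" "f' \<in> FF" "integrable \<mu> g"
  shows "correlation \<mu> n (\<lambda>x. f x + f' x) g = correlation \<mu> n f g + correlation \<mu> n f' g"
  using product_integrable(1)[OF assms(1,3), of n] product_integrable(1)[OF assms(2,3), of n]
    product_integrable(2)[OF assms(1,3)] product_integrable(2)[OF assms(2,3)]
  by (simp add: correlation_def distrib_right)

lemma correlation_cmult: "correlation \<mu> n (\<lambda>x. c * f x) g = c * correlation \<mu> n f g"
  by (simp add: correlation_def right_diff_distrib mult.assoc)

text \<open>No decay, only invariance and the essential supremum of \<open>f\<close>; this absorbs
  the approximation error in the next lemma.\<close>

lemma correlation_trivial_bound: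
  assumes "f \<in> FF" "Nm f < e" "integrable \<mu> g"
  shows "cmod (correlation \<mu> n f g) \<le> 2 * e * (\<integral>x. cmod (g x) \<partial>\<mu>)"
proof -
  note i = product_integrable(1)[OF assms(1,3), of n] product_integrable(2)[OF assms(1,3)] and c = composed_integrable[OF assms(3), of n]
  note b = FF_bounded_ae_\<mu>[OF assms(1,2)]
  have e: "0 \<le> e" using Nm_nonneg[OF FF_BV[OF assms(1)]] assms(2) by linarith
  have "cmod (\<integral>x. f x * g ((shift ^^ n) x) \<partial>\<mu>) \<le> (\<integral>x. cmod (f x * g ((shift ^^ n) x)) \<partial>\<mu>)" by (rule integral_norm_bound)
  also have "\<dots> \<le> (\<integral>x. e * cmod (g ((shift ^^ n) x)) \<partial>\<mu>)"
  proof (rule integral_mono_AE)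
    show "integrable \<mu> (\<lambda>x. cmod (f x * g ((shift ^^ n) x)))" by (rule integrable_norm[OF i(1)])
    show "integrable \<mu> (\<lambda>x. e * cmod (g ((shift ^^ n) x)))"
      by (rule integrable_mult_right) (rule integrable_norm[OF c(1)])
    show "AE x in \<mu>. cmod (f x * g ((shift ^^ n) x)) \<le> e * cmod (g ((shift ^^ n) x))"
      using b by eventually_elim (simp add: norm_mult mult_right_mono)
  qed
  also have "\<dots> = e * (\<integral>x. cmod (g x) \<partial>\<mu>)" using c(2) by simp
  finally have 1: "cmod (\<integral>x. f x * g ((shift ^^ n) x) \<partial>\<mu>) \<le> e * (\<integral>x. cmod (g x) \<partial>\<mu>)" .
  have "cmod (\<integral>x. f x \<partial>\<mu>) \<le> (\<integral>x. cmod (f x) \<partial>\<mu>)" by (rule integral_norm_bound)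
  also have "\<dots> \<le> (\<integral>x. e \<partial>\<mu>)" using i(2) b by (intro integral_mono_AE) auto
  also have "\<dots> = e" using pmu.prob_space by simp
  finally have "cmod (\<integral>x. f x \<partial>\<mu>) * cmod (\<integral>x. g x \<partial>\<mu>) \<le> e * (\<integral>x. cmod (g x) \<partial>\<mu>)"
    using e by (intro mult_mono integral_norm_bound) auto
  then show ?thesis using 1 norm_triangle_ineq4[of "\<integral>x. f x * g ((shift ^^ n) x) \<partial>\<mu>" "(\<integral>x. f x \<partial>\<mu>) * (\<integral>x. g x \<partial>\<mu>)"]
    unfolding correlation_def norm_mult by linarith
qed

text \<open>For a step function the bound for indicators is multiplied by the sum of the moduli of
  the coefficients, which the norm dominates. The remainder \<open>f - s\<close> has arbitrarily
  small norm, so its lack of decay is harmless.\<close>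

lemma exponential_mixing: "\<exists>K>0. \<exists>\<theta>. 0 < \<theta> \<and> \<theta> < 1 \<and> correlation_bound \<beta> \<mu> K \<theta>"
proof -
  obtain K \<theta> where K: "0 < K" "0 < \<theta>" "\<theta> < 1" "\<And>b x n. b \<in> X \<Longrightarrow> x \<in> X \<Longrightarrow>
      \<bar>(N ^^ n) (\<lambda>y. er b y * dens y) x - (\<integral>y. er b y * dens y \<partial>m) * dens x\<bar> \<le> K * \<theta> ^ n"
    using weighted_convergence by blast
  have "cmod (correlation \<mu> n f g) \<le> (K * L) * Nm f * (\<integral>x. cmod (g x) \<partial>\<mu>) * \<theta> ^ n"
    if f: "f \<in> FF" and g: "integrable \<mu> g" for f n and g :: "digits \<Rightarrow> complex"
  proof (rule le_of_all_epsilon)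
    define J where "J = (\<integral>x. cmod (g x) \<partial>\<mu>)"
    have J: "0 \<le> J" unfolding J_def by (rule integral_nonneg_AE) simp
    show "0 \<le> 2 * J + K * L * J * \<theta> ^ n" using J K L_pos by simp
    fix e :: real assume e: "e > 0"
    obtain s z where s: "comb (\<lambda>_. 0) s z" "Nm (\<lambda>x. f x - s x) < e" by (rule FF_approx[OF f e])
    have sF: "s \<in> FF" by (rule comb_FF[OF s(1)])
    obtain A d where A: "finite A" "A \<subseteq> X1" "s = (\<lambda>x. \<Sum>a\<in>A. d a * ind a x)" using comb_repr[OF s(1)] by blast
    have "cmod (correlation \<mu> n (\<lambda>x. \<Sum>a\<in>A. d a * ind a x) g) \<le> (\<Sum>a\<in>A. cmod (d a)) * (K * L * \<theta> ^ n * J) \<and>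
        (\<lambda>x. \<Sum>a\<in>A. d a * ind a x) \<in> FF"
      using A(1,2)
    proof (induction A rule: finite_induct)
      case empty
      then show ?case using FF_zero by (simp add: correlation_def)
    next
      case (insert a A)
      then have a: "a \<in> X" and IH: "cmod (correlation \<mu> n (\<lambda>x. \<Sum>a\<in>A. d a * ind a x) g) \<le> (\<Sum>a\<in>A. cmod (d a)) * (K * L * \<theta> ^ n * J)"
        "(\<lambda>x. \<Sum>a\<in>A. d a * ind a x) \<in> FF" using X1_X by auto
      have aF: "(\<lambda>x. d a * ind a x) \<in> FF" by (intro FF_cmult ind_FF a)
      have "correlation \<mu> n (\<lambda>x. \<Sum>a\<in>insert a A. d a * ind a x) g = d a * correlation \<mu> n (ind a) g + correlation \<mu> n (\<lambda>x. \<Sum>a\<in>A. d a * ind a x) g"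
        using correlation_add[OF aF IH(2) g, of n] insert.hyps by (simp add: correlation_cmult)
      also have "cmod \<dots> \<le> cmod (d a) * (K * L * \<theta> ^ n * J) + (\<Sum>a\<in>A. cmod (d a)) * (K * L * \<theta> ^ n * J)"
      proof (intro order_trans[OF norm_triangle_ineq] add_mono IH(1))
        have "cmod (correlation \<mu> n (ind a) g) \<le> K * L * \<theta> ^ n * J"
          unfolding J_def by (rule correlation_ind[OF K(4) _ _ a g]) (use K in auto)
        then show "cmod (d a * correlation \<mu> n (ind a) g) \<le> cmod (d a) * (K * L * \<theta> ^ n * J)"
          by (simp only: norm_mult mult_left_mono norm_ge_zero)
      qed
      finally show ?case using FF_add[OF aF IH(2)] insert.hyps by (simp add: distrib_right)
    qed
    then have "cmod (correlation \<mu> n s g) \<le> (\<Sum>a\<in>A. cmod (d a)) * (K * L * \<theta> ^ n * J)" using A(3) by simp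
    also have "\<dots> \<le> (Nm f + e) * (K * L * \<theta> ^ n * J)"
    proof (rule mult_right_mono)
      have "(\<Sum>a\<in>A. cmod (d a)) \<le> Nm s" using coefficient_bound_Nm[OF A(1,2)] A(3) by simp
      also have "Nm s \<le> Nm f + Nm (\<lambda>x. f x - s x)"
        using Nm_diff[OF FF_BV[OF f] BV_diff(1)[OF FF_BV[OF f] FF_BV[OF sF]]] by simp
      finally show "(\<Sum>a\<in>A. cmod (d a)) \<le> Nm f + e" using s(2) by simp
      show "0 \<le> K * L * \<theta> ^ n * J" using K L_pos J by simp
    qed
    finally have 1: "cmod (correlation \<mu> n s g) \<le> (Nm f + e) * (K * L * \<theta> ^ n * J)" .
    have 2: "cmod (correlation \<mu> n (\<lambda>x. f x - s x) g) \<le> 2 * e * J"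
      unfolding J_def by (rule correlation_trivial_bound[OF FF_diff[OF f sF] s(2) g])
    have "correlation \<mu> n f g = correlation \<mu> n (\<lambda>x. f x - s x) g + correlation \<mu> n s g"
      using correlation_add[OF FF_diff[OF f sF] sF g, of n] by simp
    then have "cmod (correlation \<mu> n f g) \<le> 2 * e * J + (Nm f + e) * (K * L * \<theta> ^ n * J)"
      using 1 2 norm_triangle_ineq[of "correlation \<mu> n (\<lambda>x. f x - s x) g" "correlation \<mu> n s g"] by simp
    also have "\<dots> = K * L * Nm f * J * \<theta> ^ n + e * (2 * J + K * L * J * \<theta> ^ n)" by (simp add: algebra_simps)
    finally show "cmod (correlation \<mu> n f g) \<le> (K * L) * Nm f * (\<integral>x. cmod (g x) \<partial>\<mu>) * \<theta> ^ n + e * (2 * J + K * L * J * \<theta> ^ n)"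
      by (simp add: J_def)
  qed
  then have "correlation_bound \<beta> \<mu> (K * L) \<theta>" unfolding correlation_bound_def FF_def by auto
  moreover have "0 < K * L" using K L_pos by simp
  ultimately show ?thesis using K by blast
qed

lemma correlation_bound_alpha: "\<exists>K>0. correlation_bound \<beta> \<mu> K (alpha \<beta> t \<kappa>)"
proof -
  obtain K \<theta> where K: "0 < K" "0 < \<theta>" "\<theta> < 1" "correlation_bound \<beta> \<mu> K \<theta>" using exponential_mixing by blast
  have a: "\<theta> \<le> alpha \<beta> t \<kappa>" using alpha_bounds(1) r_rad_ge1 K by linarith
  have "correlation_bound \<beta> \<mu> K (alpha \<beta> t \<kappa>)" unfolding correlation_bound_def
  proof (intro allI impI)
    fix n :: nat and f g :: "digits \<Rightarrow> complex" assume h: "1 \<le> n" "cls \<beta> f \<in> F_space \<beta>" "integrable \<mu> g"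
    have "0 \<le> K * Nm f * (\<integral>x. cmod (g x) \<partial>\<mu>)"
      using K Nm_nonneg[OF FF_BV[of f]] h(2) by (simp add: FF_def)
    then have "K * Nm f * (\<integral>x. cmod (g x) \<partial>\<mu>) * \<theta> ^ n \<le> K * Nm f * (\<integral>x. cmod (g x) \<partial>\<mu>) * alpha \<beta> t \<kappa> ^ n"
      using a K by (intro mult_left_mono power_mono) auto
    then show "cmod (correlation \<mu> n f g) \<le> K * Nm f * (\<integral>x. cmod (g x) \<partial>\<mu>) * alpha \<beta> t \<kappa> ^ n"
      using K(4) h unfolding correlation_bound_def by (meson order_trans)
  qed
  then show ?thesis using K(1) by blast
qed

section \<open>Conclusions for the eigenmeasure and mu\<close>

lemma measure_part:
  "\<exists>m. prob_on_beta_shift \<beta> m \<and> non_atomic m \<and>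
     (\<forall>f. cls \<beta> f \<in> F_space \<beta> \<longrightarrow> integrable m f \<and> \<nu> (cls \<beta> f) = (\<integral>x. f x \<partial>m)) \<and>
     (\<forall>a\<in>X. (\<lambda>n. real (a n) * H n t a / \<kappa> ^ Suc n) sums measure m (ival \<beta> zero_seq a)) \<and>
     (let \<mu> = density m (\<lambda>x. ennreal (h_density \<beta> t \<kappa> x)) in
        prob_on_beta_shift \<beta> \<mu> \<and> shift_invariant \<mu> \<and>
        (\<exists>K>0. correlation_bound \<beta> \<mu> K (alpha \<beta> t \<kappa>)) \<and> exponentially_mixing \<beta> \<mu>)"
proof (intro exI[of _ m] conjI allI impI ballI)
  show "prob_on_beta_shift \<beta> m" by (simp add: prob_on_beta_shift_def prob_m sets_m)
  show "non_atomic m" by (rule non_atomic_m)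
  show "integrable m f" "\<nu> (cls \<beta> f) = (\<integral>x. f x \<partial>m)" if "cls \<beta> f \<in> F_space \<beta>" for f
    using that FF_integrable \<nu>_integral by (auto simp: FF_def)
  show "(\<lambda>n. real (a n) * H n t a / \<kappa> ^ Suc n) sums measure m (ival \<beta> zero_seq a)" if "a \<in> X" for a
    using G_sums[OF that] m_ival[OF that] \<nu>_ind(2)[OF that] by (simp add: measure_def)
  have "prob_on_beta_shift \<beta> \<mu>" by (simp add: prob_on_beta_shift_def prob_\<mu> sets_m)
  moreover have "shift_invariant \<mu>" by (simp add: shift_invariant_def shift_\<mu>(1) invariant)
  ultimately show "let \<mu> = density m (\<lambda>x. ennreal (h_density \<beta> t \<kappa> x)) in
        prob_on_beta_shift \<beta> \<mu> \<and> shift_invariant \<mu> \<and>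
        (\<exists>K>0. correlation_bound \<beta> \<mu> K (alpha \<beta> t \<kappa>)) \<and> exponentially_mixing \<beta> \<mu>"
    using correlation_bound_alpha exponential_mixing
    unfolding \<mu>_def[symmetric] exponentially_mixing_def by simp
qed

end

theorem theorem3p8:
  fixes \<beta> t :: real
  assumes "1 < \<beta>" and "\<beta> \<le> 2"
  shows
    "(\<forall>\<kappa>::complex. isolated_eigenvalue \<beta> t \<kappa> \<and> cmod \<kappa> > r_rad \<beta> t \<longrightarrow>
        has_dim \<beta> (eigenspace \<beta> t \<kappa>) 1 \<and>
        (\<exists>!\<nu>. eigenfunctional \<beta> t \<kappa> \<nu> \<and> \<nu> (B_one \<beta>) = 1) \<and>
        (\<forall>\<nu>. eigenfunctional \<beta> t \<kappa> \<nu> \<and> \<nu> (B_one \<beta>) = 1 \<longrightarrow>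
           (\<forall>a\<in>beta_shift \<beta>.
              (\<lambda>n. of_nat (a n) * of_real (H n t a) / \<kappa> ^ Suc n)
                sums \<nu> (cls \<beta> (indicator (ival \<beta> zero_seq a))))) \<and>
        (\<forall>h\<in>eigenfunctions \<beta> t \<kappa>. \<exists>C. h = cls \<beta> (\<lambda>x. C * eigfun \<beta> t \<kappa> x)))
     \<and>
     (\<forall>\<kappa>t \<nu>t. positive_eigenpair \<beta> t \<kappa>t \<nu>t \<longrightarrow>
        r_rad \<beta> t < \<kappa>t \<and>
        has_dim \<beta> (gen_eigenspace \<beta> t (of_real \<kappa>t)) 1 \<and>
        (\<forall>\<kappa>. isolated_eigenvalue \<beta> t \<kappa> \<and> cmod \<kappa> > r_rad \<beta> t \<and> \<kappa> \<noteq> of_real \<kappa>t \<longrightarrow>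
           cmod \<kappa> < \<kappa>t) \<and>
        r_rad \<beta> t \<le> alpha \<beta> t \<kappa>t \<and> alpha \<beta> t \<kappa>t < \<kappa>t \<and>
        (\<exists>m. prob_on_beta_shift \<beta> m \<and> non_atomic m \<and>
           (\<forall>f. cls \<beta> f \<in> F_space \<beta> \<longrightarrow> integrable m f \<and> \<nu>t (cls \<beta> f) = (\<integral>x. f x \<partial>m)) \<and>
           (\<forall>a\<in>beta_shift \<beta>.
              (\<lambda>n. real (a n) * H n t a / \<kappa>t ^ Suc n) sums measure m (ival \<beta> zero_seq a)) \<and>
           (let \<mu> = density m (\<lambda>x. ennreal (h_density \<beta> t \<kappa>t x)) in
              prob_on_beta_shift \<beta> \<mu> \<and> shift_invariant \<mu> \<and>
              (\<exists>K>0. correlation_bound \<beta> \<mu> K (alpha \<beta> t \<kappa>t)) \<and>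
              exponentially_mixing \<beta> \<mu>)))"
proof -
  interpret beta \<beta> t using assms by unfold_locales
  show ?thesis
  proof (intro conjI allI impI)
    fix \<kappa> :: complex assume "isolated_eigenvalue \<beta> t \<kappa> \<and> cmod \<kappa> > r_rad \<beta> t"
    then have \<kappa>: "r_rad \<beta> t < cmod \<kappa>" "eigenfunctions \<beta> t \<kappa> \<noteq> {}" by (auto simp: isolated_eigenvalue_def)
    note part = eigenvalue_part[OF \<kappa>]
    show "has_dim \<beta> (eigenspace \<beta> t \<kappa>) 1" "\<exists>!\<nu>. eigenfunctional \<beta> t \<kappa> \<nu> \<and> \<nu> (B_one \<beta>) = 1"
      by (fact part)+
    show "\<forall>a\<in>X. (\<lambda>n. of_nat (a n) * of_real (H n t a) / \<kappa> ^ Suc n)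
        sums \<nu> (cls \<beta> (indicator (ival \<beta> zero_seq a)))"
      if "eigenfunctional \<beta> t \<kappa> \<nu> \<and> \<nu> (B_one \<beta>) = 1" for \<nu> using part(3) that by blast
    show "\<forall>h\<in>eigenfunctions \<beta> t \<kappa>. \<exists>C. h = cls \<beta> (\<lambda>x. C * eigfun \<beta> t \<kappa> x)" using part(4) by blast
  next
    fix \<kappa>t \<nu>t assume "positive_eigenpair \<beta> t \<kappa>t \<nu>t"
    then interpret positive_pair \<beta> t \<kappa>t \<nu>t by unfold_locales
    show "r_rad \<beta> t < \<kappa>t" by (rule r_less_\<kappa>)
    show "has_dim \<beta> (gen_eigenspace \<beta> t (of_real \<kappa>t)) 1" by (rule simple)
    show "cmod \<kappa> < \<kappa>t" if "isolated_eigenvalue \<beta> t \<kappa> \<and> cmod \<kappa> > r_rad \<beta> t \<and> \<kappa> \<noteq> of_real \<kappa>t" for \<kappa>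
      using that other_eigenvalue by (auto simp: isolated_eigenvalue_def)
    show "r_rad \<beta> t \<le> alpha \<beta> t \<kappa>t" "alpha \<beta> t \<kappa>t < \<kappa>t" by (fact alpha_bounds)+
    show "\<exists>m. prob_on_beta_shift \<beta> m \<and> non_atomic m \<and>
           (\<forall>f. cls \<beta> f \<in> F_space \<beta> \<longrightarrow> integrable m f \<and> \<nu>t (cls \<beta> f) = (\<integral>x. f x \<partial>m)) \<and>
           (\<forall>a\<in>beta_shift \<beta>.
              (\<lambda>n. real (a n) * H n t a / \<kappa>t ^ Suc n) sums measure m (ival \<beta> zero_seq a)) \<and>
           (let \<mu> = density m (\<lambda>x. ennreal (h_density \<beta> t \<kappa>t x)) in
              prob_on_beta_shift \<beta> \<mu> \<and> shift_invariant \<mu> \<and>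
              (\<exists>K>0. correlation_bound \<beta> \<mu> K (alpha \<beta> t \<kappa>t)) \<and>
              exponentially_mixing \<beta> \<mu>)" by (rule measure_part)
  qed
qed

end
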